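(* Let $N\ge3$, $p_S<p<p_{JL}$ and $n\ge1$. Then $\lambda_n(\gamma)$ oscillates around $\lambda_n^*$ infinitely many times as $\gamma\to\infty$: there is a sequence $\gamma_1<\gamma_2<\cdots\to\infty$ such that $\lambda_n(\gamma_j)-\lambda_n^*$ is nonzero and alternates in sign in $j$.
   Context: $p_S:=\frac{N+2}{N-2}$; $p_{JL}:=1+\frac{4}{N-4-2\sqrt{N-1}}$ if $N\ge11$, $p_{JL}:=\infty$ if $N\le10$. $f(U):=-U+U^p$. For $\gamma>1$, $\lambda_n(\gamma)$ is the square of the $n$-th positive critical point of the solution $u(s,\gamma)$ of $u''+\frac{N-1}{s}u'+f(u)=0$, $u(0)=\gamma$, $u'(0)=0$ (so $(\lambda_n(\gamma),u(\sqrt{\lambda_n(\gamma)}\,r,\gamma))$ is the solution on the $n$-th bifurcation branch of $U''+\frac{N-1}{r}U'+\lambda f(U)=0$, $U'(1)=0$). $\lambda_n^*:=(s_n^* )^2$ where $s_n^*$ is the $n$-th positive critical point of the singular solution $u^*(s):=As^{-\theta}y^*(m^{-1}\log s)$, with $\theta=\frac2{p-1}$, $A=\{\theta(N-2-\theta)\}^{1/(p-1)}$, $m=\{\theta(N-2-\theta)\}^{-1/2}$, $\alpha=m(N-2-2\theta)$, and $y^*$ the unique solution on $\mathbb{R}$ of $y''+\alpha y'-y+y^p-m^2e^{2mt}y=0$ with $y(-\infty)=1$. *)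

theory Defs
  imports "HOL-Analysis.Analysis"
begin

text \<open>Odd extension of the power: U^p for U \<ge> 0 (solutions considered are positive).\<close>
definition fpow :: "real \<Rightarrow> real \<Rightarrow> real" where
  "fpow p x = \<bar>x\<bar> powr (p - 1) * x"

definition fnl :: "real \<Rightarrow> real \<Rightarrow> real" where
  "fnl p x = - x + fpow p x"

definition p_S :: "nat \<Rightarrow> real" where
  "p_S N = (real N + 2) / (real N - 2)"

text \<open>p < p_JL, where p_JL = infinity for N \<le> 10.\<close>
definition below_p_JL :: "nat \<Rightarrow> real \<Rightarrow> bool" where
  "below_p_JL N p \<longleftrightarrow> N \<le> 10 \<or> p < 1 + 4 / (real N - 4 - 2 * sqrt (real N - 1))"

definition radial_ivp :: "nat \<Rightarrow> real \<Rightarrow> real \<Rightarrow> (real \<Rightarrow> real) \<Rightarrow> bool" where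
  "radial_ivp N p gamma u \<longleftrightarrow>
     (\<exists>v. u 0 = gamma \<and> v 0 = 0 \<and>
          (\<forall>s\<ge>0. (u has_real_derivative v s) (at s within {0..})) \<and>
          (\<forall>s>0. (v has_real_derivative (- (real N - 1) / s * v s - fnl p (u s))) (at s)))"

definition nth_crit :: "(real \<Rightarrow> real) \<Rightarrow> nat \<Rightarrow> real" where
  "nth_crit w n = (THE s. s > 0 \<and> deriv w s = 0 \<and>
      finite {t. 0 < t \<and> t < s \<and> deriv w t = 0} \<and>
      card {t. 0 < t \<and> t < s \<and> deriv w t = 0} = n - 1)"

definition lam :: "(real \<Rightarrow> real \<Rightarrow> real) \<Rightarrow> nat \<Rightarrow> real \<Rightarrow> real" where
  "lam u n gamma = (nth_crit (u gamma) n)\<^sup>2"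

definition theta :: "real \<Rightarrow> real" where
  "theta p = 2 / (p - 1)"

definition Acoef :: "nat \<Rightarrow> real \<Rightarrow> real" where
  "Acoef N p = (theta p * (real N - 2 - theta p)) powr (1 / (p - 1))"

definition mcoef :: "nat \<Rightarrow> real \<Rightarrow> real" where
  "mcoef N p = (theta p * (real N - 2 - theta p)) powr (- 1 / 2)"

definition alphacoef :: "nat \<Rightarrow> real \<Rightarrow> real" where
  "alphacoef N p = mcoef N p * (real N - 2 - 2 * theta p)"

definition sing_profile :: "nat \<Rightarrow> real \<Rightarrow> (real \<Rightarrow> real) \<Rightarrow> bool" where
  "sing_profile N p y \<longleftrightarrow>
     (\<exists>w. (\<forall>t. (y has_real_derivative w t) (at t)) \<and>
          (\<forall>t. (w has_real_derivative
                 (- alphacoef N p * w t + y t - fpow p (y t)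
                  + (mcoef N p)\<^sup>2 * exp (2 * mcoef N p * t) * y t)) (at t))) \<and>
     (y \<longlongrightarrow> 1) at_bot"

definition u_sing :: "nat \<Rightarrow> real \<Rightarrow> (real \<Rightarrow> real) \<Rightarrow> real \<Rightarrow> real" where
  "u_sing N p y s = Acoef N p * s powr (- theta p) * y (ln s / mcoef N p)"

definition lam_star :: "nat \<Rightarrow> real \<Rightarrow> (real \<Rightarrow> real) \<Rightarrow> nat \<Rightarrow> real" where
  "lam_star N p y n = (nth_crit (u_sing N p y) n)\<^sup>2"

end

theory Submission
  imports Defs "HOL-Real_Asymp.Real_Asymp"
begin

text \<open>In Emden--Fowler variables \<open>s = exp (m t)\<close>, \<open>u(s) = A s\<^sup>-\<^sup>\<theta> y(t)\<close> the singular solution is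
  the orbit that tends to the equilibrium \<open>(1, 0)\<close> as \<open>t\<close> tends to \<open>-\<infinity>\<close>, while a regular solution
  leaves \<open>(0, 0)\<close> near \<open>t = - ln \<gamma> / (m \<theta>)\<close>, reaches a neighbourhood of \<open>(1, 0)\<close> within a time
  independent of \<open>\<gamma>\<close>, and stays there for a time that tends to infinity with \<open>\<gamma>\<close>. Below the
  Joseph--Lundgren exponent the equilibrium is a stable focus; hence the difference \<open>D\<close> of the two
  orbits decays and turns around the origin more and more often. Consequently, at \<open>s = s\<^sub>n\<^sup>*\<close>, the
  angle of \<open>(D, D')\<close> is a continuous function of \<open>\<gamma>\<close> that tends to \<open>-\<infinity>\<close>, so \<open>D = 0\<close> occurs for
  arbitrarily large \<open>\<gamma>\<close> with either sign of \<open>D'\<close>, that is, with either sign of the derivative of the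
  regular solution at \<open>s\<^sub>n\<^sup>*\<close>. By C\<open>\<^sup>1\<close> convergence this sign decides on which side of \<open>s\<^sub>n\<^sup>*\<close> the
  \<open>n\<close>-th critical point of the regular solution lies.\<close>

section \<open>Calculus lemmas\<close>

text \<open>All estimates have to be uniform in \<gamma>, without an explicit solution at hand. A
  decreasing energy \<open>J\<close>, which takes the growing term of the equation into account,
  provides this: the singular orbit and all regular ones have \<open>J < 0\<close>, and this alone
  gives positivity and bounds. Rotation is measured by a complex logarithm of \<open>z\<close>, the
  difference of orbits in coordinates where the linearised equation is \<open>z' = rate * z\<close>;
  log |z| and the angle are estimated together from z'/z - rate. The final angle tends to
  -\<infinity> only if the angle at the entry time stays bounded above. There the regular orbit has
  y <= 1/2 and the singular one y > 1/2, so the cosine of the entry angle is negative and that angle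
  cannot pass a multiple of 2 \<pi>. A second obstacle is that \<open>nth_crit\<close> is a definite
  description that counts all earlier zeros of the derivative. Another angle, that of (u - 1, u'),
  passes multiples of \<pi> only downwards, which makes the count exact. That the singular solution
  has an n-th critical point at all also requires proof.\<close>

lemma fpow_pos: "0 < x \<Longrightarrow> fpow p x = x powr p"
  by (simp add: fpow_def powr_diff)

lemma fpow_scale: "0 < c \<Longrightarrow> fpow p (c * x) = c powr p * fpow p x"
  by (simp add: fpow_def powr_mult abs_mult powr_diff)

text \<open>Used with exponent p + 1 for the potential \<open>G\<close>. Positivity of solutions is
  a consequence of the energy argument, so the energy must be differentiable across 0 as well; there
  the difference quotient is at most |h| to the power a - 1.\<close>

lemma DERIV_abs_powr:
  fixes a :: real
  assumes "1 < a"
  shows "((\<lambda>x. \<bar>x\<bar> powr a) has_real_derivative a * fpow (a - 1) x) (at x)"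
proof -
  consider "x > 0" | "x < 0" | "x = 0" by linarith
  then show ?thesis
  proof cases
    case 1
    have "((\<lambda>x. x powr a) has_real_derivative a * x powr (a - 1)) (at x)"
      using 1 by (rule has_real_derivative_powr)
    moreover have "eventually (\<lambda>z. z powr a = \<bar>z\<bar> powr a) (nhds x)"
      using eventually_nhds_in_open[of "{0<..}" x] 1 by (auto elim!: eventually_mono)
    ultimately have "((\<lambda>x. \<bar>x\<bar> powr a) has_real_derivative a * x powr (a - 1)) (at x)"
      using DERIV_cong_ev[OF refl _ refl, of "\<lambda>x. x powr a" "\<lambda>x. \<bar>x\<bar> powr a" x] by blast
    then show ?thesis using 1 by (simp add: fpow_pos)
  next
    case 2
    have *: "fpow (a - 1) x = - ((-x) powr (a - 1))"
      using 2 powr_mult_base[of "-x" "a - 2"] by (simp add: fpow_def algebra_simps)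
    have "((\<lambda>x. (-x) powr a) has_real_derivative a * (-x) powr (a - 1) * (-1)) (at x)"
      using 2 by (auto intro!: derivative_eq_intros)
    moreover have "eventually (\<lambda>z. (-z) powr a = \<bar>z\<bar> powr a) (nhds x)"
      using eventually_nhds_in_open[of "{..<0}" x] 2 by (auto elim!: eventually_mono)
    ultimately have "((\<lambda>x. \<bar>x\<bar> powr a) has_real_derivative a * (-x) powr (a - 1) * (-1)) (at x)"
      using DERIV_cong_ev[OF refl _ refl, of "\<lambda>x. (-x) powr a" "\<lambda>x. \<bar>x\<bar> powr a" x] by blast
    with * show ?thesis by simp
  next
    case 3
    have "((\<lambda>h::real. \<bar>h\<bar> powr (a - 1)) \<longlongrightarrow> 0) (at 0)"
      by (rule tendsto_eq_intros | use assms in force)+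
    then have "((\<lambda>h::real. \<bar>h\<bar> powr a / h) \<longlongrightarrow> 0) (at 0)"
    proof (rule Lim_null_comparison[rotated])
      show "eventually (\<lambda>h. norm (\<bar>h\<bar> powr a / h) \<le> \<bar>h\<bar> powr (a - 1)) (at 0)"
        by (auto simp: eventually_at_filter powr_diff)
    qed
    then show ?thesis using 3 assms
      by (simp add: DERIV_def fpow_def)
  qed
qed

section \<open>Differential inequalities\<close>

lemma diff_le_of_deriv_le:
  fixes f :: "real \<Rightarrow> real"
  assumes "a \<le> b" "continuous_on {a..b} f"
    and "\<And>x. a < x \<Longrightarrow> x < b \<Longrightarrow> \<exists>d. (f has_real_derivative d) (at x) \<and> d \<le> C"
  shows "f b - f a \<le> C * (b - a)"
proof -
  have "f b - C * b \<le> f a - C * a"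
  proof (rule DERIV_nonpos_imp_decreasing_open[OF assms(1)])
    show "\<exists>y. ((\<lambda>x. f x - C * x) has_real_derivative y) (at x) \<and> y \<le> 0" if x: "a < x" "x < b" for x
    proof -
      obtain d where "(f has_real_derivative d) (at x)" "d \<le> C" using assms(3)[OF x] by blast
      then show ?thesis by (intro exI[of _ "d - C"]) (auto intro!: derivative_eq_intros)
    qed
  qed (intro continuous_intros assms(2))
  then show ?thesis by (simp add: algebra_simps)
qed

lemma gronwall_le:
  fixes e :: "real \<Rightarrow> real"
  assumes "a \<le> b" "continuous_on {a..b} e"
    and "\<And>x. a < x \<Longrightarrow> x < b \<Longrightarrow> \<exists>d. (e has_real_derivative d) (at x) \<and> d \<le> C * e x"
  shows "e b \<le> e a * exp (C * (b - a))"
proof -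
  have "e b * exp (- C * b) \<le> e a * exp (- C * a)"
  proof (rule DERIV_nonpos_imp_decreasing_open[OF assms(1)])
    show "\<exists>y. ((\<lambda>x. e x * exp (- C * x)) has_real_derivative y) (at x) \<and> y \<le> 0"
      if x: "a < x" "x < b" for x
    proof -
      obtain d where d: "(e has_real_derivative d) (at x)" "d \<le> C * e x" using assms(3)[OF x] by blast
      have "((\<lambda>x. e x * exp (- C * x)) has_real_derivative (d - C * e x) * exp (- C * x)) (at x)"
        by (auto intro!: derivative_eq_intros d simp: algebra_simps)
      moreover have "(d - C * e x) * exp (- C * x) \<le> 0" using d(2) by (simp add: mult_nonpos_nonneg)
      ultimately show ?thesis by blast
    qed
  qed (intro continuous_intros assms(2))
  then have "e b * exp (- C * b) * exp (C * b) \<le> e a * exp (- C * a) * exp (C * b)"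
    by (simp add: mult_right_mono)
  then show ?thesis by (simp add: mult.assoc flip: exp_add) (simp add: algebra_simps)
qed

section \<open>Mean value estimates for real powers\<close>

lemma powr_diff_MVT:
  fixes a b p :: real
  assumes "0 < a" "0 < b"
  obtains x where "min a b \<le> x" "x \<le> max a b" "a powr p - b powr p = p * x powr (p - 1) * (a - b)"
proof -
  have *: "\<exists>x. c \<le> x \<and> x \<le> d \<and> d powr p - c powr p = p * x powr (p - 1) * (d - c)"
    if "0 < c" "c < d" for c d
  proof -
    have "\<exists>z>c. z < d \<and> d powr p - c powr p = (d - c) * (p * z powr (p - 1))"
      by (rule MVT2) (use that in \<open>auto intro!: has_real_derivative_powr\<close>)
    then show ?thesis by (auto simp: mult_ac intro: less_imp_le)
  qed
  consider "a < b" | "b < a" | "a = b" by linarith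
  then show thesis
  proof cases
    case 1
    then obtain x where "a \<le> x" "x \<le> b" "b powr p - a powr p = p * x powr (p - 1) * (b - a)"
      using * assms by blast
    then show ?thesis using 1 by (intro that[of x]) (auto simp: algebra_simps)
  next
    case 2
    then show ?thesis using *[of b a] assms that by (auto simp: min_def max_def split: if_splits)
  next
    case 3
    then show ?thesis by (intro that[of a]) auto
  qed
qed

lemma powr_lipschitz:
  fixes a b p M :: real
  assumes "0 < a" "0 < b" "a \<le> M" "b \<le> M" "1 \<le> p"
  shows "\<bar>a powr p - b powr p\<bar> \<le> p * M powr (p - 1) * \<bar>a - b\<bar>"
proof -
  obtain x where x: "min a b \<le> x" "x \<le> max a b" "a powr p - b powr p = p * x powr (p - 1) * (a - b)"
    using powr_diff_MVT assms by metis
  have "x powr (p - 1) \<le> M powr (p - 1)" using x assms by (intro powr_mono2) auto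
  then show ?thesis using x(3) assms by (simp add: abs_mult mult_right_mono)
qed

text \<open>The derivative of the power is continuous at 1, and the mean value point lies between a
  and b. Two free points near 1 allow the difference of two orbits to be linearised, with an error
  relative to that difference and not to the distance from 1.\<close>

lemma powr_linearization_at_1:
  fixes p :: real
  assumes "0 < \<eta>"
  obtains \<delta> where "0 < \<delta>" "\<delta> < 1"
    "\<And>a b. \<lbrakk>\<bar>a - 1\<bar> \<le> \<delta>; \<bar>b - 1\<bar> \<le> \<delta>\<rbrakk> \<Longrightarrow> \<bar>a powr p - b powr p - p * (a - b)\<bar> \<le> \<eta> * \<bar>a - b\<bar>"
proof -
  have "isCont (\<lambda>x. p * x powr (p - 1)) 1" by (intro continuous_intros) auto
  then have "eventually (\<lambda>x. dist (p * x powr (p - 1)) (p * 1 powr (p - 1)) < \<eta>) (at 1)"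
    using assms unfolding isCont_def tendsto_iff by blast
  then obtain d where d: "0 < d" "\<And>x. \<lbrakk>x \<noteq> 1; dist x 1 < d\<rbrakk> \<Longrightarrow> \<bar>p * x powr (p - 1) - p\<bar> < \<eta>"
    unfolding eventually_at by (auto simp: dist_real_def)
  define \<delta> where "\<delta> = min (d / 2) (1 / 2)"
  show thesis
  proof (rule that[of \<delta>])
    show "0 < \<delta>" "\<delta> < 1" using d by (auto simp: \<delta>_def)
    fix a b assume ab: "\<bar>a - 1\<bar> \<le> \<delta>" "\<bar>b - 1\<bar> \<le> \<delta>"
    have "\<delta> \<le> 1 / 2" by (simp add: \<delta>_def)
    then have pos: "0 < a" "0 < b" using ab by linarith+
    obtain x where x: "min a b \<le> x" "x \<le> max a b" "a powr p - b powr p = p * x powr (p - 1) * (a - b)"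
      using powr_diff_MVT pos by metis
    have "\<bar>x - 1\<bar> \<le> \<delta>" using x ab by (auto simp: abs_le_iff min_def max_def split: if_splits)
    then have "dist x 1 < d" using d by (auto simp: \<delta>_def dist_real_def)
    then have "\<bar>p * x powr (p - 1) - p\<bar> \<le> \<eta>"
      using d(2)[of x] assms by (cases "x = 1") auto
    moreover have "a powr p - b powr p - p * (a - b) = (p * x powr (p - 1) - p) * (a - b)"
      using x(3) by (simp add: algebra_simps)
    ultimately show "\<bar>a powr p - b powr p - p * (a - b)\<bar> \<le> \<eta> * \<bar>a - b\<bar>"
      by (simp add: abs_mult mult_right_mono)
  qed
qed

text \<open>Near t the given logarithm equals \<open>g t + Ln (z x / z t)\<close>: continuity keeps
  the imaginary part of \<open>g x - g t\<close> below \<pi> in modulus, hence in the principal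
  branch, which is differentiable at 1.\<close>

lemma log_has_vector_derivative:
  fixes g z :: "real \<Rightarrow> complex"
  assumes "isCont g t" and ev: "eventually (\<lambda>x. exp (g x) = z x) (nhds t)"
    and z: "(z has_vector_derivative z') (at t)"
  shows "(g has_vector_derivative z' / z t) (at t)"
proof -
  have zt: "exp (g t) = z t" using ev by (rule eventually_nhds_x_imp_x)
  then have nz: "z t \<noteq> 0" by (metis exp_not_eq_zero)
  have d: "((\<lambda>x. z x / z t) has_vector_derivative z' / z t) (at t)"
    using has_vector_derivative_divide[OF z] .
  have "((Ln \<circ> (\<lambda>x. z x / z t)) has_vector_derivative (z' / z t * inverse (z t / z t))) (at t)"
    by (rule field_vector_diff_chain_at[OF d has_field_derivative_Ln]) (use nz in auto)
  then have L: "((\<lambda>x. g t + Ln (z x / z t)) has_vector_derivative (z' / z t)) (at t)"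
    using nz by (auto intro!: derivative_eq_intros simp: o_def)
  have "eventually (\<lambda>x. dist (g x) (g t) < pi) (at t)"
    using assms(1) pi_gt_zero unfolding isCont_def tendsto_iff by blast
  then have "eventually (\<lambda>x. dist (g x) (g t) < pi) (nhds t)"
    unfolding eventually_at_filter by (rule eventually_mono) (use pi_gt_zero in auto)
  then have "eventually (\<lambda>x. g t + Ln (z x / z t) = g x) (nhds t)"
    using ev
  proof eventually_elim
    case (elim x)
    have "\<bar>Im (g x - g t)\<bar> < pi"
      using elim(1) abs_Im_le_cmod[of "g x - g t"] by (simp add: dist_norm)
    moreover have "exp (g x - g t) = z x / z t" using elim(2) zt by (simp add: exp_diff)
    ultimately have "Ln (z x / z t) = g x - g t" by (intro Ln_unique) auto
    then show ?case by simp
  qed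
  note ev2 = this
  have "eventually (\<lambda>x. g t + Ln (z x / z t) = g x) (at t)"
    using ev2 by (simp add: eventually_at_filter eventually_mono)
  moreover have "g t + Ln (z t / z t) = g t"
    using ev2 by (rule eventually_nhds_x_imp_x)
  ultimately show ?thesis
    using has_derivative_transform_eventually[OF L[unfolded has_vector_derivative_def]]
    unfolding has_vector_derivative_def by blast
qed

text \<open>The derivative z'/z of the logarithm stays within K of l; its real part controls log
  |z|, its imaginary part the angle. K may be large on time ranges of bounded length but has to be
  small on a long one.\<close>

lemma log_growth:
  fixes g z z' :: "real \<Rightarrow> complex"
  assumes ab: "a \<le> b" and g: "continuous_on {a..b} g"
    and eq: "\<And>t. t \<in> {a..b} \<Longrightarrow> exp (g t) = z t"
    and z: "\<And>t. a < t \<Longrightarrow> t < b \<Longrightarrow> (z has_vector_derivative z' t) (at t)"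
    and le: "\<And>t. a < t \<Longrightarrow> t < b \<Longrightarrow> norm (z' t - l * z t) \<le> K * norm (z t)"
  shows "Re (g b) - Re (g a) \<le> (Re l + K) * (b - a)"
    and "Im (g b) - Im (g a) \<le> (Im l + K) * (b - a)"
proof -
  have D: "(g has_vector_derivative z' t / z t) (at t)" "norm (z' t / z t - l) \<le> K"
    if t: "a < t" "t < b" for t
  proof -
    have nz: "z t \<noteq> 0" using eq[of t] t by (metis exp_not_eq_zero atLeastAtMost_iff less_imp_le)
    have ic: "isCont g t"
      using continuous_on_interior[OF g] t by (simp add: interior_atLeastAtMost_real)
    have "eventually (\<lambda>x. exp (g x) = z x) (nhds t)"
      using eventually_nhds_in_open[of "{a<..<b}" t] t by (auto elim!: eventually_mono intro!: eq)
    then show "(g has_vector_derivative z' t / z t) (at t)"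
      using log_has_vector_derivative ic z[OF t] by blast
    have "z' t / z t - l = (z' t - l * z t) / z t" using nz by (simp add: field_simps)
    then show "norm (z' t / z t - l) \<le> K"
      using le[OF t] nz by (simp add: norm_divide field_simps)
  qed
  show "Re (g b) - Re (g a) \<le> (Re l + K) * (b - a)"
  proof (rule diff_le_of_deriv_le[OF ab])
    fix t assume t: "a < t" "t < b"
    show "\<exists>d. ((\<lambda>t. Re (g t)) has_real_derivative d) (at t) \<and> d \<le> Re l + K"
      using D[OF t] complex_Re_le_cmod[of "z' t / z t - l"]
      by (intro exI[of _ "Re (z' t / z t)"]) (auto simp: has_vector_derivative_complex_iff)
  qed (intro continuous_intros g)
  show "Im (g b) - Im (g a) \<le> (Im l + K) * (b - a)"
  proof (rule diff_le_of_deriv_le[OF ab])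
    fix t assume t: "a < t" "t < b"
    show "\<exists>d. ((\<lambda>t. Im (g t)) has_real_derivative d) (at t) \<and> d \<le> Im l + K"
      using D[OF t] abs_Im_le_cmod[of "z' t / z t - l"]
      by (intro exI[of _ "Im (z' t / z t)"]) (auto simp: has_vector_derivative_complex_iff)
  qed (intro continuous_intros g)
qed

section \<open>Emden--Fowler variables\<close>

lemma p_S_alt:
  assumes "3 \<le> N" "p_S N < p"
  shows "1 < p" "0 < theta p" "0 < real N - 2 - 2 * theta p"
proof -
  have N: "real N - 2 > 0" using assms(1) by simp
  have "p_S N - 1 = 4 / (real N - 2)" using N by (simp add: p_S_def field_simps)
  then have q: "4 / (real N - 2) < p - 1" using assms(2) by linarith
  moreover have "0 < 4 / (real N - 2)" using N by simp
  ultimately have pos: "0 < p - 1" by linarith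
  then show "1 < p" "0 < theta p" by (auto simp: theta_def)
  have "4 < (real N - 2) * (p - 1)" using q N by (simp add: field_simps)
  then have "2 * (2 / (p - 1)) < real N - 2" using pos by (simp add: field_simps)
  then show "0 < real N - 2 - 2 * theta p" by (simp add: theta_def)
qed

text \<open>Since \<open>theta p = 2 / (p - 1)\<close>, the bound p < p_JL for finite p_JL is this
  inequality solved for theta. If N - 4 - 2 sqrt(N - 1) is not positive, theta > 0 is
  enough.\<close>

lemma below_p_JL_theta:
  assumes "3 \<le> N" "below_p_JL N p" "1 < p"
  shows "real N - 2 - 2 * theta p < 2 + 2 * sqrt (real N - 1)"
proof -
  let ?d = "real N - 4 - 2 * sqrt (real N - 1)"
  have th: "0 < theta p" using assms by (simp add: theta_def)
  show ?thesis
  proof (cases "?d \<le> 0")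
    case True then show ?thesis using th by linarith
  next
    case False
    have "N > 10"
    proof (rule ccontr)
      assume "\<not> N > 10"
      then have N: "real N \<le> 10" "3 \<le> real N" using assms(1) by auto
      \<comment> \<open>The product is 4 (N - 1) - (N - 4)^2; its root at 10 is where p_JL becomes
        infinite.\<close>
      have "(real N - 2) * (10 - real N) \<ge> 0" using N by (intro mult_nonneg_nonneg) auto
      then have "(real N - 4)\<^sup>2 \<le> 4 * (real N - 1)" by (simp add: power2_eq_square algebra_simps)
      then have "\<bar>real N - 4\<bar> \<le> sqrt (4 * (real N - 1))"
        by (metis real_sqrt_abs real_sqrt_le_mono)
      then have "real N - 4 \<le> 2 * sqrt (real N - 1)"
        using real_sqrt_mult[of 4 "real N - 1"] by simp
      with False show False by simp
    qed
    then have "p - 1 < 4 / ?d" using assms(2) by (simp add: below_p_JL_def)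
    then have "?d * (p - 1) < 4" using False by (simp add: field_simps)
    then have "?d < 2 * theta p" using assms(3) by (simp add: theta_def field_simps)
    then show ?thesis by linarith
  qed
qed

locale exponents =
  fixes N :: nat and p :: real
  assumes N3: "3 \<le> N" and supercritical: "p_S N < p" and sub_JL: "below_p_JL N p"
begin

definition "th = theta p"
definition "A = Acoef N p"
definition "m = mcoef N p"
definition "al = alphacoef N p"
text \<open>Linearising at y = 1 without the exponential term gives D'' + al D' + (p - 1) D = 0 with
  eigenvalues -al/2 +- i om; a positive radicand means that the equilibrium is a focus.\<close>

definition "om = sqrt (p - 1 - al\<^sup>2 / 4)"

lemma p1: "1 < p" and th_pos: "0 < th" and dim_pos: "0 < real N - 2 - 2 * th"
  using p_S_alt[OF N3 supercritical] by (auto simp: th_def)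

lemma th_p: "th * (p - 1) = 2"
  using p1 by (simp add: th_def theta_def field_simps)

lemma mass_pos: "0 < th * (real N - 2 - th)"
  using th_pos dim_pos by (intro mult_pos_pos) auto

lemma m_pos: "0 < m" and A_pos: "0 < A"
  using mass_pos by (auto simp: m_def mcoef_def A_def Acoef_def th_def)

lemma m_sq: "m\<^sup>2 * (th * (real N - 2 - th)) = 1"
  using mass_pos
  by (simp add: m_def mcoef_def th_def powr_minus powr_half_sqrt power2_eq_square field_simps)

lemma A_powr: "A powr (p - 1) * m\<^sup>2 = 1"
proof -
  have "A powr (p - 1) = th * (real N - 2 - th)"
    using mass_pos p1 by (simp add: A_def Acoef_def th_def powr_powr)
  then show ?thesis using m_sq by (simp add: mult.commute)
qed

lemma al_eq: "al = m * (real N - 2 - 2 * th)"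
  by (simp add: al_def m_def th_def alphacoef_def)

lemma al_pos: "0 < al"
  using m_pos dim_pos by (simp add: al_eq)

text \<open>With x = N - 2 - 2 th, al = m x and th (p - 1) = 2, the focus condition al^2 < 4 (p - 1)
  reads x^2 < 4 x + 4 (N - 2), that is, (x - 2)^2 < 4 (N - 1), which follows from the
  Joseph-Lundgren bound on x.\<close>

lemma om_pos: "0 < om" and om_sq: "om\<^sup>2 = p - 1 - al\<^sup>2 / 4"
proof -
  define x where "x = real N - 2 - 2 * th"
  define r where "r = sqrt (real N - 1)"
  have r: "r\<^sup>2 = real N - 1" "0 \<le> r" using N3 by (auto simp: r_def)
  have x: "0 < x" "x < 2 + 2 * r"
    using below_p_JL_theta[OF N3 sub_JL p1] dim_pos by (auto simp: x_def r_def th_def)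
  have "(x - 2)\<^sup>2 < (2 * r)\<^sup>2"
  proof -
    have "1 < r" using N3 by (simp add: r_def)
    then have "0 < (2 * r - (x - 2)) * (2 * r + (x - 2))" using x by (intro mult_pos_pos) auto
    then show ?thesis by (simp add: power2_eq_square algebra_simps)
  qed
  then have "x\<^sup>2 < 4 * x + 4 * (real N - 2)" using r(1) by (simp add: power2_eq_square algebra_simps)
  also have "\<dots> = 8 * (real N - 2 - th)" by (simp add: x_def algebra_simps)
  also have "\<dots> = 4 * (p - 1) * (th * (real N - 2 - th))"
  proof -
    have "4 * (p - 1) * (th * (real N - 2 - th)) = 4 * (th * (p - 1)) * (real N - 2 - th)"
      by (simp add: mult_ac)
    then show ?thesis by (simp add: th_p)
  qed
  finally have "m\<^sup>2 * x\<^sup>2 < m\<^sup>2 * (4 * (p - 1) * (th * (real N - 2 - th)))"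
    using m_pos by (intro mult_strict_left_mono) auto
  also have "\<dots> = 4 * (p - 1)" using m_sq by (simp add: mult_ac)
  finally have "al\<^sup>2 < 4 * (p - 1)" by (simp add: al_eq x_def power_mult_distrib)
  then have "0 < p - 1 - al\<^sup>2 / 4" by simp
  then show "0 < om" "om\<^sup>2 = p - 1 - al\<^sup>2 / 4" by (auto simp: om_def)
qed

text \<open>No condition at 0, so that the singular solution is covered too.\<close>

definition radial_solution :: "(real \<Rightarrow> real) \<Rightarrow> (real \<Rightarrow> real) \<Rightarrow> bool" where
  "radial_solution u v \<longleftrightarrow> (\<forall>s>0. (u has_real_derivative v s) (at s) \<and>
     (v has_real_derivative - (real N - 1) / s * v s - fnl p (u s)) (at s))"

definition ef_solution :: "(real \<Rightarrow> real) \<Rightarrow> (real \<Rightarrow> real) \<Rightarrow> bool" where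
  "ef_solution y w \<longleftrightarrow> (\<forall>t. (y has_real_derivative w t) (at t) \<and>
     (w has_real_derivative
        - al * w t + y t - fpow p (y t) + m\<^sup>2 * exp (2 * m * t) * y t) (at t))"

definition ef_y :: "(real \<Rightarrow> real) \<Rightarrow> real \<Rightarrow> real" where
  "ef_y u t = exp (m * th * t) / A * u (exp (m * t))"

definition ef_w :: "(real \<Rightarrow> real) \<Rightarrow> (real \<Rightarrow> real) \<Rightarrow> real \<Rightarrow> real" where
  "ef_w u v t = m * (exp (m * th * t) / A) * (th * u (exp (m * t)) + exp (m * t) * v (exp (m * t)))"

text \<open>The derivative of \<open>u_sing N p y\<close> when \<open>w\<close> is the derivative of
  \<open>y\<close>.\<close>

definition rad_v :: "(real \<Rightarrow> real) \<Rightarrow> (real \<Rightarrow> real) \<Rightarrow> real \<Rightarrow> real" where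
  "rad_v y w s = A * s powr (- th - 1) * (w (ln s / m) / m - th * y (ln s / m))"

text \<open>\<open>th * (p - 1) = 2\<close> makes the exponentials match and
  \<open>A powr (p - 1) * m\<^sup>2 = 1\<close> fixes the constant: this is why th, A and m are
  chosen so, and why the power has coefficient 1 in the new equation.\<close>

lemma fpow_ef:
  "m\<^sup>2 * exp (2 * m * t) * (exp (m * th * t) / A) * fpow p x = fpow p (exp (m * th * t) / A * x)"
proof -
  define c where "c = exp (m * th * t) / A"
  have c: "0 < c" using A_pos by (simp add: c_def)
  have "exp (m * th * t) powr (p - 1) = exp (2 * m * t)"
  proof -
    have "(p - 1) * (m * th * t) = 2 * m * t" using th_p by (metis mult.assoc mult.commute)
    then show ?thesis by (simp add: powr_def)
  qed
  then have "c powr (p - 1) = exp (2 * m * t) * m\<^sup>2"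
    using A_powr A_pos by (simp add: c_def powr_divide field_simps)
  then have "c powr p = m\<^sup>2 * exp (2 * m * t) * c"
    using c powr_mult_base[of c "p - 1"] by (simp add: mult_ac)
  then show ?thesis using fpow_scale[OF c] by (simp add: c_def)
qed

lemma ef_solution_of_radial:
  assumes "radial_solution u v"
  shows "ef_solution (ef_y u) (ef_w u v)"
  unfolding ef_solution_def
proof (intro allI conjI)
  fix t
  let ?s = "exp (m * t)"
  have "0 < ?s" by simp
  with assms have u: "(u has_real_derivative v ?s) (at ?s)"
    and v: "(v has_real_derivative - (real N - 1) / ?s * v ?s - fnl p (u ?s)) (at ?s)"
    unfolding radial_solution_def by blast+
  have e: "((\<lambda>t. exp (m * t)) has_real_derivative m * ?s) (at t)"
    by (auto intro!: derivative_eq_intros)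
  note du = DERIV_chain2[OF u e] and dv = DERIV_chain2[OF v e]
  define E where "E = exp (m * th * t) / A"
  have dE: "((\<lambda>t. exp (m * th * t) / A) has_real_derivative m * th * E) (at t)"
    using A_pos by (auto intro!: derivative_eq_intros simp: E_def)
  show "(ef_y u has_real_derivative ef_w u v t) (at t)"
    unfolding ef_y_def ef_w_def
    by (rule derivative_eq_intros du dE refl)+ (use A_pos in \<open>simp add: E_def algebra_simps\<close>)
  have "(ef_w u v has_real_derivative
      m * (m * th * E) * (th * u ?s + ?s * v ?s) +
      m * E * (th * (v ?s * (m * ?s)) + (m * ?s * v ?s +
         ?s * ((- (real N - 1) / ?s * v ?s - fnl p (u ?s)) * (m * ?s))))) (at t)"
    unfolding ef_w_def
    by (rule DERIV_cong[OF DERIV_mult[OF DERIV_cmult[OF dE, of m]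
          DERIV_add[OF DERIV_cmult[OF du, of th] DERIV_mult[OF e dv]]]])
      (unfold E_def[symmetric], simp add: algebra_simps)
  moreover have "m * (m * th * E) * (th * u ?s + ?s * v ?s) +
      m * E * (th * (v ?s * (m * ?s)) + (m * ?s * v ?s +
         ?s * ((- (real N - 1) / ?s * v ?s - fnl p (u ?s)) * (m * ?s))))
    = - al * ef_w u v t + ef_y u t - fpow p (ef_y u t) + m\<^sup>2 * exp (2 * m * t) * ef_y u t"
  proof -
    have s2: "exp (2 * m * t) = ?s * ?s" by (simp flip: exp_add)
    have "fpow p (ef_y u t) = m\<^sup>2 * exp (2 * m * t) * E * fpow p (u ?s)"
      by (simp only: ef_y_def E_def fpow_ef)
    \<comment> \<open>The identity m^2 th (N - 2 - th) = 1 produces the linear term with coefficient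
      1.\<close>
    moreover have "E * u ?s = m\<^sup>2 * (th * (real N - 2 - th)) * (E * u ?s)"
      by (simp only: m_sq mult_1)
    moreover have "?s * ((- (real N - 1) / ?s * v ?s - fnl p (u ?s)) * (m * ?s)) =
      - m * (real N - 1) * (?s * v ?s) - m * (?s * ?s) * fnl p (u ?s)"
      by (simp add: field_simps)
    ultimately show ?thesis
      unfolding al_eq fnl_def s2 ef_y_def ef_w_def E_def[symmetric]
      by (simp only:) (simp add: algebra_simps power2_eq_square)
  qed
  ultimately show "(ef_w u v has_real_derivative
      - al * ef_w u v t + ef_y u t - fpow p (ef_y u t) + m\<^sup>2 * exp (2 * m * t) * ef_y u t) (at t)"
    by simp
qed

lemma u_sing_ef: "0 < s \<Longrightarrow> u_sing N p y s = A / exp (m * th * (ln s / m)) * y (ln s / m)"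
  using m_pos by (simp add: u_sing_def A_def[symmetric] th_def[symmetric] m_def[symmetric]
    powr_def exp_minus field_simps)

text \<open>The singular solution is given through its profile y only, whereas critical points and
  their counting angle belong to the radial variable.\<close>

lemma radial_solution_of_ef:
  assumes "ef_solution y w"
  shows "radial_solution (u_sing N p y) (rad_v y w)"
  unfolding radial_solution_def
proof (intro allI impI conjI)
  fix s :: real assume s: "0 < s"
  let ?t = "ln s / m"
  from assms have y: "(y has_real_derivative w ?t) (at ?t)"
    and w: "(w has_real_derivative
        - al * w ?t + y ?t - fpow p (y ?t) + m\<^sup>2 * exp (2 * m * ?t) * y ?t) (at ?t)"
    unfolding ef_solution_def by blast+
  have l: "((\<lambda>s. ln s / m) has_real_derivative 1 / (s * m)) (at s)"
    using s m_pos by (auto intro!: derivative_eq_intros simp: field_simps)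
  note dy = DERIV_chain2[OF y l] and dw = DERIV_chain2[OF w l]
  have us: "u_sing N p y = (\<lambda>s. A * s powr (- th) * y (ln s / m))"
    by (simp add: fun_eq_iff u_sing_def A_def th_def m_def)
  have pd: "((\<lambda>s. s powr c) has_real_derivative c * s powr (c - 1)) (at s)" for c
    using s by (rule has_real_derivative_powr)
  have sp: "s powr c = s powr (c - 1) * s" for c
    using s powr_mult_base[of s "c - 1"] by (simp add: mult.commute)
  show "(u_sing N p y has_real_derivative rad_v y w s) (at s)"
    unfolding us rad_v_def
    by (rule DERIV_cong[OF DERIV_mult[OF DERIV_cmult[OF pd] dy]])
      (use m_pos s sp[of "-th"] in \<open>simp add: field_simps\<close>)
  define Q where "Q = A * s powr (- th - 2)"
  have "- th - 1 - 1 = - th - 2" by simp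
  note e1 = this
  then have sp2: "s powr (- th - 1) = s powr (- th - 2) * s" using sp[of "- th - 1"] by metis
  then have Q1: "A * s powr (- th - 1) = Q * s" by (simp add: Q_def)
  have Q0: "A * s powr (- th) = Q * s * s" by (simp only: Q_def sp[of "- th"] sp2 mult.assoc)
  have Qd: "((\<lambda>s. A * s powr (- th - 1)) has_real_derivative (- th - 1) * Q) (at s)"
    using DERIV_cmult[OF pd, of A "- th - 1"] unfolding e1 by (simp add: Q_def mult_ac)
  have "(rad_v y w has_real_derivative
     (- th - 1) * Q * (w ?t / m - th * y ?t) +
     ((- al * w ?t + y ?t - fpow p (y ?t) + m\<^sup>2 * exp (2 * m * ?t) * y ?t) * (1 / (s * m)) / m
        - th * (w ?t * (1 / (s * m)))) * (Q * s)) (at s)"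
    unfolding rad_v_def 
    by (rule DERIV_cong[OF DERIV_mult[OF Qd
          DERIV_diff[OF DERIV_cdivide[OF dw, of m] DERIV_cmult[OF dy, of th]]]]) (simp add: Q1)
  moreover have "(- th - 1) * Q * (w ?t / m - th * y ?t) +
     ((- al * w ?t + y ?t - fpow p (y ?t) + m\<^sup>2 * exp (2 * m * ?t) * y ?t) * (1 / (s * m)) / m
        - th * (w ?t * (1 / (s * m)))) * (Q * s)
     = - (real N - 1) / s * rad_v y w s - fnl p (u_sing N p y s)"
  proof -
    have "2 * m * ?t = ln s + ln s" using m_pos by simp
    then have e: "exp (2 * m * ?t) = s * s" using s by (simp only: exp_add exp_ln)
    have u: "u_sing N p y s = Q * s * s * y ?t" by (simp add: us Q0)
    have E: "exp (m * th * ?t) / A * (Q * s * s) = 1"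
    proof -
      have "exp (m * th * ?t) = s powr th" using s m_pos by (simp add: powr_def)
      then show ?thesis unfolding Q0[symmetric] using s A_pos by (simp add: powr_minus)
    qed
    have yE: "exp (m * th * ?t) / A * u_sing N p y s = y ?t"
      using E u by (metis mult.assoc mult_1_left)
    have "m\<^sup>2 * (s * s) * (exp (m * th * ?t) / A) * fpow p (u_sing N p y s) = fpow p (y ?t)"
      using fpow_ef[of ?t "u_sing N p y s"] unfolding e yE by (simp only: mult_ac)
    then have "fpow p (y ?t) * Q = m\<^sup>2 * fpow p (u_sing N p y s) * (exp (m * th * ?t) / A * (Q * s * s))"
      by (simp only: mult_ac)
    then have f: "fpow p (y ?t) * Q = m\<^sup>2 * fpow p (u_sing N p y s)" by (simp only: E mult_1_right)
    have r: "rad_v y w s = Q * s * (w ?t / m - th * y ?t)" by (simp add: rad_v_def Q1)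
    have y1: "y ?t = m\<^sup>2 * (th * (real N - 2 - th)) * y ?t" by (simp only: m_sq mult_1)
    have h1: "Q * y ?t / (m * m) = Q * (th * (real N - 2 - th)) * y ?t"
      by (subst y1) (use m_pos in \<open>simp add: power2_eq_square\<close>)
    have h2: "Q * fpow p (y ?t) / (m * m) = fpow p (u_sing N p y s)"
      using f m_pos by (simp add: power2_eq_square field_simps)
    have h3: "((- al * w ?t + y ?t - fpow p (y ?t) + m\<^sup>2 * exp (2 * m * ?t) * y ?t) * (1 / (s * m)) / m
        - th * (w ?t * (1 / (s * m)))) * (Q * s) =
       - (al * w ?t * Q / (m * m)) + Q * y ?t / (m * m) - Q * fpow p (y ?t) / (m * m) + Q * s * s * y ?t
       - th * Q * (w ?t / m)"
      using s m_pos unfolding e by (simp add: power2_eq_square field_simps)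
    have h4: "al * w ?t * Q / (m * m) = (real N - 2 - 2 * th) * Q * (w ?t / m)"
      using m_pos by (simp add: al_eq)
    have h5: "- (real N - 1) / s * rad_v y w s = - ((real N - 1) * Q * (w ?t / m - th * y ?t))"
      using s by (simp add: r) (metis minus_diff_eq minus_mult_left mult.assoc)
    have h6: "fnl p (u_sing N p y s) = - (Q * s * s * y ?t) + fpow p (u_sing N p y s)"
      by (simp add: fnl_def u)
    define k where "k = w ?t / m"
    show ?thesis
      unfolding h3 h4 h5 h6 h1 h2 k_def[symmetric] by (simp add: right_diff_distrib left_diff_distrib distrib_left distrib_right)
  qed
  ultimately show "(rad_v y w has_real_derivative
      - (real N - 1) / s * rad_v y w s - fnl p (u_sing N p y s)) (at s)" by simp
qed

end

section \<open>The Lyapunov functional in Emden--Fowler variables\<close>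

context exponents
begin

definition G :: "real \<Rightarrow> real" where
  "G y = \<bar>y\<bar> powr (p + 1) / (p + 1) - y\<^sup>2 / 2"

text \<open>Energy of the Emden-Fowler equation with the growing coefficient m^2 exp(2 m t) put into
  the potential. Both the damping and the growth of that coefficient make it decrease.\<close>

definition J :: "(real \<Rightarrow> real) \<Rightarrow> (real \<Rightarrow> real) \<Rightarrow> real \<Rightarrow> real" where
  "J y w t = (w t)\<^sup>2 / 2 + G (y t) - m\<^sup>2 * exp (2 * m * t) * (y t)\<^sup>2 / 2"

text \<open>Covers the singular orbit and all regular ones at once; estimates for this class have
  constants independent of \<gamma>.\<close>

definition bound_solution :: "(real \<Rightarrow> real) \<Rightarrow> (real \<Rightarrow> real) \<Rightarrow> bool" where
  "bound_solution y w \<longleftrightarrow> ef_solution y w \<and> (\<forall>t. 0 < y t \<and> J y w t < 0)"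

lemma G_deriv: "(G has_real_derivative fpow p y - y) (at y)"
proof -
  have "((\<lambda>y. \<bar>y\<bar> powr (p + 1)) has_real_derivative (p + 1) * fpow p y) (at y)"
    using DERIV_abs_powr[of "p + 1" y] p1 by simp
  moreover have "((\<lambda>y. y\<^sup>2 / 2) has_real_derivative y) (at y)"
    by (auto intro!: derivative_eq_intros)
  ultimately have "((\<lambda>y. \<bar>y\<bar> powr (p + 1) / (p + 1) - y\<^sup>2 / 2) has_real_derivative
      (p + 1) * fpow p y / (p + 1) - y) (at y)"
    by (intro DERIV_diff DERIV_cdivide)
  then show ?thesis using p1 by (simp add: G_def[abs_def])
qed

lemma ef_D:
  assumes "ef_solution y w"
  shows "(y has_real_derivative w t) (at t)"
    and "(w has_real_derivative
      - al * w t + y t - fpow p (y t) + m\<^sup>2 * exp (2 * m * t) * y t) (at t)"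
  using assms by (auto simp: ef_solution_def)

lemma ef_continuous:
  assumes "ef_solution y w"
  shows "continuous_on S y" "continuous_on S w"
  by (blast intro: continuous_at_imp_continuous_on DERIV_isCont[OF ef_D(1)[OF assms]]
        DERIV_isCont[OF ef_D(2)[OF assms]])+

lemma J_deriv:
  assumes "ef_solution y w"
  shows "(J y w has_real_derivative
    - (al * (w t)\<^sup>2 + m\<^sup>2 * m * exp (2 * m * t) * (y t)\<^sup>2)) (at t)"
proof -
  note y = ef_D(1)[OF assms, of t] and w = ef_D(2)[OF assms, of t]
  have "((\<lambda>t. (w t)\<^sup>2 / 2 + G (y t) - m\<^sup>2 * exp (2 * m * t) * (y t)\<^sup>2 / 2) has_real_derivative
    w t * (- al * w t + y t - fpow p (y t) + m\<^sup>2 * exp (2 * m * t) * y t)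
    + (fpow p (y t) - y t) * w t
    - (m\<^sup>2 * exp (2 * m * t) * (m * (y t)\<^sup>2 + y t * w t))) (at t)"
    by (auto intro!: derivative_eq_intros y w DERIV_chain2[OF G_deriv y]) (simp add: algebra_simps)
  then show ?thesis
    unfolding J_def[abs_def] by (rule DERIV_cong) (simp add: power2_eq_square algebra_simps)
qed

lemma J_antimono:
  assumes "ef_solution y w" "s \<le> t"
  shows "J y w t \<le> J y w s"
  using assms(2)
proof (rule DERIV_nonpos_imp_nonincreasing)
  fix x
  show "\<exists>d. (J y w has_real_derivative d) (at x) \<and> d \<le> 0"
  proof (intro exI conjI)
    show "(J y w has_real_derivative
      - (al * (w x)\<^sup>2 + m\<^sup>2 * m * exp (2 * m * x) * (y x)\<^sup>2)) (at x)"
      by (rule J_deriv[OF assms(1)])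
    have "0 \<le> al * (w x)\<^sup>2 + m\<^sup>2 * m * exp (2 * m * x) * (y x)\<^sup>2"
      using al_pos m_pos by (intro add_nonneg_nonneg mult_nonneg_nonneg) auto
    then show "- (al * (w x)\<^sup>2 + m\<^sup>2 * m * exp (2 * m * x) * (y x)\<^sup>2) \<le> 0" by simp
  qed
qed

text \<open>\<open>J\<close> starts from a nonpositive limit and decreases, strictly while y > 0,
  hence is negative at all times. A zero of y would force \<open>J = w\<^sup>2 / 2\<close>, which is
  not negative, so positivity propagates from -\<infinity> to all times.\<close>

lemma bound_solutionI:
  assumes ef: "ef_solution y w" and lim: "(J y w \<longlongrightarrow> L) at_bot" "L \<le> 0"
    and pos: "eventually (\<lambda>t. 0 < y t) at_bot"
  shows "bound_solution y w"
proof -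
  obtain t0 where t0: "\<And>t. t \<le> t0 \<Longrightarrow> 0 < y t"
    using pos by (auto simp: eventually_at_bot_linorder)
  have le: "J y w t \<le> L" for t
    by (rule tendsto_lowerbound[OF lim(1)])
      (auto simp: eventually_at_bot_linorder intro!: exI[of _ t] J_antimono[OF ef])
  have neg: "J y w t < 0" for t
  proof -
    \<comment> \<open>Times up to t0 have y > 0, so the decrease of \<open>J\<close> on [s - 1, s]
      is strict.\<close>
    define s where "s = min t t0"
    have "J y w t \<le> J y w s" by (rule J_antimono[OF ef]) (simp add: s_def)
    also have "J y w s < J y w (s - 1)"
    proof (rule DERIV_neg_imp_decreasing[of "s - 1" s "J y w"])
      fix x assume "s - 1 \<le> x" "x \<le> s"
      then have "0 < y x" by (intro t0) (auto simp: s_def)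
      then have "0 < al * (w x)\<^sup>2 + m\<^sup>2 * m * exp (2 * m * x) * (y x)\<^sup>2"
        using al_pos m_pos by (intro add_nonneg_pos) auto
      then show "\<exists>d. (J y w has_real_derivative d) (at x) \<and> d < 0"
        using J_deriv[OF ef, of x] by (intro exI conjI) auto
    qed auto
    also have "\<dots> \<le> L" by (rule le)
    finally show ?thesis using lim(2) by simp
  qed
  have "0 < y t" for t
  proof (rule ccontr)
    assume "\<not> 0 < y t"
    moreover from this have "t0 < t" using t0[of t] by linarith
    ultimately obtain s where "y s = 0"
      using IVT2'[of y t 0 t0] t0[of t0] ef_continuous(1)[OF ef] by force
    then have "J y w s = (w s)\<^sup>2 / 2" using p1 by (simp add: J_def G_def)
    then show False using neg[of s] by (smt (verit) zero_le_power2 divide_nonneg_nonneg)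
  qed
  with neg ef show ?thesis by (simp add: bound_solution_def)
qed

lemma bound_solution_D:
  assumes "bound_solution y w"
  shows "ef_solution y w" "0 < y t" "J y w t < 0"
  using assms by (auto simp: bound_solution_def)

text \<open>Negative energy says w^2/2 + y^(p+1)/(p+1) < D y^2/2 with D = 1 + m^2 exp(2 m t);
  dropping either term on the left bounds y or w. The growth of D is why the bounds hold only up to
  a given time.\<close>

lemma bound_solution_le:
  assumes bs: "bound_solution y w" and t: "t \<le> T"
  defines "C \<equiv> 1 + m\<^sup>2 * exp (2 * m * T)"
  defines "M \<equiv> ((p + 1) / 2 * C) powr (1 / (p - 1))"
  shows "y t \<le> M" "\<bar>w t\<bar> \<le> C * y t"
proof -
  define D where "D = 1 + m\<^sup>2 * exp (2 * m * t)"
  have D: "1 \<le> D" "D \<le> C" using t m_pos by (auto simp: D_def C_def)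
  note y = bound_solution_D(2)[OF bs, of t]
  have J: "(w t)\<^sup>2 / 2 + y t powr (p + 1) / (p + 1) < D * (y t)\<^sup>2 / 2"
    using bound_solution_D(3)[OF bs, of t] y by (simp add: J_def G_def D_def algebra_simps)
  have py: "y t powr (p + 1) = y t powr (p - 1) * (y t)\<^sup>2"
    using y by (simp add: powr_add[symmetric] add.commute flip: powr_numeral)
  have "y t powr (p + 1) / (p + 1) \<le> D * (y t)\<^sup>2 / 2"
    using J by (smt (verit) zero_le_power2 divide_nonneg_nonneg)
  then have "y t powr (p - 1) / (p + 1) \<le> D / 2"
  proof -
    have "y t powr (p - 1) / (p + 1) * (y t)\<^sup>2 \<le> D / 2 * (y t)\<^sup>2"
      using \<open>y t powr (p + 1) / (p + 1) \<le> _\<close> by (simp add: py)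
    then show ?thesis by (rule mult_right_le_imp_le) (use y in simp)
  qed
  then have "y t powr (p - 1) \<le> (p + 1) / 2 * D" using p1 by (simp add: field_simps)
  also have "\<dots> \<le> (p + 1) / 2 * C" using D p1 by simp
  finally have "(y t powr (p - 1)) powr (1 / (p - 1)) \<le> M"
    unfolding M_def using p1 by (intro powr_mono2) auto
  then show "y t \<le> M" using p1 y by (simp add: powr_powr)
  have "0 \<le> y t powr (p + 1) / (p + 1)" using p1 by simp
  then have "(w t)\<^sup>2 \<le> D * (y t)\<^sup>2" using J by linarith
  also have "\<dots> \<le> C\<^sup>2 * (y t)\<^sup>2"
  proof (rule mult_right_mono)
    have "1 * C \<le> C * C" using D by (intro mult_right_mono) auto
    then show "D \<le> C\<^sup>2" using D unfolding power2_eq_square by linarith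
  qed simp
  finally have "(w t)\<^sup>2 \<le> (C * y t)\<^sup>2" by (simp add: power_mult_distrib)
  then have "\<bar>w t\<bar> \<le> \<bar>C * y t\<bar>" by (simp only: abs_le_square_iff)
  moreover have "0 \<le> C * y t" using y D by (intro mult_nonneg_nonneg) auto
  ultimately show "\<bar>w t\<bar> \<le> C * y t" by simp
qed

lemma bound_solution_bounded:
  obtains M where "1 \<le> M" "\<And>y w t. bound_solution y w \<Longrightarrow> t \<le> T \<Longrightarrow> y t \<le> M \<and> \<bar>w t\<bar> \<le> M"
proof -
  define C where "C = 1 + m\<^sup>2 * exp (2 * m * T)"
  define M where "M = ((p + 1) / 2 * C) powr (1 / (p - 1))"
  have C: "1 \<le> C" by (simp add: C_def)
  show thesis
  proof (rule that[of "max 1 (C * M)"])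
    fix y w and t :: real assume bs: "bound_solution y w" "t \<le> T"
    have le: "y t \<le> M" "\<bar>w t\<bar> \<le> C * y t"
      using bound_solution_le[OF bs] by (auto simp: C_def M_def)
    have "0 \<le> M" by (simp add: M_def)
    then have "M \<le> C * M" using C by (simp add: mult_le_cancel_right1)
    moreover have "C * y t \<le> C * M" using le C by simp
    ultimately show "y t \<le> max 1 (C * M) \<and> \<bar>w t\<bar> \<le> max 1 (C * M)" using le by linarith
  qed simp
qed

lemma exp_at_bot: "((\<lambda>t. exp (c * t)) \<longlongrightarrow> (0::real)) at_bot" if "0 < c"
proof -
  have "filterlim (\<lambda>t. c * t) at_bot at_bot"
    using that by (rule filterlim_tendsto_pos_mult_at_bot[OF tendsto_const _ filterlim_ident])
  then show ?thesis by (rule filterlim_compose[OF exp_at_bot])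
qed

lemma J_tendsto:
  assumes "(y \<longlongrightarrow> a) at_bot" "(w \<longlongrightarrow> 0) at_bot"
  shows "(J y w \<longlongrightarrow> G a) at_bot"
proof -
  have "isCont G a" using G_deriv by (rule DERIV_isCont)
  then have "((\<lambda>t. G (y t)) \<longlongrightarrow> G a) at_bot" using assms(1) by (rule isCont_tendsto_compose)
  then have "((\<lambda>t. (w t)\<^sup>2 / 2 + G (y t) - m\<^sup>2 * exp (2 * m * t) * (y t)\<^sup>2 / 2) \<longlongrightarrow>
     0\<^sup>2 / 2 + G a - m\<^sup>2 * 0 * a\<^sup>2 / 2) at_bot"
    using assms m_pos by (intro tendsto_intros exp_at_bot) auto
  then show ?thesis by (simp add: J_def[abs_def])
qed

text \<open>Here w' = - al w + h with h -> 0, so for c = 1 or -1 the function exp(al t) (c w - e/al)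
  is nonincreasing. An excess of c w over e/al thus persists backwards in time and makes |y| grow at
  least linearly towards -\<infinity>, against y -> 1.\<close>

lemma singular_w_tendsto:
  assumes ef: "ef_solution y w" and y1: "(y \<longlongrightarrow> 1) at_bot"
  shows "(w \<longlongrightarrow> 0) at_bot"
proof -
  define h where "h t = y t - fpow p (y t) + m\<^sup>2 * exp (2 * m * t) * y t" for t
  have "eventually (\<lambda>t. y t > 0) at_bot" using y1 by (rule order_tendstoD) simp
  moreover have "((\<lambda>t. y t - y t powr p + m\<^sup>2 * exp (2 * m * t) * y t) \<longlongrightarrow>
      1 - 1 powr p + m\<^sup>2 * 0 * 1) at_bot"
    using m_pos by (intro tendsto_intros exp_at_bot y1) auto
  ultimately have h0: "(h \<longlongrightarrow> 0) at_bot"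
    by (auto simp: h_def fpow_pos elim!: Lim_transform_eventually eventually_mono)
  have bd: "c * w t \<le> e / al"
    if e: "0 < e" and c: "\<bar>c\<bar> = 1" and T: "\<And>t. t \<le> T \<Longrightarrow> \<bar>h t\<bar> \<le> e" and t: "t \<le> T" for c e t T :: real
  proof (rule ccontr)
    assume "\<not> c * w t \<le> e / al"
    define d where "d = c * w t - e / al"
    have d: "0 < d" using \<open>\<not> _\<close> by (simp add: d_def)
    have mono: "exp (al * t) * d \<le> exp (al * s) * (c * w s - e / al)" if s: "s \<le> t" for s
      unfolding d_def using s
    proof (rule DERIV_nonpos_imp_nonincreasing)
      fix x assume "s \<le> x" "x \<le> t"
      then have "\<bar>c * h x\<bar> \<le> e" using T[of x] t c by (simp add: abs_mult)
      then have neg: "exp (al * x) * (c * h x - e) \<le> 0" by (intro mult_nonneg_nonpos) auto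
      have "((\<lambda>t. exp (al * t) * (c * w t - e / al)) has_real_derivative
         exp (al * x) * al * (c * w x - e / al) + exp (al * x) * (c * (- al * w x + h x))) (at x)"
        using ef_D(2)[OF ef, of x] unfolding h_def
        by (auto intro!: derivative_eq_intros)
      then have "((\<lambda>t. exp (al * t) * (c * w t - e / al)) has_real_derivative
         exp (al * x) * (c * h x - e)) (at x)"
        by (rule DERIV_cong) (use al_pos in \<open>simp add: field_simps\<close>)
      with neg show "\<exists>d. ((\<lambda>t. exp (al * t) * (c * w t - e / al)) has_real_derivative d) (at x) \<and> d \<le> 0"
        by blast
    qed
    have cw: "d \<le> c * w s" if s: "s \<le> t" for s
    proof -
      have "exp (al * s) * d \<le> exp (al * t) * d" using s al_pos d by simp
      also have "\<dots> \<le> exp (al * s) * (c * w s - e / al)" by (rule mono[OF s])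
      finally have "d \<le> c * w s - e / al" by simp
      moreover have "0 < e / al" using e al_pos by simp
      ultimately show ?thesis by linarith
    qed
    have lin: "c * y s + d * (t - s) \<le> c * y t" if s: "s \<le> t" for s
    proof -
      have "c * y s - d * s \<le> c * y t - d * t"
        using s
      proof (rule DERIV_nonneg_imp_nondecreasing)
        fix x assume "s \<le> x" "x \<le> t"
        then show "\<exists>f. ((\<lambda>s. c * y s - d * s) has_real_derivative f) (at x) \<and> 0 \<le> f"
          using cw[of x] by (intro exI[of _ "c * w x - d"])
            (auto intro!: derivative_eq_intros ef_D(1)[OF ef])
      qed
      then show ?thesis by (simp add: algebra_simps)
    qed
    have "eventually (\<lambda>s. dist (y s) 1 < 1) at_bot" using y1 by (auto simp: tendsto_iff)
    \<comment> \<open>So far back that the drop d (t - s) is at least |y t| + 3, although |y s| <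
      2.\<close>
    moreover have "eventually (\<lambda>s. s \<le> t - (\<bar>y t\<bar> + 3) / d) at_bot" by (rule eventually_le_at_bot)
    moreover have "eventually (\<lambda>s. s \<le> t) at_bot" by (rule eventually_le_at_bot)
    ultimately obtain s where s: "dist (y s) 1 < 1" "s \<le> t - (\<bar>y t\<bar> + 3) / d" "s \<le> t"
      by (metis (mono_tags, lifting) eventually_conj eventually_happens' trivial_limit_at_bot_linorder)
    have "\<bar>y t\<bar> + 3 \<le> d * (t - s)" using s(2) d by (simp add: field_simps)
    moreover have "\<bar>c * y s\<bar> < 2" using s(1) c by (simp add: abs_mult dist_real_def)
    moreover have "c * y t \<le> \<bar>y t\<bar>" using c by (metis abs_ge_self abs_mult mult_1)
    ultimately show False using lin[OF s(3)] by linarith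
  qed
  show ?thesis
    unfolding tendsto_iff
  proof (intro allI impI)
    fix r :: real assume r: "0 < r"
    define e where "e = al * r / 2"
    have e: "0 < e" using r al_pos by (simp add: e_def)
    then have "eventually (\<lambda>t. dist (h t) 0 < e) at_bot" using h0 unfolding tendsto_iff by blast
    then obtain T where T: "\<And>t. t \<le> T \<Longrightarrow> \<bar>h t\<bar> \<le> e"
      by (auto simp: eventually_at_bot_linorder dist_real_def intro: less_imp_le)
    have "dist (w t) 0 < r" if "t \<le> T" for t
      using bd[OF e _ T that, of 1] bd[OF e _ T that, of "-1"] r al_pos
      by (simp add: e_def dist_real_def abs_less_iff)
    then show "eventually (\<lambda>t. dist (w t) 0 < r) at_bot"
      by (auto simp: eventually_at_bot_linorder)
  qed
qed

lemma G1_neg: "G 1 < 0"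
  using p1 by (simp add: G_def field_simps)

lemma singular_bound_solution:
  assumes ef: "ef_solution y w" and y1: "(y \<longlongrightarrow> 1) at_bot"
  shows "bound_solution y w"
  using ef J_tendsto[OF y1 singular_w_tendsto[OF assms]]
proof (rule bound_solutionI)
  show "eventually (\<lambda>t. 0 < y t) at_bot" using y1 by (rule order_tendstoD) simp
qed (use G1_neg in simp)

lemma sing_profile_ef:
  assumes "sing_profile N p y"
  obtains w where "ef_solution y w" "(y \<longlongrightarrow> 1) at_bot"
  using assms unfolding sing_profile_def ef_solution_def al_def m_def by blast

end

section \<open>Regular solutions\<close>

context exponents
begin

definition regular :: "real \<Rightarrow> (real \<Rightarrow> real) \<Rightarrow> (real \<Rightarrow> real) \<Rightarrow> bool" where
  "regular \<gamma> u v \<longleftrightarrow> 1 < \<gamma> \<and> u 0 = \<gamma> \<and> v 0 = 0 \<and>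
     (\<forall>s\<ge>0. (u has_real_derivative v s) (at s within {0..})) \<and>
     (\<forall>s>0. (v has_real_derivative (- (real N - 1) / s * v s - fnl p (u s))) (at s))"

lemma regular_D:
  assumes "regular \<gamma> u v"
  shows "1 < \<gamma>" "u 0 = \<gamma>" "v 0 = 0"
    "0 \<le> s \<Longrightarrow> (u has_real_derivative v s) (at s within {0..})"
    "0 < s \<Longrightarrow> (u has_real_derivative v s) (at s)"
    "0 < s \<Longrightarrow> (v has_real_derivative (- (real N - 1) / s * v s - fnl p (u s))) (at s)"
proof -
  show "(u has_real_derivative v s) (at s)" if "0 < s"
  proof -
    have "at s within {0..} = at s" using that by (intro at_within_open_subset[of s "{0<..}"]) auto
    moreover have "(u has_real_derivative v s) (at s within {0..})"
      using that assms by (simp add: regular_def)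
    ultimately show ?thesis by simp
  qed
qed (use assms in \<open>auto simp: regular_def\<close>)

lemma regular_radial: "regular \<gamma> u v \<Longrightarrow> radial_solution u v"
  unfolding radial_solution_def by (intro allI impI conjI regular_D(5,6))

lemma regular_u_continuous: "regular \<gamma> u v \<Longrightarrow> continuous_on {0..} u"
  by (rule DERIV_continuous_on, rule regular_D(4)) auto

text \<open>Continuity of v at 0 is not part of the initial value problem, so s^(N-1) v cannot
  simply be integrated from 0. Instead, h is nonincreasing; if it were positive at s0, then c v
  would stay above some d > 0 on (0, s0], and so would the difference quotients of c u at 0, whose
  limit is c v(0) = 0.\<close>

lemma regular_v_le_aux:
  assumes reg: "regular \<gamma> u v" and b: "0 < b" and K: "0 \<le> K"
    and f: "\<And>s. 0 < s \<Longrightarrow> s \<le> b \<Longrightarrow> \<bar>fnl p (u s)\<bar> \<le> K"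
    and c: "\<bar>c\<bar> = 1" and s0: "0 < s0" "s0 \<le> b"
  shows "c * v s0 \<le> K * s0 / N"
proof (rule ccontr)
  assume "\<not> c * v s0 \<le> K * s0 / N"
  define k where "k = N - 1"
  have k: "N = Suc k" using N3 by (simp add: k_def)
  define h where "h s = s ^ k * (c * v s) - K * s ^ N / N" for s
  have "h s0 = s0 ^ k * (c * v s0 - K * s0 / N)" by (simp add: h_def k algebra_simps)
  then have h0: "0 < h s0" using s0 \<open>\<not> _\<close> by simp
  have mono: "h s0 \<le> h s" if s: "0 < s" "s \<le> s0" for s
    using s(2)
  proof (rule DERIV_nonpos_imp_nonincreasing)
    fix x assume x: "s \<le> x" "x \<le> s0"
    have x0: "0 < x" using x s by simp
    have "(h has_real_derivative
       real k * x ^ (k - 1) * (c * v x) + x ^ k * (c * (- (real N - 1) / x * v x - fnl p (u x)))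
       - K * (real N * x ^ k) / N) (at x)"
      unfolding h_def[abs_def]
      by (rule DERIV_cong[OF DERIV_diff[OF DERIV_mult[OF DERIV_pow
              DERIV_cmult[OF regular_D(6)[OF reg x0]]] DERIV_cdivide[OF DERIV_cmult[OF DERIV_pow]]]])
        (simp add: k)
    moreover have "real k * x ^ (k - 1) * (c * v x) + x ^ k * (c * (- (real N - 1) / x * v x - fnl p (u x)))
       - K * (real N * x ^ k) / N = x ^ k * (- c * fnl p (u x) - K)"
    proof -
      have "x ^ k = x * x ^ (k - 1)" using N3 by (cases k) (auto simp: k_def)
      then have "x ^ k * (c * ((real N - 1) / x * v x)) = real k * x ^ (k - 1) * (c * v x)"
        using x0 by (simp add: k)
      moreover have "x ^ k * (c * (- (real N - 1) / x * v x - fnl p (u x))) =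
        - (x ^ k * (c * ((real N - 1) / x * v x))) - x ^ k * (c * fnl p (u x))"
        by (simp only: right_diff_distrib minus_divide_left[symmetric] mult_minus_left mult_minus_right)
      moreover have "K * (real N * x ^ k) / N = x ^ k * K" using N3 by simp
      ultimately show ?thesis by (simp add: right_diff_distrib)
    qed
    moreover have "\<bar>c * fnl p (u x)\<bar> \<le> K" using f[of x] x x0 s0 c by (simp add: abs_mult)
    then have "x ^ k * (- c * fnl p (u x) - K) \<le> 0" using x0 by (intro mult_nonneg_nonpos) auto
    ultimately show "\<exists>y. (h has_real_derivative y) (at x) \<and> y \<le> 0" by auto
  qed
  define d where "d = h s0 / s0 ^ k"
  have d: "0 < d" using h0 s0 by (simp add: d_def)
  have vd: "d \<le> c * v s" if s: "0 < s" "s \<le> s0" for s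
  proof -
    have "h s0 \<le> s ^ k * (c * v s)"
      using mono[OF s] K s by (simp add: h_def) (smt (verit) divide_nonneg_nonneg mult_nonneg_nonneg of_nat_0_le_iff zero_le_power)
    then have "h s0 / s ^ k \<le> c * v s" using s by (simp add: divide_le_eq mult.commute)
    moreover have "h s0 / s0 ^ k \<le> h s0 / s ^ k"
      using h0 s by (intro divide_left_mono power_mono mult_pos_pos) auto
    ultimately show ?thesis by (simp add: d_def)
  qed
  have uq: "d \<le> c * ((u s - u 0) / s)" if s: "0 < s" "s \<le> s0" for s
  proof -
    have "d * s \<le> c * u s - c * u 0"
    proof -
      have "c * u 0 - d * 0 \<le> c * u s - d * s"
      proof (rule DERIV_nonneg_imp_increasing_open[of 0 s "\<lambda>s. c * u s - d * s"])
        show "0 \<le> s" using s by simp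
        fix x assume x: "0 < x" "x < s"
        then show "\<exists>y. ((\<lambda>s. c * u s - d * s) has_real_derivative y) (at x) \<and> 0 \<le> y"
          using vd[of x] s regular_D(5)[OF reg x(1)]
          by (intro exI[of _ "c * v x - d"]) (auto intro!: derivative_eq_intros)
      next
        show "continuous_on {0..s} (\<lambda>s. c * u s - d * s)"
          by (intro continuous_intros continuous_on_subset[OF regular_u_continuous[OF reg]]) auto
      qed
      then show ?thesis by simp
    qed
    then show ?thesis using s by (simp add: field_simps)
  qed
  have "((\<lambda>s. (u s - u 0) / (s - 0)) \<longlongrightarrow> v 0) (at 0 within {0..})"
    using regular_D(4)[OF reg, of 0] unfolding has_field_derivative_iff by simp
  then have "((\<lambda>s. c * ((u s - u 0) / (s - 0))) \<longlongrightarrow> c * v 0) (at 0 within {0..})"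
    by (intro tendsto_intros)
  then have "((\<lambda>s. c * ((u s - u 0) / s)) \<longlongrightarrow> 0) (at 0 within {0..})"
    using regular_D(3)[OF reg] by simp
  then have "eventually (\<lambda>s. c * ((u s - u 0) / s) < d) (at 0 within {0..})"
    using d by (rule order_tendstoD)
  then obtain e where e: "0 < e" "\<And>s. 0 < s \<Longrightarrow> s < e \<Longrightarrow> c * ((u s - u 0) / s) < d"
    by (auto simp: eventually_at dist_real_def)
  have "0 < min (e / 2) s0" "min (e / 2) s0 < e" "min (e / 2) s0 \<le> s0" using e s0 by auto
  then show False using e(2) uq by fastforce
qed

lemma regular_v_le:
  assumes "regular \<gamma> u v" "0 < b" "0 \<le> K" "\<And>s. 0 < s \<Longrightarrow> s \<le> b \<Longrightarrow> \<bar>fnl p (u s)\<bar> \<le> K" "0 < s" "s \<le> b"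
  shows "\<bar>v s\<bar> \<le> K * s / N"
  using regular_v_le_aux[OF assms(1-4) _ assms(5,6), of 1]
    regular_v_le_aux[OF assms(1-4) _ assms(5,6), of "-1"] by auto

lemma fpow_continuous: "continuous_on S (fpow p)"
proof -
  have "isCont (\<lambda>x. fpow p x) x" for x
  proof -
    have "isCont (\<lambda>x. \<bar>x\<bar> powr (p - 1) * x) x" if "x \<noteq> 0" using that by (intro continuous_intros) auto
    moreover have "isCont (\<lambda>x. \<bar>x\<bar> powr (p - 1) * x) 0"
      unfolding isCont_def using p1 by (rule_tac tendsto_eq_intros | force)+
    ultimately show ?thesis by (cases "x = 0") (auto simp: fpow_def[abs_def])
  qed
  then show ?thesis by (intro continuous_at_imp_continuous_on) auto
qed

lemma regular_v_continuous:
  assumes reg: "regular \<gamma> u v"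
  shows "continuous_on {0..} v"
proof -
  have "continuous_on {0..1} (\<lambda>s. fnl p (u s))"
    unfolding fnl_def using continuous_on_subset[OF regular_u_continuous[OF reg], of "{0..1}"]
    by (intro continuous_intros continuous_on_compose2[OF fpow_continuous[of UNIV]]) auto
  then have "bounded ((\<lambda>s. fnl p (u s)) ` {0..1})"
    by (intro compact_imp_bounded compact_continuous_image) auto
  then obtain K where K: "0 < K" "\<And>s. s \<in> {0..1} \<Longrightarrow> \<bar>fnl p (u s)\<bar> \<le> K"
    unfolding bounded_pos by auto
  have v: "\<bar>v s\<bar> \<le> K * s / N" if "0 < s" "s \<le> 1" for s
    using regular_v_le[OF reg _ _ _ that, of K] K by auto
  have "((\<lambda>s. K * s / N) \<longlongrightarrow> K * 0 / N) (at 0 within {0..})" by (intro tendsto_intros) (use N3 in auto)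
  then have "((\<lambda>s. K * s / N) \<longlongrightarrow> 0) (at 0 within {0..})" by simp
  then have "(v \<longlongrightarrow> 0) (at 0 within {0..})"
    by (rule Lim_null_comparison[rotated])
      (auto simp: eventually_at dist_real_def intro!: exI[of _ 1] v)
  then have "continuous (at 0 within {0..}) v" using regular_D(3)[OF reg] by (simp add: continuous_within)
  moreover have "continuous (at s within {0..}) v" if "0 < s" for s
    using DERIV_isCont[OF regular_D(6)[OF reg that]] continuous_at_imp_continuous_at_within by blast
  ultimately show ?thesis
    unfolding continuous_on_eq_continuous_within by (metis atLeast_iff order_le_less)
qed

lemma exp_at_right_0:
  assumes "0 < c"
  shows "filterlim (\<lambda>t. exp (c * t)) (at 0 within {0<..}) (at_bot :: real filter)"
  using exp_at_bot[OF assms] by (simp add: filterlim_at)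

lemma regular_tendsto_at_bot:
  assumes reg: "regular \<gamma> u v"
  shows "((\<lambda>t. u (exp (m * t))) \<longlongrightarrow> \<gamma>) at_bot" "((\<lambda>t. v (exp (m * t))) \<longlongrightarrow> 0) at_bot"
proof -
  have "(u \<longlongrightarrow> u 0) (at 0 within {0<..})" "(v \<longlongrightarrow> v 0) (at 0 within {0<..})"
    using regular_u_continuous[OF reg] regular_v_continuous[OF reg]
    by (auto simp: continuous_on_def intro: tendsto_within_subset[where S = "{0..}"])
  then show "((\<lambda>t. u (exp (m * t))) \<longlongrightarrow> \<gamma>) at_bot" "((\<lambda>t. v (exp (m * t))) \<longlongrightarrow> 0) at_bot"
    using filterlim_compose[OF _ exp_at_right_0[OF m_pos]] regular_D(2,3)[OF reg] by auto
qed

text \<open>Both components carry the factor exp(m th t), so the orbit leaves the origin and its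
  energy starts from G 0 = 0.\<close>

lemma regular_bound_solution:
  assumes reg: "regular \<gamma> u v"
  shows "bound_solution (ef_y u) (ef_w u v)"
proof -
  have e: "((\<lambda>t. exp (m * th * t)) \<longlongrightarrow> 0) at_bot"
    using m_pos th_pos by (intro exp_at_bot) auto
  have y: "((\<lambda>t. exp (m * th * t) / A * u (exp (m * t))) \<longlongrightarrow> 0 / A * \<gamma>) at_bot"
    using A_pos by (intro tendsto_intros e regular_tendsto_at_bot[OF reg]) auto
  have w: "((\<lambda>t. m * (exp (m * th * t) / A) * (th * u (exp (m * t)) + exp (m * t) * v (exp (m * t))))
    \<longlongrightarrow> m * (0 / A) * (th * \<gamma> + 0 * 0)) at_bot"
    using A_pos m_pos by (intro tendsto_intros e regular_tendsto_at_bot[OF reg] exp_at_bot) auto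
  have "(ef_y u \<longlongrightarrow> 0) at_bot" "(ef_w u v \<longlongrightarrow> 0) at_bot"
    using y w by (simp_all add: ef_y_def[abs_def] ef_w_def[abs_def])
  then have "(J (ef_y u) (ef_w u v) \<longlongrightarrow> G 0) at_bot" by (rule J_tendsto)
  moreover have "G 0 \<le> 0" using p1 by (simp add: G_def)
  moreover have "eventually (\<lambda>t. 0 < u (exp (m * t))) at_bot"
    using regular_tendsto_at_bot(1)[OF reg] regular_D(1)[OF reg] by (intro order_tendstoD) auto
  then have "eventually (\<lambda>t. 0 < ef_y u t) at_bot"
    using A_pos by (auto simp: ef_y_def elim!: eventually_mono)
  ultimately show ?thesis
    using bound_solutionI ef_solution_of_radial[OF regular_radial[OF reg]] by blast
qed

lemma regular_pos:
  assumes reg: "regular \<gamma> u v" and "0 \<le> s"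
  shows "0 < u s"
proof (cases "s = 0")
  case True then show ?thesis using regular_D(1,2)[OF reg] by simp
next
  case False
  define t where "t = ln s / m"
  have "exp (m * t) = s" using m_pos assms False by (simp add: t_def)
  moreover have "0 < ef_y u t" by (rule bound_solution_D[OF regular_bound_solution[OF reg]])
  ultimately have "0 < exp (m * th * t) / A * u s" by (simp only: ef_y_def)
  moreover have "0 < exp (m * th * t) / A" using A_pos by simp
  ultimately show ?thesis by (rule zero_less_mult_pos)
qed

section \<open>Radial energy and dependence on the initial value\<close>

lemma G_continuous: "continuous_on S G"
  by (blast intro: continuous_at_imp_continuous_on DERIV_isCont[OF G_deriv])

lemma G_strict_mono:
  assumes "1 \<le> a" "a < b"
  shows "G a < G b"
proof (rule DERIV_pos_imp_increasing_open[OF assms(2)])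
  fix x assume x: "a < x" "x < b"
  have "x powr 1 < x powr p" using x assms p1 by (intro powr_less_mono) auto
  then have "x < fpow p x" using x assms by (simp add: fpow_pos)
  then show "\<exists>y. (G has_real_derivative y) (at x) \<and> 0 < y" using G_deriv[of x] by (intro exI conjI) auto
next
  show "continuous_on {a..b} G" by (rule G_continuous)
qed

lemma radial_energy_deriv:
  assumes "radial_solution u v" "0 < s"
  shows "((\<lambda>s. (v s)\<^sup>2 / 2 + G (u s)) has_real_derivative - (real N - 1) / s * (v s)\<^sup>2) (at s)"
proof -
  have u: "(u has_real_derivative v s) (at s)"
    and v: "(v has_real_derivative - (real N - 1) / s * v s - fnl p (u s)) (at s)"
    using assms by (auto simp: radial_solution_def)
  have "((\<lambda>s. (v s)\<^sup>2 / 2 + G (u s)) has_real_derivative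
     v s * (- (real N - 1) / s * v s - fnl p (u s)) + (fpow p (u s) - u s) * v s) (at s)"
    by (auto intro!: derivative_eq_intros u v DERIV_chain2[OF G_deriv u])
  then show ?thesis
    by (rule DERIV_cong) (simp add: fnl_def power2_eq_square algebra_simps)
qed

text \<open>The radial energy v^2/2 + G(u) starts at G(\<gamma>) and does not increase, while
  \<open>G\<close> is strictly increasing beyond 1.\<close>

lemma regular_le:
  assumes reg: "regular \<gamma> u v" and s: "0 \<le> s"
  shows "u s \<le> \<gamma>"
proof (rule ccontr)
  assume "\<not> u s \<le> \<gamma>"
  then have "G \<gamma> < G (u s)" using regular_D(1)[OF reg] by (intro G_strict_mono) auto
  also have "\<dots> \<le> (v s)\<^sup>2 / 2 + G (u s)" by simp
  also have "\<dots> \<le> (v 0)\<^sup>2 / 2 + G (u 0)"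
  proof (rule DERIV_nonpos_imp_decreasing_open[OF s, of "\<lambda>s. (v s)\<^sup>2 / 2 + G (u s)"])
    fix x assume x: "0 < x" "x < s"
    have "- (real N - 1) / x * (v x)\<^sup>2 \<le> 0" using x N3 by (intro mult_nonpos_nonneg) (auto simp: divide_le_0_iff)
    then show "\<exists>y. ((\<lambda>s. (v s)\<^sup>2 / 2 + G (u s)) has_real_derivative y) (at x) \<and> y \<le> 0"
      using radial_energy_deriv[OF regular_radial[OF reg] x(1)] by blast
  next
    have "continuous_on {0..s} (\<lambda>s. G (u s))"
      by (rule continuous_on_compose2[OF G_continuous[of UNIV]
            continuous_on_subset[OF regular_u_continuous[OF reg]]]) auto
    moreover have "continuous_on {0..s} v"
      by (rule continuous_on_subset[OF regular_v_continuous[OF reg]]) auto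
    ultimately show "continuous_on {0..s} (\<lambda>s. (v s)\<^sup>2 / 2 + G (u s))"
      by (intro continuous_intros) auto
  qed
  finally show False using regular_D(2,3)[OF reg] by simp
qed

text \<open>For 0 < u <= \<gamma> and \<gamma> > 1 the nonlinearity is at most \<gamma>^p in
  modulus. The explicit power matters: after the time shift of the entry estimate it leaves bounds
  relative to \<gamma>.\<close>

lemma regular_near_0:
  assumes reg: "regular \<gamma> u v" and s: "0 < s"
  shows "\<bar>v s\<bar> \<le> \<gamma> powr p * s / N" "\<gamma> - \<gamma> powr p * s\<^sup>2 / (2 * N) \<le> u s"
proof -
  have g1: "1 < \<gamma>" using regular_D(1)[OF reg] .
  have gp: "\<gamma> powr 1 \<le> \<gamma> powr p" using g1 p1 by (intro powr_mono) auto
  have f: "\<bar>fnl p (u s)\<bar> \<le> \<gamma> powr p" if "0 < s" for s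
  proof -
    have u: "0 < u s" "u s \<le> \<gamma>" using regular_pos[OF reg] regular_le[OF reg] that by auto
    then have "u s powr p \<le> \<gamma> powr p" using p1 by (intro powr_mono2) auto
    then show ?thesis using u gp g1 by (simp add: fnl_def fpow_pos abs_le_iff) (smt (verit) powr_ge_zero)
  qed
  show v: "\<bar>v s\<bar> \<le> \<gamma> powr p * s / N"
    by (rule regular_v_le[OF reg s]) (use f s in auto)
  define C where "C = \<gamma> powr p / N"
  have vC: "\<bar>v x\<bar> \<le> C * x" if "0 < x" for x
  proof -
    have "\<bar>v x\<bar> \<le> \<gamma> powr p * x / N" by (rule regular_v_le[OF reg that]) (use f that in auto)
    then show ?thesis by (simp add: C_def)
  qed
  have "u 0 + C * 0\<^sup>2 / 2 \<le> u s + C * s\<^sup>2 / 2"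
  proof (rule DERIV_nonneg_imp_increasing_open[of 0 s "\<lambda>s. u s + C * s\<^sup>2 / 2"])
    fix x assume x: "0 < x" "x < s"
    then show "\<exists>y. ((\<lambda>s. u s + C * s\<^sup>2 / 2) has_real_derivative y) (at x) \<and> 0 \<le> y"
      using vC[of x] by (intro exI[of _ "v x + C * x"])
        (auto intro!: derivative_eq_intros regular_D(5)[OF reg])
  next
    show "continuous_on {0..s} (\<lambda>s. u s + C * s\<^sup>2 / 2)"
      by (intro continuous_intros continuous_on_subset[OF regular_u_continuous[OF reg]]) auto
  qed (use s in simp)
  then show "\<gamma> - \<gamma> powr p * s\<^sup>2 / (2 * N) \<le> u s"
    using regular_D(2)[OF reg] by (simp add: C_def)
qed

lemma regular_lipschitz:
  assumes reg: "regular \<gamma> u v" and reg': "regular \<gamma>' u' v'" and le: "\<gamma> \<le> \<Gamma>" "\<gamma>' \<le> \<Gamma>" and s: "0 \<le> s"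
  shows "(u s - u' s)\<^sup>2 + (v s - v' s)\<^sup>2 \<le> (\<gamma> - \<gamma>')\<^sup>2 * exp ((2 + p * \<Gamma> powr (p - 1)) * s)"
proof -
  define L where "L = 1 + p * \<Gamma> powr (p - 1)"
  define e where "e s = (u s - u' s)\<^sup>2 + (v s - v' s)\<^sup>2" for s
  have L: "0 < L" using p1 by (simp add: L_def add_pos_nonneg)
  have "e s \<le> e 0 * exp ((1 + L) * (s - 0))"
    using s
  proof (rule gronwall_le)
    show "continuous_on {0..s} e"
      unfolding e_def
      by (intro continuous_intros continuous_on_subset[OF regular_u_continuous[OF reg]]
          continuous_on_subset[OF regular_u_continuous[OF reg']]
          continuous_on_subset[OF regular_v_continuous[OF reg]]
          continuous_on_subset[OF regular_v_continuous[OF reg']]) auto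
    fix x assume x: "0 < x" "x < s"
    define a where "a = u x - u' x"
    define b where "b = v x - v' x"
    define g where "g = fnl p (u x) - fnl p (u' x)"
    have "(e has_real_derivative 2 * a * b + 2 * b * (- (real N - 1) / x * v x - fnl p (u x)
        - (- (real N - 1) / x * v' x - fnl p (u' x)))) (at x)"
      unfolding e_def a_def b_def
      by (rule DERIV_cong[OF DERIV_add[OF
              DERIV_power[OF DERIV_diff[OF regular_D(5)[OF reg x(1)] regular_D(5)[OF reg' x(1)]]]
              DERIV_power[OF DERIV_diff[OF regular_D(6)[OF reg x(1)] regular_D(6)[OF reg' x(1)]]]]])
        (simp add: mult_ac del: right_diff_distrib_numeral)
    moreover have "2 * a * b + 2 * b * (- (real N - 1) / x * v x - fnl p (u x)
        - (- (real N - 1) / x * v' x - fnl p (u' x))) = 2 * (a * b) - 2 * (b * g) - 2 * ((real N - 1) / x * b\<^sup>2)"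
    proof -
      define k where "k = (real N - 1) / x"
      have k: "- (real N - 1) / x = - k" unfolding k_def by (simp only: minus_divide_left)
      show ?thesis unfolding k k_def[symmetric] by (simp add: b_def g_def power2_eq_square algebra_simps)
    qed
    moreover have "2 * (a * b) - 2 * (b * g) - 2 * ((real N - 1) / x * b\<^sup>2) \<le> (1 + L) * e x"
    proof -
      have "u x \<le> \<Gamma>" "u' x \<le> \<Gamma>"
        using regular_le[OF reg, of x] regular_le[OF reg', of x] x le by linarith+
      then have "\<bar>u x powr p - u' x powr p\<bar> \<le> p * \<Gamma> powr (p - 1) * \<bar>u x - u' x\<bar>"
        using regular_pos[OF reg] regular_pos[OF reg'] x p1 by (intro powr_lipschitz) auto
      moreover have "g = (u x powr p - u' x powr p) - a"
        using regular_pos[OF reg, of x] regular_pos[OF reg', of x] x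
        by (simp add: g_def a_def fnl_def fpow_pos)
      ultimately have g: "\<bar>g\<bar> \<le> L * \<bar>a\<bar>" by (simp add: L_def a_def algebra_simps)
      have ab: "2 * (\<bar>a\<bar> * \<bar>b\<bar>) \<le> a\<^sup>2 + b\<^sup>2"
        using sum_squares_bound[of "\<bar>a\<bar>" "\<bar>b\<bar>"] by simp
      have "- (b * g) \<le> \<bar>b\<bar> * \<bar>g\<bar>" by (metis abs_ge_minus_self abs_mult)
      also have "\<dots> \<le> \<bar>b\<bar> * (L * \<bar>a\<bar>)" using g by (intro mult_left_mono) auto
      finally have "- 2 * (b * g) \<le> L * (2 * (\<bar>a\<bar> * \<bar>b\<bar>))" by (simp add: mult_ac)
      also have "\<dots> \<le> L * (a\<^sup>2 + b\<^sup>2)" using ab L by (intro mult_left_mono) auto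
      finally have 1: "- 2 * (b * g) \<le> L * (a\<^sup>2 + b\<^sup>2)" .
      have "a * b \<le> \<bar>a\<bar> * \<bar>b\<bar>" by (metis abs_ge_self abs_mult)
      then have 2: "2 * (a * b) \<le> a\<^sup>2 + b\<^sup>2" using ab by linarith
      have "0 \<le> (real N - 1) / x * b\<^sup>2" using x N3 by simp
      with 1 2 show ?thesis by (simp add: e_def a_def b_def distrib_right)
    qed
    ultimately show "\<exists>d. (e has_real_derivative d) (at x) \<and> d \<le> (1 + L) * e x" by metis
  qed
  moreover have "e 0 = (\<gamma> - \<gamma>')\<^sup>2" using regular_D(2,3)[OF reg] regular_D(2,3)[OF reg'] by (simp add: e_def)
  ultimately show ?thesis by (simp add: e_def L_def)
qed

end

section \<open>Counting critical points by an angle\<close>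

text \<open>Just before a first return to a level with sin = 0 the angle would be above that level;
  being below it right after the departure, it would have returned even earlier. So multiples of
  \<pi> are passed only downwards, each at most once.\<close>

lemma down_crossing:
  fixes \<psi> :: "real \<Rightarrow> real"
  assumes cont: "continuous_on {a..b} \<psi>"
    and left: "\<And>t. \<lbrakk>a < t; t \<le> b; sin (\<psi> t) = 0\<rbrakk> \<Longrightarrow> eventually (\<lambda>x. \<psi> t < \<psi> x) (at_left t)"
    and right: "\<And>t. \<lbrakk>a \<le> t; t < b; sin (\<psi> t) = 0\<rbrakk> \<Longrightarrow> eventually (\<lambda>x. \<psi> x < \<psi> t) (at_right t)"
    and st: "a \<le> s" "s < t" "t \<le> b"
  shows "sin (\<psi> s) = 0 \<Longrightarrow> \<psi> t < \<psi> s" and "sin (\<psi> t) = 0 \<Longrightarrow> \<psi> t < \<psi> s"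
proof -
  have cont': "continuous_on {c..d} \<psi>" if "a \<le> c" "d \<le> b" for c d
    using cont that by (auto intro: continuous_on_subset)
  have after: "\<psi> t < \<psi> s" if st: "a \<le> s" "s < t" "t \<le> b" and s0: "sin (\<psi> s) = 0" for s t
  proof (rule ccontr)
    assume neg: "\<not> \<psi> t < \<psi> s"
    have "eventually (\<lambda>x. x < t) (at_right s)" using st(2) by (auto simp: eventually_at_right)
    with right[of s] have "eventually (\<lambda>x. \<psi> x < \<psi> s \<and> x < t) (at_right s)"
      using st s0 by (simp add: eventually_conj)
    moreover have "eventually (\<lambda>x. s < x) (at_right s)" by (simp add: eventually_at_right_less)
    ultimately have "eventually (\<lambda>x. (\<psi> x < \<psi> s \<and> x < t) \<and> s < x) (at_right s)" by (rule eventually_conj)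
    then obtain s1 where s1: "\<psi> s1 < \<psi> s" "s1 < t" "s < s1"
      using eventually_happens'[OF trivial_limit_at_right_real] by blast
    \<comment> \<open>The returns to the level \<psi> s; the least element is the first
      return.\<close>
    define X where "X = {x \<in> {s1..t}. \<psi> x = \<psi> s}"
    have "compact X"
    proof -
      have "closed X" unfolding X_def
        by (rule continuous_closed_preimage_constant[OF cont']) (use s1 st in auto)
      then show ?thesis
        by (rule compact_Icc[THEN compact_Int_closed, of _ s1 t, THEN back_subst[of compact]]) (auto simp: X_def)
    qed
    moreover have "\<exists>x\<ge>s1. x \<le> t \<and> \<psi> x = \<psi> s"
      by (rule IVT') (use s1 neg cont' st in auto)
    then have "X \<noteq> {}" by (auto simp: X_def)
    ultimately obtain x0 where x0: "x0 \<in> X" "\<And>x. x \<in> X \<Longrightarrow> x0 \<le> x"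
      using compact_attains_inf by metis
    have x0': "s1 < x0" "x0 \<le> t" "\<psi> x0 = \<psi> s" using x0(1) s1 by (auto simp: X_def order_less_le)
    have "eventually (\<lambda>x. \<psi> x0 < \<psi> x) (at_left x0)" using left[of x0] x0' s0 st s1 by auto
    moreover have "eventually (\<lambda>x. s1 < x) (at_left x0)" using x0' by (auto simp: eventually_at_left)
    moreover have "eventually (\<lambda>x. x < x0) (at_left x0)"
      unfolding eventually_at_left_field by (auto intro!: exI[of _ "x0 - 1"])
    ultimately have "eventually (\<lambda>x. \<psi> x0 < \<psi> x \<and> s1 < x \<and> x < x0) (at_left x0)"
      by (intro eventually_conj)
    then obtain x where x: "\<psi> x0 < \<psi> x" "s1 < x" "x < x0"
      using eventually_happens'[OF trivial_limit_at_left_real] by blast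
    have "\<exists>y\<ge>s1. y \<le> x \<and> \<psi> y = \<psi> s"
      by (rule IVT') (use s1 x x0' cont' st in auto)
    then obtain y where "s1 \<le> y" "y \<le> x" "\<psi> y = \<psi> s" by blast
    then show False using x0(2)[of y] x x0' by (auto simp: X_def)
  qed
  show "\<psi> t < \<psi> s" if "sin (\<psi> s) = 0" using after st that by blast
  \<comment> \<open>If \<psi> s were at most \<psi> t, the level \<psi> t would already be attained
    between s and a point just left of t, and the first claim would apply to it.\<close>
  show "\<psi> t < \<psi> s" if t0: "sin (\<psi> t) = 0"
  proof (rule ccontr)
    assume neg: "\<not> \<psi> t < \<psi> s"
    have "eventually (\<lambda>x. \<psi> t < \<psi> x) (at_left t)" using left[of t] st t0 by auto
    moreover have "eventually (\<lambda>x. s < x) (at_left t)" using st by (auto simp: eventually_at_left)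
    moreover have "eventually (\<lambda>x. x < t) (at_left t)"
      unfolding eventually_at_left_field by (auto intro!: exI[of _ "t - 1"])
    ultimately have "eventually (\<lambda>x. \<psi> t < \<psi> x \<and> s < x \<and> x < t) (at_left t)"
      by (intro eventually_conj)
    then obtain t1 where t1: "\<psi> t < \<psi> t1" "s < t1" "t1 < t"
      using eventually_happens'[OF trivial_limit_at_left_real] by blast
    have "\<exists>x\<ge>s. x \<le> t1 \<and> \<psi> x = \<psi> t"
      by (rule IVT') (use t1 neg cont' st in auto)
    then obtain x where "s \<le> x" "x \<le> t1" "\<psi> x = \<psi> t" by blast
    then show False using after[of x t] t1 st t0 by auto
  qed
qed

text \<open>The angle starts in (-\<pi>, 0), so the k-th critical point is where it equals -k \<pi>.
  Those before S belong to 1 <= k < n, which accounts for the n - 1 in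
  \<open>nth_crit\<close>.\<close>

lemma nth_crit_eq:
  fixes \<psi> w :: "real \<Rightarrow> real"
  assumes cont: "continuous_on {a..b} \<psi>"
    and left: "\<And>t. \<lbrakk>a < t; t \<le> b; sin (\<psi> t) = 0\<rbrakk> \<Longrightarrow> eventually (\<lambda>x. \<psi> t < \<psi> x) (at_left t)"
    and right: "\<And>t. \<lbrakk>a \<le> t; t < b; sin (\<psi> t) = 0\<rbrakk> \<Longrightarrow> eventually (\<lambda>x. \<psi> x < \<psi> t) (at_right t)"
    and a: "0 < a" and no_crit: "\<And>t. \<lbrakk>0 < t; t \<le> a\<rbrakk> \<Longrightarrow> deriv w t \<noteq> 0"
    and crit: "\<And>t. \<lbrakk>a \<le> t; t \<le> b\<rbrakk> \<Longrightarrow> deriv w t = 0 \<longleftrightarrow> sin (\<psi> t) = 0"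
    and \<psi>a: "- pi < \<psi> a" "\<psi> a < 0"
    and S: "a \<le> S" "S \<le> b" "\<psi> S = - real n * pi" and n: "1 \<le> n"
  shows "nth_crit w n = S"
proof -
  have dc: "sin (\<psi> s) = 0 \<Longrightarrow> \<psi> t < \<psi> s" "sin (\<psi> t) = 0 \<Longrightarrow> \<psi> t < \<psi> s"
    if "a \<le> s" "s < t" "t \<le> b" for s t
    using down_crossing[of a b \<psi> s t] cont left right that by blast+
  have sinS: "sin (\<psi> S) = 0" using S by simp
  have "\<psi> S \<le> - pi" using S n by simp
  then have aS: "a < S" using \<psi>a S by (cases "a = S") auto
  have "\<exists>x. a < x \<and> x < S \<and> \<psi> x = - real k * pi" if k: "k \<in> {1..<n}" for k
  proof -
    have k': "real k * pi < real n * pi" "1 * pi \<le> real k * pi"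
      using k by (auto intro: mult_right_mono)
    have le: "\<psi> S \<le> - real k * pi" "- real k * pi \<le> \<psi> a" using k' S \<psi>a by linarith+
    have "\<exists>x\<ge>a. x \<le> S \<and> \<psi> x = - real k * pi"
      by (rule IVT2'[of \<psi> S "- real k * pi" a, OF le]) (use S aS cont in \<open>auto intro: continuous_on_subset\<close>)
    then obtain x where x: "a \<le> x" "x \<le> S" "\<psi> x = - real k * pi" by blast
    moreover have "x \<noteq> a" "x \<noteq> S" using x k' S \<psi>a by auto
    ultimately show ?thesis by force
  qed
  then obtain f where f: "\<And>k. k \<in> {1..<n} \<Longrightarrow> a < f k \<and> f k < S \<and> \<psi> (f k) = - real k * pi"
    by metis
  define C where "C s = {t. 0 < t \<and> t < s \<and> deriv w t = 0}" for s
  have uniq: "t = t'" if "\<psi> t = \<psi> t'" "sin (\<psi> t) = 0" "a \<le> t" "t \<le> b" "a \<le> t'" "t' \<le> b" for t t'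
  proof (cases t t' rule: linorder_cases)
    case less
    then show ?thesis using dc(1)[of t t'] that by simp
  next
    case greater
    then show ?thesis using dc(1)[of t' t] that by simp
  qed
  have CS: "C S = f ` {1..<n}"
  proof (intro equalityI subsetI)
    fix t assume "t \<in> C S"
    then have t: "0 < t" "t < S" "deriv w t = 0" by (auto simp: C_def)
    have at: "a < t" using no_crit[OF t(1)] t(3) by (cases "t \<le> a") auto
    have s0: "sin (\<psi> t) = 0" using crit[of t] at t S by simp
    then obtain i :: int where i: "\<psi> t = real_of_int i * pi" by (auto simp: sin_zero_iff_int2)
    have "\<psi> t < \<psi> a" using dc(2)[of a t] at t S s0 by simp
    then have "real_of_int i * pi < 0" using i \<psi>a by linarith
    then have i0: "i < 0" by (simp add: mult_less_0_iff)
    have "\<psi> S < \<psi> t" using dc(1)[of t S] at t S s0 by simp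
    then have "- real n * pi < real_of_int i * pi" using i S by simp
    then have "- real n < real_of_int i" by (simp only: mult_less_cancel_right_pos[OF pi_gt_zero])
    then have "- int n < i" by linarith
    with i0 have k: "nat (- i) \<in> {1..<n}" by auto
    have "\<psi> (f (nat (- i))) = \<psi> t" using f[OF k] i i0 by simp
    then have "t = f (nat (- i))" using uniq[of t "f (nat (- i))"] f[OF k] at t S s0 by simp
    then show "t \<in> f ` {1..<n}" using k by blast
  next
    fix t assume "t \<in> f ` {1..<n}"
    then obtain k where k: "k \<in> {1..<n}" "t = f k" by blast
    then have "sin (\<psi> t) = 0" using f[OF k(1)] by simp
    then show "t \<in> C S" using f[OF k(1)] k crit[of t] a S by (auto simp: C_def)
  qed
  have "inj_on f {1..<n}"
  proof (rule inj_onI)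
    fix j k assume "j \<in> {1..<n}" "k \<in> {1..<n}" "f j = f k"
    then have "- real j * pi = - real k * pi" using f by metis
    then show "j = k" by simp
  qed
  then have card: "finite (C S)" "card (C S) = n - 1" by (auto simp: CS card_image)
  show ?thesis unfolding nth_crit_def
  proof (rule the_equality)
    show "0 < S \<and> deriv w S = 0 \<and> finite {t. 0 < t \<and> t < S \<and> deriv w t = 0} \<and>
      card {t. 0 < t \<and> t < S \<and> deriv w t = 0} = n - 1"
      using card a aS S crit[of S] sinS by (auto simp: C_def)
  next
    fix s assume "0 < s \<and> deriv w s = 0 \<and> finite {t. 0 < t \<and> t < s \<and> deriv w t = 0} \<and>
      card {t. 0 < t \<and> t < s \<and> deriv w t = 0} = n - 1"
    then have s: "0 < s" "deriv w s = 0" "finite (C s)" "card (C s) = n - 1" by (auto simp: C_def)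
    have S0: "0 < S" "deriv w S = 0" using a aS S crit[of S] sinS by auto
    \<comment> \<open>The number of earlier critical points grows strictly from one critical point
      to the next, so only one of them can have n - 1.\<close>
    have less: "card (C x) < card (C z)"
      if "x < z" "0 < x" "deriv w x = 0" "finite (C z)" for x z
      by (rule psubset_card_mono[OF that(4)]) (use that in \<open>auto simp: C_def\<close>)
    show "s = S"
      using less[of s S] less[of S s] s S0 card by (cases s S rule: linorder_cases) auto
  qed
qed

lemma tendsto_deriv_zero:
  fixes f g :: "real \<Rightarrow> real"
  assumes f: "(f \<longlongrightarrow> L) at_top" and g: "(g \<longlongrightarrow> M) at_top"
    and d: "\<And>s. s0 < s \<Longrightarrow> (f has_real_derivative g s) (at s)"
  shows "M = 0"
proof (rule ccontr)
  assume "M \<noteq> 0"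
  have "eventually (\<lambda>s. dist (g s) M < \<bar>M\<bar> / 2) at_top"
    using g \<open>M \<noteq> 0\<close> unfolding tendsto_iff by (metis half_gt_zero zero_less_abs_iff)
  then obtain s1 where s1: "\<And>s. s1 \<le> s \<Longrightarrow> dist (g s) M < \<bar>M\<bar> / 2"
    by (auto simp: eventually_at_top_linorder)
  have "eventually (\<lambda>s. dist (f s) L < \<bar>M\<bar> / 8) at_top"
    using f \<open>M \<noteq> 0\<close> unfolding tendsto_iff by (metis zero_less_abs_iff divide_pos_pos zero_less_numeral)
  then obtain s2 where s2: "\<And>s. s2 \<le> s \<Longrightarrow> dist (f s) L < \<bar>M\<bar> / 8"
    by (auto simp: eventually_at_top_linorder)
  define s where "s = max (max s1 s2) (s0 + 1)"
  have "\<exists>z>s. z < s + 1 \<and> f (s + 1) - f s = (s + 1 - s) * g z"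
    by (rule MVT2) (auto intro!: d simp: s_def)
  then obtain z where z: "s < z" "f (s + 1) - f s = g z" by auto
  have "dist (g z) M < \<bar>M\<bar> / 2" using s1[of z] z by (simp add: s_def)
  moreover have "dist (f s) L < \<bar>M\<bar> / 8" "dist (f (s + 1)) L < \<bar>M\<bar> / 8"
    using s2[of s] s2[of "s + 1"] by (auto simp: s_def)
  ultimately show False using z unfolding dist_real_def by linarith
qed

context exponents
begin

text \<open>Where v = 0 the equation gives v' = - f(u), of sign opposite to u - 1, because 1 is the
  only positive zero of f. With c = cos \<psi>(t) = +-1 one has c v = r sin(\<psi>(x) - \<psi>(t)),
  and c v decreases through 0.\<close>

lemma angle_crossing:
  assumes sol: "radial_solution u v" and a: "0 < a"
    and pos: "\<And>t. t \<in> {a..b} \<Longrightarrow> 0 < u t"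
    and cont: "continuous_on {a..b} \<psi>"
    and polar: "\<And>t. t \<in> {a..b} \<Longrightarrow> 0 < r t \<and> u t - 1 = r t * cos (\<psi> t) \<and> v t = r t * sin (\<psi> t)"
    and t: "t \<in> {a..b}" "sin (\<psi> t) = 0"
  shows "a < t \<Longrightarrow> eventually (\<lambda>x. \<psi> t < \<psi> x) (at_left t)"
    and "t < b \<Longrightarrow> eventually (\<lambda>x. \<psi> x < \<psi> t) (at_right t)"
proof -
  define c where "c = cos (\<psi> t)"
  have c2: "c\<^sup>2 = 1" using t(2) sin_cos_squared_add[of "\<psi> t"] by (simp add: c_def)
  then have c: "c = 1 \<or> c = -1" by (simp add: power2_eq_1_iff)
  have vt: "v t = 0" using polar[OF t(1)] t(2) by simp
  have ut: "u t - 1 = r t * c" "0 < r t" "0 < u t" using polar[OF t(1)] pos[OF t(1)] by (auto simp: c_def)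
  have "(v has_real_derivative - fnl p (u t)) (at t)"
  proof -
    have "0 < t" using t a by simp
    then have "(v has_real_derivative - (real N - 1) / t * v t - fnl p (u t)) (at t)"
      using sol unfolding radial_solution_def by blast
    then show ?thesis using vt by simp
  qed
  then have d: "((\<lambda>x. c * v x) has_real_derivative c * (- fnl p (u t))) (at t)"
    by (rule DERIV_cmult)
  have neg: "c * (- fnl p (u t)) < 0"
    using c
  proof
    assume c1: "c = 1"
    then have "u t powr 1 < u t powr p" using ut p1 by (intro powr_less_mono) auto
    then show ?thesis using c1 ut by (simp add: fnl_def fpow_pos)
  next
    assume c1: "c = -1"
    then have "u t < 1" using ut by simp
    then have "u t powr p < u t powr 1" using ut p1 by (intro powr_less_mono') auto
    then show ?thesis using c1 ut by (simp add: fnl_def fpow_pos)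
  qed
  have sgn_eq: "c * v x = r x * sin (\<psi> x - \<psi> t)" if "x \<in> {a..b}" for x
    using polar[OF that] t(2) by (simp add: sin_diff c_def)
  have "(\<psi> \<longlongrightarrow> \<psi> t) (at t within {a..b})" using cont t by (simp add: continuous_on_def)
  then have "eventually (\<lambda>x. dist (\<psi> x) (\<psi> t) < pi) (at t within {a..b})"
    unfolding tendsto_iff using pi_gt_zero by blast
  then obtain e where e: "0 < e" "\<And>x. x \<in> {a..b} \<Longrightarrow> \<bar>x - t\<bar> < e \<Longrightarrow> \<bar>\<psi> x - \<psi> t\<bar> < pi"
    unfolding eventually_at dist_real_def by (metis abs_0 cancel_comm_monoid_add_class.diff_cancel pi_gt_zero)
  show "eventually (\<lambda>x. \<psi> x < \<psi> t) (at_right t)" if tb: "t < b"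
  proof -
    obtain d' where d': "0 < d'" "\<And>h. 0 < h \<Longrightarrow> h < d' \<Longrightarrow> c * v (t + h) < c * v t"
      using DERIV_neg_dec_right[OF d neg] by blast
    have "\<psi> x < \<psi> t" if x: "t < x" "x < min b (t + min d' e)" for x
    proof (rule ccontr)
      assume "\<not> \<psi> x < \<psi> t"
      moreover have xab: "x \<in> {a..b}" using x t by auto
      moreover have "\<bar>\<psi> x - \<psi> t\<bar> < pi" using e(2)[OF xab] x by auto
      ultimately have "0 \<le> sin (\<psi> x - \<psi> t)" by (intro sin_ge_zero) auto
      then have "0 \<le> r x * sin (\<psi> x - \<psi> t)" using polar[OF xab] by (intro mult_nonneg_nonneg) auto
      then have "0 \<le> c * v x" by (simp only: sgn_eq[OF xab])
      moreover have "x - t < d'" using x by linarith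
      ultimately show False using d'(2)[of "x - t"] x vt by simp
    qed
    moreover have "t < min b (t + min d' e)" using tb e d' by simp
    ultimately show ?thesis unfolding eventually_at_right_field by blast
  qed
  show "eventually (\<lambda>x. \<psi> t < \<psi> x) (at_left t)" if ta: "a < t"
  proof -
    obtain d' where d': "0 < d'" "\<And>h. 0 < h \<Longrightarrow> h < d' \<Longrightarrow> c * v t < c * v (t - h)"
      using DERIV_neg_dec_left[OF d neg] by blast
    have "\<psi> t < \<psi> x" if x: "max a (t - min d' e) < x" "x < t" for x
    proof (rule ccontr)
      assume "\<not> \<psi> t < \<psi> x"
      moreover have xab: "x \<in> {a..b}" using x t by auto
      moreover have "\<bar>\<psi> x - \<psi> t\<bar> < pi" using e(2)[OF xab] x by auto
      ultimately have "0 \<le> sin (\<psi> t - \<psi> x)" by (intro sin_ge_zero) auto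
      moreover have "sin (\<psi> x - \<psi> t) = - sin (\<psi> t - \<psi> x)" by (metis minus_diff_eq sin_minus)
      ultimately have "r x * sin (\<psi> x - \<psi> t) \<le> 0" using polar[OF xab] by (intro mult_nonneg_nonpos) auto
      then have "c * v x \<le> 0" by (simp only: sgn_eq[OF xab])
      moreover have "t - x < d'" using x by linarith
      ultimately show False using d'(2)[of "t - x"] x vt by simp
    qed
    moreover have "max a (t - min d' e) < t" using ta e d' by simp
    ultimately show ?thesis unfolding eventually_at_left_field by blast
  qed
qed

end

section \<open>Critical points of the singular solution\<close>

lemma mono_bounded_tendsto:
  fixes f :: "real \<Rightarrow> real"
  assumes mono: "\<And>s t. \<lbrakk>a \<le> s; s \<le> t\<rbrakk> \<Longrightarrow> f s \<le> f t" and bound: "\<And>s. a \<le> s \<Longrightarrow> f s \<le> B"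
  obtains L where "(f \<longlongrightarrow> L) at_top" "\<And>s. a \<le> s \<Longrightarrow> f s \<le> L"
proof -
  define L where "L = Sup (f ` {a..})"
  have bdd: "bdd_above (f ` {a..})" by (rule bdd_aboveI[of _ B]) (use bound in auto)
  have le: "f s \<le> L" if "a \<le> s" for s
    unfolding L_def using that bdd by (auto intro: cSup_upper)
  have "(f \<longlongrightarrow> L) at_top"
  proof (rule order_tendstoI)
    fix c assume "c < L"
    then obtain s where s: "a \<le> s" "c < f s"
      unfolding L_def using less_cSup_iff[OF _ bdd] by auto
    then show "eventually (\<lambda>x. c < f x) at_top"
      unfolding eventually_at_top_linorder using mono[OF s(1)] by (intro exI[of _ s]) force
  next
    fix c assume "L < c"
    then show "eventually (\<lambda>x. f x < c) at_top"
      unfolding eventually_at_top_linorder using le by (intro exI[of _ a]) force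
  qed
  then show thesis using that le by blast
qed

context exponents
begin

text \<open>The quotient q = v/(u - 1) solves the Riccati equation q' = - k q - g - q^2 with k -> 0
  and g close to p - 1. Hence arctan q decreases at a fixed rate, which is impossible for a bounded
  function.\<close>

lemma no_monotone_convergence_to_1:
  assumes sol: "radial_solution u v" and pos: "\<And>s. s0 < s \<Longrightarrow> 0 < u s" and s0: "0 < s0"
    and ne: "\<And>s. s0 < s \<Longrightarrow> u s \<noteq> 1" and lim: "(u \<longlongrightarrow> 1) at_top"
  shows False
proof -
  define c where "c = (p - 1) / 2"
  have c: "0 < c" using p1 by (simp add: c_def)
  obtain \<delta>' where \<delta>': "0 < \<delta>'" "\<And>a b. \<lbrakk>\<bar>a - 1\<bar> \<le> \<delta>'; \<bar>b - 1\<bar> \<le> \<delta>'\<rbrakk> \<Longrightarrow>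
      \<bar>a powr p - b powr p - p * (a - b)\<bar> \<le> c * \<bar>a - b\<bar>"
    using powr_linearization_at_1[OF c] by metis
  have "eventually (\<lambda>s. dist (u s) 1 < \<delta>') at_top" using lim \<delta>' unfolding tendsto_iff by blast
  then obtain s1 where s1: "\<And>s. s1 \<le> s \<Longrightarrow> \<bar>u s - 1\<bar> < \<delta>'"
    by (auto simp: eventually_at_top_linorder dist_real_def)
  have ev: "((\<lambda>s. (real N - 1) / s) \<longlongrightarrow> 0) at_top"
    by (rule tendsto_divide_0[OF tendsto_const filterlim_at_top_imp_at_infinity[OF filterlim_ident]])
  \<comment> \<open>With |k| <= e and e^2 = c the friction is absorbed, |k q| <= q^2/2 + c/2;
    together with g >= c this leaves q' <= - q^2/2 - c/2.\<close>
  define e where "e = sqrt c"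
  have e: "0 < e" "e\<^sup>2 = c" using c by (auto simp: e_def)
  have "eventually (\<lambda>s. dist ((real N - 1) / s) 0 < e) at_top" using ev e unfolding tendsto_iff by blast
  then obtain s2 where s2: "\<And>s. s2 \<le> s \<Longrightarrow> \<bar>(real N - 1) / s\<bar> < e"
    by (auto simp: eventually_at_top_linorder dist_real_def)
  define a where "a = max (max s1 s2) (s0 + 1)"
  define q where "q s = v s / (u s - 1)" for s
  define \<delta> where "\<delta> = min (1/2) (c/2)"
  have \<delta>: "0 < \<delta>" using c by (simp add: \<delta>_def)
  have dec: "arctan (q b) - arctan (q a) \<le> - \<delta> * (b - a)" if "a \<le> b" for b
  proof -
    have D: "\<exists>d. ((\<lambda>s. arctan (q s)) has_real_derivative d) (at x) \<and> d \<le> - \<delta>" if x: "a \<le> x" for x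
    proof -
      have x': "s1 \<le> x" "s2 \<le> x" "s0 < x" "0 < x" using x s0 by (auto simp: a_def)
      define k where "k = (real N - 1) / x"
      define D where "D = u x - 1"
      have D: "D \<noteq> 0" using ne x' by (simp add: D_def)
      have u: "(u has_real_derivative v x) (at x)"
        and v: "(v has_real_derivative - (real N - 1) / x * v x - fnl p (u x)) (at x)"
        using sol x' by (auto simp: radial_solution_def)
      define g where "g = fnl p (u x) / D"
      have vk: "- (real N - 1) / x * v x - fnl p (u x) = - (k * v x) - g * D"
      proof -
        have "fnl p (u x) = g * D" using D by (simp add: g_def)
        moreover have "- (real N - 1) / x * v x = - (k * v x)"
          unfolding k_def by (simp only: minus_divide_left[symmetric] mult_minus_left)
        ultimately show ?thesis by simp
      qed
      have v': "(v has_real_derivative - (k * v x) - g * D) (at x)" using v unfolding vk .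
      have u1: "((\<lambda>s. u s - 1) has_real_derivative v x) (at x)"
        by (rule DERIV_cong[OF DERIV_diff[OF u DERIV_const]]) simp
      have "(q has_real_derivative ((- (k * v x) - g * D) * D - v x * v x) / (D * D)) (at x)"
        unfolding q_def[abs_def] D_def by (rule DERIV_divide[OF v'[unfolded D_def] u1]) (use D in \<open>simp add: D_def\<close>)
      moreover have "((- (k * v x) - g * D) * D - v x * v x) / (D * D) = - k * q x - g - (q x)\<^sup>2"
        using D by (simp add: q_def D_def[symmetric] power2_eq_square field_simps)
      ultimately have dq: "(q has_real_derivative - k * q x - g - (q x)\<^sup>2) (at x)" by simp
      have "c \<le> g"
      proof -
        have "\<bar>u x powr p - 1 powr p - p * (u x - 1)\<bar> \<le> c * \<bar>u x - 1\<bar>"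
          using \<delta>'(1) s1[OF x'(1)] by (intro \<delta>'(2)) auto
        moreover have "fnl p (u x) - (p - 1) * D = u x powr p - 1 powr p - p * (u x - 1)"
          using pos[OF x'(3)] by (simp add: fnl_def fpow_pos D_def algebra_simps)
        ultimately have "\<bar>fnl p (u x) - (p - 1) * D\<bar> / \<bar>D\<bar> \<le> c"
          using D by (simp add: D_def divide_le_eq)
        then have "\<bar>g - (p - 1)\<bar> \<le> c"
          using D by (simp add: g_def abs_divide[symmetric] diff_divide_distrib)
        then have "- (g - (p - 1)) \<le> c" by (rule abs_le_D2)
        moreover have "2 * c = p - 1" by (simp add: c_def)
        ultimately show ?thesis by linarith
      qed
      moreover have "- k * q x \<le> (q x)\<^sup>2 / 2 + c / 2"
      proof -
        have "- k * q x \<le> \<bar>k\<bar> * \<bar>q x\<bar>" by (metis abs_ge_self abs_minus_cancel abs_mult)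
        also have "\<dots> \<le> e * \<bar>q x\<bar>" using s2[OF x'(2)] by (intro mult_right_mono) (auto simp: k_def)
        also have "\<dots> \<le> (q x)\<^sup>2 / 2 + e\<^sup>2 / 2"
          using sum_squares_bound[of e "\<bar>q x\<bar>"] by simp
        finally show ?thesis using e by simp
      qed
      ultimately have "- k * q x - g - (q x)\<^sup>2 \<le> - (1/2 * (q x)\<^sup>2 + c/2)" by simp
      also have "\<dots> \<le> - (\<delta> * (q x)\<^sup>2 + \<delta>)"
      proof -
        have "\<delta> * (q x)\<^sup>2 \<le> 1/2 * (q x)\<^sup>2" "\<delta> \<le> c/2"
          by (intro mult_right_mono) (auto simp: \<delta>_def)
        then show ?thesis by linarith
      qed
      also have "\<dots> = - \<delta> * (1 + (q x)\<^sup>2)" by (simp add: algebra_simps)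
      finally have le: "- k * q x - g - (q x)\<^sup>2 \<le> - \<delta> * (1 + (q x)\<^sup>2)" .
      have p: "0 < 1 + (q x)\<^sup>2" by (simp add: add_pos_nonneg)
      have "((\<lambda>s. arctan (q s)) has_real_derivative inverse (1 + (q x)\<^sup>2) * (- k * q x - g - (q x)\<^sup>2)) (at x)"
        by (rule DERIV_chain2[OF DERIV_arctan dq])
      moreover have "inverse (1 + (q x)\<^sup>2) * (- k * q x - g - (q x)\<^sup>2) \<le> - \<delta>"
        using le p by (simp add: inverse_eq_divide divide_le_eq)
      ultimately show ?thesis by blast
    qed
    show ?thesis
    proof (rule diff_le_of_deriv_le[OF that])
      show "continuous_on {a..b} (\<lambda>s. arctan (q s))"
        
      proof (rule continuous_at_imp_continuous_on, rule ballI)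
        fix x assume "x \<in> {a..b}"
        then obtain d where "((\<lambda>s. arctan (q s)) has_real_derivative d) (at x)" using D[of x] by auto
        then show "isCont (\<lambda>s. arctan (q s)) x" by (rule DERIV_isCont)
      qed
    qed (use D in auto)
  qed
  define b where "b = a + pi / \<delta>"
  have "arctan (q b) - arctan (q a) \<le> - pi" using dec[of b] \<delta> by (simp add: b_def)
  moreover have "- (pi/2) < arctan (q b)" "arctan (q a) < pi/2" using arctan_bounded by auto
  ultimately show False by linarith
qed

text \<open>For small u the nonlinearity is close to -u, and v^2 - u^2/2 decreases to 0; this gives
  v <= - u/2 and exponential decay. The decay beats all powers of s in the transformation, so the
  negative part of \<open>J\<close> tends to 0, although \<open>J\<close> stays below a negative
  constant.\<close>

lemma no_decay_to_0:
  assumes bs: "bound_solution y w"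
    and neg: "\<And>s. s0 < s \<Longrightarrow> rad_v y w s < 0" and s0: "0 < s0"
    and lim: "(u_sing N p y \<longlongrightarrow> 0) at_top" and limv: "(rad_v y w \<longlongrightarrow> 0) at_top"
  shows False
proof -
  define u where "u = u_sing N p y"
  define v where "v = rad_v y w"
  note ef = bound_solution_D(1)[OF bs]
  have sol: "radial_solution u v" unfolding u_def v_def by (rule radial_solution_of_ef[OF ef])
  have pos: "0 < u s" if "0 < s" for s
    using bound_solution_D(2)[OF bs] A_pos that by (simp add: u_def u_sing_ef)
  \<comment> \<open>Below this threshold u^p <= u/2.\<close>
  have "eventually (\<lambda>s. u s < (1/2) powr (1 / (p - 1))) at_top"
    using lim unfolding u_def by (rule order_tendstoD) simp
  then obtain s1 where s1: "\<And>s. s1 \<le> s \<Longrightarrow> u s < (1/2) powr (1 / (p - 1))"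
    by (auto simp: eventually_at_top_linorder)
  define a where "a = max s1 (s0 + 1)"
  have a: "0 < a" using s0 by (simp add: a_def)
  have fu: "u s / 2 \<le> u s - fpow p (u s)" if s: "a \<le> s" for s
  proof -
    have us: "0 < u s" using pos s a by simp
    have "u s powr (p - 1) \<le> ((1/2) powr (1 / (p - 1))) powr (p - 1)"
      using s1[of s] s us p1 by (intro powr_mono2) (auto simp: a_def)
    then have "u s powr (p - 1) \<le> 1/2" using p1 by (simp add: powr_powr)
    then have "u s * u s powr (p - 1) \<le> u s * (1/2)" using us by (intro mult_left_mono) auto
    then have "u s powr p \<le> u s / 2" using powr_mult_base[of "u s" "p - 1"] us by simp
    then show ?thesis using us by (simp add: fpow_pos)
  qed
  have du: "(u has_real_derivative v s) (at s)"
    and dv: "(v has_real_derivative - (real N - 1) / s * v s - fnl p (u s)) (at s)" if "0 < s" for s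
    using sol that by (auto simp: radial_solution_def)
  have "v s \<le> - u s / 2" if s: "a \<le> s" for s
  proof -
    let ?h = "\<lambda>s. (v s)\<^sup>2 - (u s)\<^sup>2 / 2"
    have "(?h \<longlongrightarrow> 0\<^sup>2 - 0\<^sup>2 / 2) at_top"
      using lim limv unfolding u_def v_def by (intro tendsto_intros) auto
    then have lim0: "(?h \<longlongrightarrow> 0) at_top" by simp
    have "?h t \<le> ?h s" if t: "s \<le> t" for t
      using t
    proof (rule DERIV_nonpos_imp_nonincreasing[of s t ?h])
      fix x assume x: "s \<le> x" "x \<le> t"
      have x0: "0 < x" "a \<le> x" "v x < 0" using x s a neg[of x] by (auto simp: a_def v_def)
      have "(?h has_real_derivative 2 * v x * (- (real N - 1) / x * v x - fnl p (u x)) - u x * v x) (at x)"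
        by (auto intro!: derivative_eq_intros du dv x0)
      moreover have "2 * v x * (- (real N - 1) / x * v x - fnl p (u x)) - u x * v x =
        - 2 * ((real N - 1) / x * (v x)\<^sup>2) + 2 * v x * (u x - fpow p (u x) - u x / 2)"
      proof -
        define k where "k = (real N - 1) / x"
        have k: "- (real N - 1) / x = - k" unfolding k_def by (simp only: minus_divide_left)
        show ?thesis
          unfolding k k_def[symmetric] by (simp add: fnl_def power2_eq_square algebra_simps)
      qed
      moreover have "0 \<le> (real N - 1) / x * (v x)\<^sup>2" using x0 N3 by simp
      moreover have "2 * v x * (u x - fpow p (u x) - u x / 2) \<le> 0"
        using fu[OF x0(2)] x0 by (rule_tac mult_nonpos_nonneg) auto
      ultimately show "\<exists>y. (?h has_real_derivative y) (at x) \<and> y \<le> 0"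
        by (intro exI[of _ "2 * v x * (- (real N - 1) / x * v x - fnl p (u x)) - u x * v x"]) linarith
    qed
    then have "0 \<le> ?h s"
      by (intro tendsto_upperbound[OF lim0]) (auto simp: eventually_at_top_linorder intro!: exI[of _ s])
    moreover have "(u s / 2)\<^sup>2 \<le> (u s)\<^sup>2 / 2" by (simp add: power_divide)
    ultimately have "(u s / 2)\<^sup>2 \<le> (v s)\<^sup>2" by linarith
    then have "\<bar>u s / 2\<bar> \<le> \<bar>v s\<bar>" by (simp only: abs_le_square_iff)
    moreover have "0 < u s" "v s < 0" using pos neg[of s] s a by (auto simp: a_def v_def)
    ultimately show ?thesis by simp
  qed note vle = this
  have decay: "u s \<le> u a * exp (- (1/2) * (s - a))" if s: "a \<le> s" for s
    using s
  proof (rule gronwall_le)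
    show "continuous_on {a..s} u"
      by (rule continuous_at_imp_continuous_on) (use a DERIV_isCont[OF du] in auto)
    show "\<exists>d. (u has_real_derivative d) (at x) \<and> d \<le> - (1/2) * u x" if "a < x" "x < s" for x
      using du[of x] vle[of x] that a by (intro exI[of _ "v x"]) auto
  qed
  have yu: "y (ln s / m) = s powr th * u s / A" if "0 < s" for s
    using that m_pos A_pos by (simp add: u_def u_sing_ef powr_def)
  have es: "exp (2 * m * (ln s / m)) = s\<^sup>2" if "0 < s" for s
  proof -
    have "2 * m * (ln s / m) = ln s + ln s" using m_pos by simp
    then show ?thesis using that by (simp only: exp_add exp_ln power2_eq_square)
  qed
  define B where "B = u a * exp (a / 2) / A"
  have B: "0 < B" using pos[OF a] A_pos by (simp add: B_def)
  \<comment> \<open>Only the negative terms of \<open>J\<close> are kept; in the variable s they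
    amount to y^2 (1 + m^2 s^2)/2.\<close>
  have Jb: "- ((B * s powr th * exp (- s / 2))\<^sup>2 * (1 + m\<^sup>2 * s\<^sup>2) / 2) \<le> J y w (ln s / m)" if s: "a \<le> s" for s
  proof -
    have s0: "0 < s" using s a by simp
    have "u s \<le> u a * (exp (a/2) * exp (- s/2))"
    proof -
      have ex: "- (1/2) * (s - a) = a / 2 + - s / 2" by (simp add: field_simps)
      show ?thesis using decay[OF s] unfolding ex exp_add .
    qed
    then have "s powr th * u s \<le> s powr th * (u a * (exp (a/2) * exp (- s/2)))"
      by (intro mult_left_mono) auto
    then have "s powr th * u s / A \<le> s powr th * (u a * (exp (a/2) * exp (- s/2))) / A"
      using A_pos by (intro divide_right_mono) auto
    then have "y (ln s / m) \<le> B * s powr th * exp (- s / 2)"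
      by (simp add: yu[OF s0] B_def mult_ac)
    then have "(y (ln s / m))\<^sup>2 \<le> (B * s powr th * exp (- s / 2))\<^sup>2"
      using bound_solution_D(2)[OF bs] by (intro power_mono) (auto intro: less_imp_le)
    then have "(y (ln s / m))\<^sup>2 * (1 + m\<^sup>2 * s\<^sup>2) \<le> (B * s powr th * exp (- s / 2))\<^sup>2 * (1 + m\<^sup>2 * s\<^sup>2)"
      by (intro mult_right_mono) auto
    moreover have "- ((y (ln s / m))\<^sup>2 * (1 + m\<^sup>2 * s\<^sup>2) / 2) \<le> J y w (ln s / m)"
    proof -
      have "0 \<le> \<bar>y (ln s / m)\<bar> powr (p + 1) / (p + 1)" using p1 by simp
      then have "0 \<le> (w (ln s / m))\<^sup>2 / 2 + \<bar>y (ln s / m)\<bar> powr (p + 1) / (p + 1)" by simp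
      then show ?thesis unfolding J_def G_def es[OF s0] by (simp add: algebra_simps add_divide_distrib)
    qed
    ultimately show ?thesis by linarith
  qed
  have "((\<lambda>s. - ((B * s powr th * exp (- s / 2))\<^sup>2 * (1 + m\<^sup>2 * s\<^sup>2) / 2)) \<longlongrightarrow> 0) at_top"
    using m_pos th_pos B by real_asymp
  moreover have "J y w (ln a / m) < 0" by (rule bound_solution_D[OF bs])
  ultimately have "eventually (\<lambda>s. J y w (ln a / m) < - ((B * s powr th * exp (- s / 2))\<^sup>2 * (1 + m\<^sup>2 * s\<^sup>2) / 2)) at_top"
    by (rule order_tendstoD)
  then obtain s where s: "a \<le> s" "J y w (ln a / m) < - ((B * s powr th * exp (- s / 2))\<^sup>2 * (1 + m\<^sup>2 * s\<^sup>2) / 2)"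
    by (metis (mono_tags, lifting) eventually_at_top_linorder linorder_linear)
  have "J y w (ln s / m) \<le> J y w (ln a / m)"
    using s(1) a m_pos by (intro J_antimono[OF ef]) (simp add: divide_right_mono)
  then show False using Jb[OF s(1)] s(2) by linarith
qed

text \<open>Where u^(p-1) >= p + 1 the potential is at least u^2/2, while the energy never exceeds
  its value at s0. The second entry of B makes u^2 larger than twice that value.\<close>

lemma radial_bounded:
  assumes sol: "radial_solution u v" and s0: "0 < s0" and pos: "\<And>s. s0 \<le> s \<Longrightarrow> 0 < u s"
  obtains B where "\<And>s. s0 \<le> s \<Longrightarrow> u s \<le> B"
proof -
  define E where "E s = (v s)\<^sup>2 / 2 + G (u s)" for s
  have E: "E s \<le> E s0" if "s0 \<le> s" for s
    using that
  proof (rule DERIV_nonpos_imp_nonincreasing)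
    fix x assume "s0 \<le> x"
    then have x: "0 < x" using s0 by simp
    have "- (real N - 1) / x * (v x)\<^sup>2 \<le> 0" using x N3 by (intro mult_nonpos_nonneg) (auto simp: divide_le_0_iff)
    then show "\<exists>y. (E has_real_derivative y) (at x) \<and> y \<le> 0"
      using radial_energy_deriv[OF sol x] unfolding E_def[abs_def] by blast
  qed
  define B where "B = max ((p + 1) powr (1 / (p - 1))) (1 + 2 * \<bar>E s0\<bar>)"
  show thesis
  proof (rule that[of B], rule ccontr)
    fix s assume s: "s0 \<le> s" and "\<not> u s \<le> B"
    then have u: "(p + 1) powr (1 / (p - 1)) < u s" "1 + 2 * \<bar>E s0\<bar> < u s" by (auto simp: B_def)
    have u0: "0 < u s" by (rule pos[OF s])
    have "((p + 1) powr (1 / (p - 1))) powr (p - 1) \<le> u s powr (p - 1)"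
      using u p1 by (intro powr_mono2) auto
    then have "p + 1 \<le> u s powr (p - 1)" using p1 by (simp add: powr_powr)
    then have "(p + 1) * (u s)\<^sup>2 \<le> u s powr (p - 1) * (u s)\<^sup>2" by (intro mult_right_mono) auto
    also have "\<dots> = u s powr (p + 1)" using u0 by (simp add: powr_add[symmetric] add.commute flip: powr_numeral)
    finally have "(u s)\<^sup>2 \<le> u s powr (p + 1) / (p + 1)" using p1 by (simp add: field_simps)
    then have "(u s)\<^sup>2 / 2 \<le> G (u s)" unfolding G_def abs_of_pos[OF u0] by linarith
    also have "\<dots> \<le> E s" by (simp add: E_def)
    also have "\<dots> \<le> E s0" by (rule E[OF s])
    finally have "(u s)\<^sup>2 \<le> 2 * \<bar>E s0\<bar>" by linarith
    moreover have "1 * u s \<le> u s * u s" using u by (intro mult_right_mono) auto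
    ultimately show False using u by (simp add: power2_eq_square)
  qed
qed

text \<open>Otherwise u is eventually strictly monotone and bounded, with a limit L. The energy
  converges too, hence so does v, necessarily to 0; then v' tends to - f(L), so f(L) = 0. An
  increasing u cannot tend to 0; \<open>no_decay_to_0\<close> and
  \<open>no_monotone_convergence_to_1\<close> exclude the rest.\<close>

lemma singular_crit_unbounded:
  assumes bs: "bound_solution y w" and s0: "0 < s0"
  shows "\<exists>s>s0. rad_v y w s = 0"
proof (rule ccontr)
  assume no_zero: "\<not> ?thesis"
  define u where "u = u_sing N p y"
  define v where "v = rad_v y w"
  have nz: "v s \<noteq> 0" if "s0 < s" for s using no_zero that by (auto simp: v_def)
  note ef = bound_solution_D(1)[OF bs]
  have sol: "radial_solution u v" unfolding u_def v_def by (rule radial_solution_of_ef[OF ef])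
  have pos: "0 < u s" if "0 < s" for s
    using bound_solution_D(2)[OF bs] A_pos that by (simp add: u_def u_sing_ef)
  have du: "(u has_real_derivative v s) (at s)"
    and dv: "(v has_real_derivative - (real N - 1) / s * v s - fnl p (u s)) (at s)" if "0 < s" for s
    using sol that by (auto simp: radial_solution_def)
  define c where "c = sgn (v (s0 + 1))"
  have c: "c = 1 \<or> c = -1" using nz[of "s0 + 1"] by (auto simp: c_def sgn_if)
  have cv: "0 < c * v s" if s: "s0 < s" for s
  proof (rule ccontr)
    assume neg: "\<not> 0 < c * v s"
    have p: "0 < c * v (s0 + 1)" using nz[of "s0 + 1"] by (simp add: c_def sgn_if)
    have cont: "continuous_on {x..z} (\<lambda>s. c * v s)" if "s0 < x" for x z
      by (intro continuous_intros continuous_at_imp_continuous_on) (use that s0 DERIV_isCont[OF dv] in auto)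
    have "\<exists>x>s0. c * v x = 0"
    proof (cases "s \<le> s0 + 1")
      case True
      have "\<exists>x\<ge>s. x \<le> s0 + 1 \<and> c * v x = 0"
        by (rule IVT'[of "\<lambda>s. c * v s" s 0 "s0 + 1"])
          (use True neg p cont[OF s, of "s0 + 1"] in auto)
      then show ?thesis using s by (meson less_le_trans)
    next
      case False
      have "\<exists>x\<ge>s0 + 1. x \<le> s \<and> c * v x = 0"
        by (rule IVT2'[of "\<lambda>s. c * v s" s 0 "s0 + 1"])
          (use False neg p cont[of "s0 + 1" s] in auto)
      then show ?thesis by (meson less_le_trans less_add_one)
    qed
    then show False using nz c by auto
  qed
  define a where "a = s0 + 1"
  have a: "s0 < a" "0 < a" using s0 by (auto simp: a_def)
  obtain B where B: "\<And>s. a \<le> s \<Longrightarrow> u s \<le> B" using radial_bounded[OF sol a(2)] pos a by force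
  have mono: "c * u s < c * u t" if "a \<le> s" "s < t" for s t
    using that(2)
  proof (rule DERIV_pos_imp_increasing)
    fix x assume "s \<le> x" "x \<le> t"
    then show "\<exists>y. ((\<lambda>s. c * u s) has_real_derivative y) (at x) \<and> 0 < y"
      using cv[of x] a that DERIV_cmult[OF du[of x], of c] by (intro exI[of _ "c * v x"]) auto
  qed
  have cu_le: "c * u s \<le> \<bar>B\<bar>" if "a \<le> s" for s
    using B[OF that] pos[of s] that a c by auto
  obtain l where l: "((\<lambda>s. c * u s) \<longlongrightarrow> l) at_top" "\<And>s. a \<le> s \<Longrightarrow> c * u s \<le> l"
  proof (rule mono_bounded_tendsto[of a "\<lambda>s. c * u s" "\<bar>B\<bar>"])
    show "c * u s \<le> c * u t" if "a \<le> s" "s \<le> t" for s t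
      using mono[OF that(1), of t] that(2) by (cases "s = t") auto
  qed (use cu_le in auto)
  define L where "L = c * l"
  have "((\<lambda>s. c * (c * u s)) \<longlongrightarrow> c * l) at_top" by (intro tendsto_intros l(1))
  moreover have "c * (c * x) = x" for x using c by auto
  ultimately have uL: "(u \<longlongrightarrow> L) at_top" by (simp add: L_def)
  have neL: "u s \<noteq> L" if "a \<le> s" for s
  proof -
    have "c * u s < c * u (s + 1)" using mono that by simp
    also have "\<dots> \<le> l" using l(2)[of "s + 1"] that by simp
    finally show ?thesis using c by (auto simp: L_def)
  qed
  define E where "E s = (v s)\<^sup>2 / 2 + G (u s)" for s
  have Emono: "- E s \<le> - E t" if "a \<le> s" "s \<le> t" for s t
  proof -
    have "E t \<le> E s"
      using that(2)
    proof (rule DERIV_nonpos_imp_nonincreasing)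
      fix x assume "s \<le> x"
      then have x: "0 < x" using a that by simp
      have "- (real N - 1) / x * (v x)\<^sup>2 \<le> 0" using x N3 by (intro mult_nonpos_nonneg) (auto simp: divide_le_0_iff)
      then show "\<exists>y. (E has_real_derivative y) (at x) \<and> y \<le> 0"
        using radial_energy_deriv[OF sol x] unfolding E_def[abs_def] by blast
    qed
    then show ?thesis by simp
  qed
  have Ebound: "- E s \<le> B\<^sup>2 / 2" if s: "a \<le> s" for s
  proof -
    have "(u s)\<^sup>2 \<le> B\<^sup>2" using B[OF s] pos[of s] s a by (intro power_mono) auto
    moreover have "0 \<le> \<bar>u s\<bar> powr (p + 1) / (p + 1)" using p1 by simp
    moreover have "0 \<le> (v s)\<^sup>2 / 2" by simp
    ultimately show ?thesis unfolding E_def G_def by linarith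
  qed
  obtain e where e: "((\<lambda>s. - E s) \<longlongrightarrow> e) at_top"
    using mono_bounded_tendsto[of a "\<lambda>s. - E s", OF Emono Ebound] by blast
  have "((\<lambda>s. G (u s)) \<longlongrightarrow> G L) at_top"
    using DERIV_isCont[OF G_deriv] uL by (rule isCont_tendsto_compose)
  \<comment> \<open>|v| is recovered from the energy as sqrt(2 (E - G(u))); the constant sign c of v
    turns this into a limit of v itself.\<close>
  with e have "((\<lambda>s. sqrt (2 * (- (- E s) - G (u s)))) \<longlongrightarrow> sqrt (2 * (- e - G L))) at_top"
    by (intro tendsto_intros)
  then have "((\<lambda>s. c * sqrt (2 * (- (- E s) - G (u s)))) \<longlongrightarrow> c * sqrt (2 * (- e - G L))) at_top"
    by (rule tendsto_mult_left)
  moreover have "eventually (\<lambda>s. c * sqrt (2 * (- (- E s) - G (u s))) = v s) at_top"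
    unfolding eventually_at_top_linorder
  proof (intro exI allI impI)
    fix s assume "a \<le> s"
    then have "0 < c * v s" using cv a by simp
    then have "c * \<bar>v s\<bar> = v s" using c by auto
    then show "c * sqrt (2 * (- (- E s) - G (u s))) = v s" by (simp add: E_def)
  qed
  ultimately have vlim: "(v \<longlongrightarrow> c * sqrt (2 * (- e - G L))) at_top" by (rule Lim_transform_eventually)
  have "c * sqrt (2 * (- e - G L)) = 0"
    by (rule tendsto_deriv_zero[OF uL vlim, of 0]) (rule du)
  with vlim have v0: "(v \<longlongrightarrow> 0) at_top" by (simp only:)
  have k0: "((\<lambda>s. - (real N - 1) / s) \<longlongrightarrow> 0) at_top"
    by (rule tendsto_divide_0[OF tendsto_const filterlim_at_top_imp_at_infinity[OF filterlim_ident]])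
  have "isCont (fnl p) L"
    using fpow_continuous[of UNIV] unfolding fnl_def[abs_def]
    by (intro continuous_intros) (auto simp: continuous_on_eq_continuous_at)
  then have "((\<lambda>s. fnl p (u s)) \<longlongrightarrow> fnl p L) at_top" using uL by (rule isCont_tendsto_compose)
  then have "((\<lambda>s. - (real N - 1) / s * v s - fnl p (u s)) \<longlongrightarrow> 0 * 0 - fnl p L) at_top"
    by (intro tendsto_intros k0 v0)
  then have "0 * 0 - fnl p L = 0" by (rule tendsto_deriv_zero[OF v0, of _ _ 0]) (rule dv)
  then have fL: "fnl p L = 0" by simp
  have L0: "0 \<le> L"
    by (rule tendsto_lowerbound[OF uL]) (use pos a in \<open>auto simp: eventually_at_top_linorder intro!: exI[of _ a] less_imp_le\<close>)
  show False
  proof (cases "L = 0")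
    case True
    show False
      using c
    proof
      assume "c = 1"
      then show False using l(2)[of a] pos[OF a(2)] True by (simp add: L_def)
    next
      assume "c = -1"
      then have "rad_v y w s < 0" if "s0 < s" for s using cv[OF that] by (simp add: v_def)
      then show False using no_decay_to_0[OF bs _ s0] uL v0 True by (simp add: u_def v_def)
    qed
  next
    case False
    with L0 have Lpos: "0 < L" by simp
    have "L = 1"
    proof (rule ccontr)
      assume "L \<noteq> 1"
      then have "L powr p \<noteq> L powr 1"
        using Lpos p1 powr_less_mono[of 1 p L] powr_less_mono'[of L 1 p]
        by (cases "1 < L") auto
      then show False using fL Lpos by (simp add: fnl_def fpow_pos)
    qed
    then show False
      using no_monotone_convergence_to_1[OF sol, of a] pos a neL uL by force
  qed
qed

end

section \<open>Approach to the equilibrium\<close>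

context exponents
begin

text \<open>The shifted time \<sigma> = t + ln \<gamma> / (m th) removes \<gamma>: with E = exp(m
  \<sigma>) one has \<gamma>^p s^2 = \<gamma> E^2, so the bounds near s = 0 become relative to
  \<gamma>. Hence one \<tau> and one c serve all regular solutions.\<close>

lemma regular_entry:
  obtains \<tau> c where "0 < c"
    "\<And>\<gamma> u v. regular \<gamma> u v \<Longrightarrow> ef_y u (\<tau> - ln \<gamma> / (m * th)) \<le> 1 / 2"
    "\<And>\<gamma> u v. regular \<gamma> u v \<Longrightarrow> J (ef_y u) (ef_w u v) (\<tau> - ln \<gamma> / (m * th)) \<le> - c"
    "\<And>\<gamma> u v t. \<lbrakk>regular \<gamma> u v; t \<le> \<tau> - ln \<gamma> / (m * th)\<rbrakk> \<Longrightarrow> \<gamma> / 2 \<le> u (exp (m * t))"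
proof -
  have e1: "((\<lambda>t. exp (m * t)) \<longlongrightarrow> 0) at_bot" and e2: "((\<lambda>t. exp (m * th * t)) \<longlongrightarrow> 0) at_bot"
    using m_pos th_pos by (auto intro!: exp_at_bot)
  \<comment> \<open>E <= th/(th + 2) ensures th u + s v >= th \<gamma>/2, a lower bound for w; the
    condition with A/2 keeps y at most 1/2 at entry.\<close>
  define r where "r = min 1 (th / (th + 2))"
  have r: "0 < r" using th_pos by (simp add: r_def)
  have "eventually (\<lambda>t. exp (m * t) < r \<and> exp (m * th * t) < A / 2) at_bot"
    using order_tendstoD(2)[OF e1 r] order_tendstoD(2)[OF e2, of "A / 2"] A_pos by (simp add: eventually_conj)
  then obtain \<tau> where "exp (m * \<tau>) < r" and e\<tau>: "exp (m * th * \<tau>) < A / 2"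
    by (auto simp: eventually_at_bot_linorder)
  then have \<tau>: "exp (m * t) \<le> 1" "exp (m * t) \<le> th / (th + 2)" if "t \<le> \<tau>" for t
    using that m_pos order_trans[of "exp (m * t)" "exp (m * \<tau>)" r] by (auto simp: r_def)
  \<comment> \<open>A lower bound for w on the last unit of time before entry; there
    \<open>J\<close>, negative at its beginning, loses at least al d^2.\<close>
  define d where "d = m * th * exp (m * th * (\<tau> - 1)) / (2 * A)"
  have d: "0 < d" using m_pos th_pos A_pos by (simp add: d_def)
  have main: "ef_y u t \<le> exp (m * th * (t + ln \<gamma> / (m * th))) / A"
       "\<gamma> / 2 \<le> u (exp (m * t))"
       "m * th * exp (m * th * (t + ln \<gamma> / (m * th))) / (2 * A) \<le> ef_w u v t"
    if reg: "regular \<gamma> u v" and t: "t \<le> \<tau> - ln \<gamma> / (m * th)" for \<gamma> u v t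
  proof -
    define \<sigma> where "\<sigma> = t + ln \<gamma> / (m * th)"
    define s where "s = exp (m * t)"
    define E where "E = exp (m * \<sigma>)"
    have g: "0 < \<gamma>" using regular_D(1)[OF reg] by simp
    have E: "0 < E" "E \<le> 1" "E \<le> th / (th + 2)" using \<tau>[of \<sigma>] t by (auto simp: E_def \<sigma>_def)
    have ge: "\<gamma> * exp (m * th * t) = exp (m * th * \<sigma>)"
    proof -
      have "m * th * \<sigma> = ln \<gamma> + m * th * t" using m_pos th_pos by (simp add: \<sigma>_def field_simps)
      then show ?thesis using g by (simp add: exp_add)
    qed
    have gs: "\<gamma> powr p * s\<^sup>2 = \<gamma> * E\<^sup>2"
    proof -
      have thp: "2 / th = p - 1" using th_p th_pos by (simp add: field_simps)
      have "2 * (m * \<sigma>) = 2 * (m * t) + (2 / th) * ln \<gamma>" using m_pos th_pos by (simp add: \<sigma>_def field_simps)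
      then have 1: "exp (2 * (m * \<sigma>)) = exp (2 * (m * t)) * \<gamma> powr (p - 1)"
        using g unfolding thp by (simp add: exp_add powr_def)
      have "s\<^sup>2 = exp (2 * (m * t))" "E\<^sup>2 = exp (2 * (m * \<sigma>))"
        by (simp_all only: s_def E_def exp_double)
      then have "\<gamma> * E\<^sup>2 = (\<gamma> * \<gamma> powr (p - 1)) * s\<^sup>2" using 1 by simp
      then show ?thesis using powr_mult_base[of \<gamma> "p - 1"] g by simp
    qed
    have s0: "0 < s" by (simp add: s_def)
    have "\<bar>v s\<bar> \<le> \<gamma> powr p * s / N" by (rule regular_near_0[OF reg s0])
    then have "s * \<bar>v s\<bar> \<le> s * (\<gamma> powr p * s / N)" using s0 by (intro mult_left_mono) auto
    also have "\<dots> = \<gamma> * E\<^sup>2 / N" using gs by (simp add: power2_eq_square mult_ac)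
    finally have sv: "\<bar>s * v s\<bar> \<le> \<gamma> * E\<^sup>2 / N" using s0 by (simp add: abs_mult)
    have "\<gamma> - \<gamma> powr p * s\<^sup>2 / (2 * N) \<le> u s" by (rule regular_near_0[OF reg s0])
    then have ul: "\<gamma> - \<gamma> * E\<^sup>2 / (2 * N) \<le> u s" using gs by simp
    have uu: "u s \<le> \<gamma>" using regular_le[OF reg] s0 by simp
    have E2: "E\<^sup>2 \<le> E" using E by (simp add: power2_eq_square mult_left_le)
    have EN: "\<gamma> * E\<^sup>2 / N \<le> \<gamma> * E / 3"
      using E2 N3 g E by (intro frac_le mult_left_mono) auto
    have "ef_y u t \<le> exp (m * th * t) / A * \<gamma>"
      unfolding ef_y_def s_def[symmetric] using uu A_pos by (intro mult_left_mono) auto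
    also have "\<dots> = exp (m * th * \<sigma>) / A" using ge by (simp add: mult.commute)
    finally show "ef_y u t \<le> exp (m * th * (t + ln \<gamma> / (m * th))) / A" by (simp add: \<sigma>_def)
    have "\<gamma> * E \<le> \<gamma> * 1" using E g by (intro mult_left_mono) auto
    then have "\<gamma> * E\<^sup>2 / N \<le> \<gamma>" using EN g by linarith
    then show "\<gamma> / 2 \<le> u (exp (m * t))" using ul unfolding s_def[symmetric] by (simp add: field_simps)
    have "th * (\<gamma> * E\<^sup>2 / (2 * N)) + \<gamma> * E\<^sup>2 / N = (th + 2) / 2 * (\<gamma> * E\<^sup>2 / N)"
      using N3 by (simp add: field_simps)
    also have "\<dots> \<le> (th + 2) / 2 * (\<gamma> * E / 3)" using th_pos EN by (intro mult_left_mono) auto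
    also have "\<dots> = \<gamma> / 6 * ((th + 2) * E)" by simp
    also have "\<dots> \<le> \<gamma> / 6 * th" using E th_pos g by (intro mult_left_mono) (auto simp: field_simps)
    also have "\<dots> \<le> th * \<gamma> / 2" using th_pos g by simp
    finally have b: "th * (\<gamma> * E\<^sup>2 / (2 * N)) + \<gamma> * E\<^sup>2 / N \<le> th * \<gamma> / 2" .
    have "th * (\<gamma> - \<gamma> * E\<^sup>2 / (2 * N)) \<le> th * u s" using ul th_pos by (intro mult_left_mono) auto
    then have "th * \<gamma> - th * (\<gamma> * E\<^sup>2 / (2 * N)) \<le> th * u s" by (simp add: right_diff_distrib)
    then have "th * \<gamma> / 2 \<le> th * u s + s * v s" using b sv by linarith
    then have "m * (exp (m * th * t) / A) * (th * \<gamma> / 2) \<le> ef_w u v t"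
      unfolding ef_w_def s_def[symmetric] using m_pos A_pos by (intro mult_left_mono) auto
    moreover have "m * (exp (m * th * t) / A) * (th * \<gamma> / 2) = m * th * (\<gamma> * exp (m * th * t)) / (2 * A)"
      by (simp add: mult_ac)
    ultimately show "m * th * exp (m * th * (t + ln \<gamma> / (m * th))) / (2 * A) \<le> ef_w u v t"
      unfolding ge \<sigma>_def by simp
  qed
  show thesis
  proof (rule that[of "al * d\<^sup>2" \<tau>])
    show "0 < al * d\<^sup>2" using al_pos d by simp
    fix \<gamma> u v assume reg: "regular \<gamma> u v"
    let ?t = "\<tau> - ln \<gamma> / (m * th)"
    have "exp (m * th * \<tau>) / A \<le> 1 / 2" using e\<tau> A_pos by (simp add: field_simps)
    moreover have "ef_y u ?t \<le> exp (m * th * \<tau>) / A" using main(1)[OF reg, of ?t] by simp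
    ultimately show "ef_y u ?t \<le> 1 / 2" by (rule order_trans[rotated])
    note bs = regular_bound_solution[OF reg]
    have "J (ef_y u) (ef_w u v) ?t - J (ef_y u) (ef_w u v) (?t - 1) \<le> - (al * d\<^sup>2) * (?t - (?t - 1))"
    proof (rule diff_le_of_deriv_le)
      show "continuous_on {?t - 1..?t} (J (ef_y u) (ef_w u v))"
        using J_deriv[OF bound_solution_D(1)[OF bs]]
        by (blast intro: continuous_at_imp_continuous_on DERIV_isCont)
      fix x assume x: "?t - 1 < x" "x < ?t"
      have "d \<le> m * th * exp (m * th * (x + ln \<gamma> / (m * th))) / (2 * A)"
        unfolding d_def using m_pos th_pos A_pos x
        by (intro divide_right_mono mult_left_mono) auto
      also have "\<dots> \<le> ef_w u v x" using main(3)[OF reg, of x] x by simp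
      finally have "d\<^sup>2 \<le> (ef_w u v x)\<^sup>2" using d by (intro power_mono) auto
      then have "al * d\<^sup>2 \<le> al * (ef_w u v x)\<^sup>2" using al_pos by simp
      moreover have "0 \<le> m\<^sup>2 * m * exp (2 * m * x) * (ef_y u x)\<^sup>2" using m_pos by simp
      ultimately have "- (al * (ef_w u v x)\<^sup>2 + m\<^sup>2 * m * exp (2 * m * x) * (ef_y u x)\<^sup>2) \<le> - (al * d\<^sup>2)"
        by linarith
      then show "\<exists>d'. (J (ef_y u) (ef_w u v) has_real_derivative d') (at x) \<and> d' \<le> - (al * d\<^sup>2)"
        using J_deriv[OF bound_solution_D(1)[OF bs]] by blast
    qed simp
    then show "J (ef_y u) (ef_w u v) ?t \<le> - (al * d\<^sup>2)"
      using bound_solution_D(3)[OF bs, of "?t - 1"] by simp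
  next
    show "\<gamma> / 2 \<le> u (exp (m * t))" if "regular \<gamma> u v" "t \<le> \<tau> - ln \<gamma> / (m * th)" for \<gamma> u v t
      using main(2) that by blast
  qed
qed

text \<open>Writing y^p - y = y (y^(p-1) - 1), the mean value theorem compares it with y - 1 on a
  compact range away from 0. Integration from 1 transfers this to the potential, which has a
  nondegenerate minimum at 1.\<close>

lemma G_quadratic_bounds:
  assumes ymin: "0 < ymin" "ymin \<le> 1" and M: "1 \<le> M"
  obtains k K where "0 < k" "0 < K"
    "\<And>y. \<lbrakk>ymin \<le> y; y \<le> M\<rbrakk> \<Longrightarrow> k * (y - 1)\<^sup>2 \<le> (y - 1) * (y powr p - y)"
    "\<And>y. \<lbrakk>ymin \<le> y; y \<le> M\<rbrakk> \<Longrightarrow> k * (y - 1)\<^sup>2 / 2 \<le> G y - G 1"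
    "\<And>y. \<lbrakk>ymin \<le> y; y \<le> M\<rbrakk> \<Longrightarrow> G y - G 1 \<le> K * (y - 1)\<^sup>2 / 2"
proof -
  \<comment> \<open>The exponent p - 2 can have either sign, so x^(p-2) is smallest at one of the
    two ends.\<close>
  define q where "q = min (ymin powr (p - 2)) (M powr (p - 2))"
  define k where "k = ymin * (p - 1) * q"
  define K where "K = p * M powr (p - 1) + 1"
  have q0: "0 < q" using ymin M by (simp add: q_def)
  then have k0: "0 < k" using ymin p1 by (simp add: k_def)
  have K0: "0 < K" using p1 by (simp add: K_def add_nonneg_pos)
  have low: "k * (y - 1)\<^sup>2 \<le> (y - 1) * (y powr p - y)" if y: "ymin \<le> y" "y \<le> M" for y
  proof -
    have y0: "0 < y" using y ymin by simp
    obtain x where x: "min y 1 \<le> x" "x \<le> max y 1" "y powr (p - 1) - 1 powr (p - 1) = (p - 1) * x powr (p - 1 - 1) * (y - 1)"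
      using powr_diff_MVT[OF y0, of 1 "p - 1"] by auto
    have x': "ymin \<le> x" "x \<le> M" using x y ymin M by (auto simp: min_def max_def split: if_splits)
    have "q \<le> x powr (p - 2)"
    proof (cases "2 \<le> p")
      case True
      then have "ymin powr (p - 2) \<le> x powr (p - 2)" using x' ymin by (intro powr_mono2) auto
      then show ?thesis by (simp add: q_def)
    next
      case False
      then have "M powr (p - 2) \<le> x powr (p - 2)" using x' ymin by (intro powr_mono2') auto
      then show ?thesis by (simp add: q_def)
    qed
    then have "ymin * ((p - 1) * q) \<le> y * ((p - 1) * x powr (p - 2))"
      using y ymin p1 q0 by (intro mult_mono mult_left_mono) auto
    then have "k \<le> y * ((p - 1) * x powr (p - 2))" by (simp add: k_def mult_ac)
    then have "k * (y - 1)\<^sup>2 \<le> y * ((p - 1) * x powr (p - 2)) * (y - 1)\<^sup>2" by (intro mult_right_mono) auto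
    also have "\<dots> = (y - 1) * (y * (y powr (p - 1) - 1 powr (p - 1)))"
      unfolding x(3) by (simp add: power2_eq_square)
    also have "y * (y powr (p - 1) - 1 powr (p - 1)) = y powr p - y"
      using powr_mult_base[of y "p - 1"] y0 by (simp add: right_diff_distrib)
    finally show ?thesis .
  qed
  have up: "(y - 1) * (y powr p - y) \<le> K * (y - 1)\<^sup>2" if y: "ymin \<le> y" "y \<le> M" for y
  proof -
    have "\<bar>y powr p - 1 powr p\<bar> \<le> p * M powr (p - 1) * \<bar>y - 1\<bar>"
      using y ymin M p1 by (intro powr_lipschitz) auto
    then have "\<bar>y powr p - y\<bar> \<le> K * \<bar>y - 1\<bar>" by (simp add: K_def algebra_simps)
    then have "\<bar>y - 1\<bar> * \<bar>y powr p - y\<bar> \<le> \<bar>y - 1\<bar> * (K * \<bar>y - 1\<bar>)" by (intro mult_left_mono) auto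
    moreover have "\<bar>y - 1\<bar> * (K * \<bar>y - 1\<bar>) = K * (y - 1)\<^sup>2"
      by (simp add: power2_eq_square)
    moreover have "(y - 1) * (y powr p - y) \<le> \<bar>y - 1\<bar> * \<bar>y powr p - y\<bar>" by (metis abs_ge_self abs_mult)
    ultimately show ?thesis by linarith
  qed
  have shift: "((\<lambda>y. c * (G y - l * (y - 1)\<^sup>2 / 2)) has_real_derivative
      c * (x powr p - x - l * (x - 1))) (at x)" if "0 < x" for c l x
    using that G_deriv[of x] by (auto intro!: derivative_eq_intros simp: fpow_pos)
  \<comment> \<open>One monotonicity argument for both bounds: c = 1 gives the lower, c = -1 the
    upper one.\<close>
  have nn: "0 \<le> c * (G y - G 1 - l * (y - 1)\<^sup>2 / 2)"
    if y: "ymin \<le> y" "y \<le> M" and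
      sgn: "\<And>x. \<lbrakk>ymin \<le> x; x \<le> M\<rbrakk> \<Longrightarrow> 0 \<le> (x - 1) * (c * (x powr p - x - l * (x - 1)))" for c l y
  proof (cases "1 \<le> y")
    case True
    have "c * (G 1 - l * (1 - 1)\<^sup>2 / 2) \<le> c * (G y - l * (y - 1)\<^sup>2 / 2)"
    proof (rule DERIV_nonneg_imp_increasing_open[OF True, of "\<lambda>y. c * (G y - l * (y - 1)\<^sup>2 / 2)"])
      fix x assume x: "1 < x" "x < y"
      then have "0 \<le> (x - 1) * (c * (x powr p - x - l * (x - 1)))" using y ymin by (intro sgn) auto
      then have "0 \<le> c * (x powr p - x - l * (x - 1))" using x by (simp add: zero_le_mult_iff)
      then show "\<exists>d. ((\<lambda>y. c * (G y - l * (y - 1)\<^sup>2 / 2)) has_real_derivative d) (at x) \<and> 0 \<le> d"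
        using shift[of x c l] x by auto
    qed (intro continuous_intros G_continuous, auto)
    then show ?thesis by (simp add: right_diff_distrib)
  next
    case False
    then have y1: "y \<le> 1" by simp
    have "c * (G 1 - l * (1 - 1)\<^sup>2 / 2) \<le> c * (G y - l * (y - 1)\<^sup>2 / 2)"
    proof (rule DERIV_nonpos_imp_decreasing_open[OF y1, of "\<lambda>y. c * (G y - l * (y - 1)\<^sup>2 / 2)"])
      fix x assume x: "y < x" "x < 1"
      then have "0 \<le> (x - 1) * (c * (x powr p - x - l * (x - 1)))" using y M by (intro sgn) auto
      then have "c * (x powr p - x - l * (x - 1)) \<le> 0" using x by (simp add: zero_le_mult_iff)
      then show "\<exists>d. ((\<lambda>y. c * (G y - l * (y - 1)\<^sup>2 / 2)) has_real_derivative d) (at x) \<and> d \<le> 0"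
        using shift[of x c l] x y ymin by auto
    qed (intro continuous_intros G_continuous, auto)
    then show ?thesis by (simp add: right_diff_distrib)
  qed
  show thesis
  proof (rule that[of k K])
    fix y assume y: "ymin \<le> y" "y \<le> M"
    show "k * (y - 1)\<^sup>2 \<le> (y - 1) * (y powr p - y)" by (rule low[OF y])
    have "0 \<le> (x - 1) * (1 * (x powr p - x - k * (x - 1)))" if "ymin \<le> x" "x \<le> M" for x
      using low[OF that] by (simp add: power2_eq_square algebra_simps)
    from nn[OF y this] show "k * (y - 1)\<^sup>2 / 2 \<le> G y - G 1" by simp
    have "0 \<le> (x - 1) * ((- 1) * (x powr p - x - K * (x - 1)))" if "ymin \<le> x" "x \<le> M" for x
      using up[OF that] by (simp add: power2_eq_square algebra_simps)
    from nn[OF y this] show "G y - G 1 \<le> K * (y - 1)\<^sup>2 / 2" by simp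
  qed (use k0 K0 in auto)
qed

text \<open>The damping in \<open>J\<close> vanishes where w = 0 and gives no rate. The functional V
  with the cross term \<eta> w (y - 1) is strict, V' <= -(c/B) V + error, and comparable to w^2 + (y
  - 1)^2 as long as y stays away from 0. T and t1 depend on \<delta> but not on the orbit.\<close>

lemma approach_equilibrium:
  assumes c0: "0 < c0"
  obtains ymin t0 where "0 < ymin"
    "\<And>y w b t. \<lbrakk>bound_solution y w; J y w b \<le> - c0; b \<le> t; t \<le> t0\<rbrakk> \<Longrightarrow> ymin \<le> y t"
    "\<And>\<delta>. 0 < \<delta> \<Longrightarrow> \<exists>T\<ge>0. \<exists>t1\<le>t0. \<forall>y w b t. bound_solution y w \<longrightarrow> J y w b \<le> - c0 \<longrightarrow>
        b + T \<le> t \<longrightarrow> t \<le> t1 \<longrightarrow> \<bar>y t - 1\<bar> \<le> \<delta> \<and> \<bar>w t\<bar> \<le> \<delta>"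
proof -
  obtain M where M: "1 \<le> M" "\<And>y w t. bound_solution y w \<Longrightarrow> t \<le> 0 \<Longrightarrow> y t \<le> M \<and> \<bar>w t\<bar> \<le> M"
    using bound_solution_bounded[of 0] by blast
  have e0: "((\<lambda>t. exp (2 * m * t)) \<longlongrightarrow> 0) at_bot" using m_pos by (intro exp_at_bot) auto
  have small: "\<exists>t1\<le>a. \<forall>t\<le>t1. C * exp (2 * m * t) \<le> e" if "0 < e" for C e a :: real
  proof -
    have "((\<lambda>t. C * exp (2 * m * t)) \<longlongrightarrow> C * 0) at_bot" by (intro tendsto_intros e0)
    then have "eventually (\<lambda>t. C * exp (2 * m * t) < e) at_bot" using that by (intro order_tendstoD) auto
    then obtain b where "\<And>t. t \<le> b \<Longrightarrow> C * exp (2 * m * t) < e" by (auto simp: eventually_at_bot_linorder)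
    then show ?thesis by (intro exI[of _ "min a b"]) (auto intro: less_imp_le)
  qed
  \<comment> \<open>\<open>J \<le> - c0\<close> and an exponential term of at most c0/2 give G(y) <=
    -c0/2, while G(y) >= -y^2/2; hence y >= sqrt c0.\<close>
  define ymin where "ymin = min 1 (sqrt c0)"
  have ymin: "0 < ymin" "ymin \<le> 1" using c0 by (auto simp: ymin_def)
  obtain t0 where t0: "t0 \<le> 0" "\<And>t. t \<le> t0 \<Longrightarrow> (m\<^sup>2 * M\<^sup>2 / 2) * exp (2 * m * t) \<le> c0 / 2"
    using small[of "c0 / 2" 0 "m\<^sup>2 * M\<^sup>2 / 2"] c0 by auto
  have lower: "ymin \<le> y t"
    if bs: "bound_solution y w" and Jb: "J y w b \<le> - c0" and bt: "b \<le> t" "t \<le> t0" for y w b t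
  proof -
    have y: "0 < y t" "y t \<le> M" using bound_solution_D(2)[OF bs] M(2)[OF bs, of t] bt t0 by auto
    have "m\<^sup>2 * exp (2 * m * t) * (y t)\<^sup>2 / 2 \<le> m\<^sup>2 * exp (2 * m * t) * M\<^sup>2 / 2"
      using y by (intro divide_right_mono mult_left_mono power_mono) auto
    also have "\<dots> = (m\<^sup>2 * M\<^sup>2 / 2) * exp (2 * m * t)" by simp
    also have "\<dots> \<le> c0 / 2" by (rule t0(2)[OF bt(2)])
    finally have pert: "m\<^sup>2 * exp (2 * m * t) * (y t)\<^sup>2 / 2 \<le> c0 / 2" .
    have "J y w t \<le> - c0" using J_antimono[OF bound_solution_D(1)[OF bs] bt(1)] Jb by simp
    then have "(w t)\<^sup>2 / 2 + G (y t) \<le> - (c0 / 2)" using pert unfolding J_def by linarith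
    moreover have "0 \<le> (w t)\<^sup>2 / 2" by simp
    moreover have "0 \<le> \<bar>y t\<bar> powr (p + 1) / (p + 1)" using p1 by simp
    ultimately have "c0 \<le> (y t)\<^sup>2" unfolding G_def by linarith
    then have "sqrt c0 \<le> y t" using y by (simp add: real_le_lsqrt)
    then show ?thesis by (simp add: ymin_def)
  qed
  obtain k K where k0: "0 < k" and K0: "0 < K"
    and k1: "\<And>y. \<lbrakk>ymin \<le> y; y \<le> M\<rbrakk> \<Longrightarrow> k * (y - 1)\<^sup>2 \<le> (y - 1) * (y powr p - y)"
    and k2: "\<And>y. \<lbrakk>ymin \<le> y; y \<le> M\<rbrakk> \<Longrightarrow> k * (y - 1)\<^sup>2 / 2 \<le> G y - G 1"
    and K1: "\<And>y. \<lbrakk>ymin \<le> y; y \<le> M\<rbrakk> \<Longrightarrow> G y - G 1 \<le> K * (y - 1)\<^sup>2 / 2"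
    using G_quadratic_bounds[OF ymin M(1)] by metis
  \<comment> \<open>The first entry keeps V comparable to the quadratic form. The second lets the
    damping absorb \<eta> w^2 and the w^2 share of the mixed term - \<eta> al w (y - 1).\<close>
  define \<eta> where "\<eta> = min (min 1 k / 2) (al / (2 * (1 + al\<^sup>2 / (2 * k))))"
  have den: "0 < 1 + al\<^sup>2 / (2 * k)" using k0 by (simp add: add_pos_nonneg)
  have \<eta>: "0 < \<eta>" "\<eta> \<le> 1 / 2" "\<eta> \<le> k / 2" "\<eta> * (1 + al\<^sup>2 / (2 * k)) \<le> al / 2"
  proof -
    show "0 < \<eta>" using k0 al_pos den by (simp add: \<eta>_def)
    have "\<eta> \<le> min 1 k / 2" unfolding \<eta>_def by (rule min.cobounded1)
    then show "\<eta> \<le> 1 / 2" "\<eta> \<le> k / 2" by linarith+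
    have "\<eta> \<le> al / (2 * (1 + al\<^sup>2 / (2 * k)))" unfolding \<eta>_def by (rule min.cobounded2)
    then have "\<eta> * (1 + al\<^sup>2 / (2 * k)) \<le> al / (2 * (1 + al\<^sup>2 / (2 * k))) * (1 + al\<^sup>2 / (2 * k))"
      using den by (intro mult_right_mono) auto
    also have "\<dots> = al / 2" using den by (simp add: field_simps)
    finally show "\<eta> * (1 + al\<^sup>2 / (2 * k)) \<le> al / 2" .
  qed
  define a where "a = min 1 k / 4"
  define B where "B = 1 + K"
  define c where "c = min (al / 2) (\<eta> * k / 2)"
  have pos: "0 < a" "0 < B" "0 < c" using k0 K0 al_pos \<eta> by (auto simp: a_def B_def c_def)
  define V where "V y w t = (w t)\<^sup>2 / 2 + G (y t) + \<eta> * (w t * (y t - 1)) - G 1" for y w :: "real \<Rightarrow> real" and t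
  have cross: "\<bar>x * z\<bar> \<le> (x\<^sup>2 + z\<^sup>2) / 2" for x z :: real
    using sum_squares_bound[of "\<bar>x\<bar>" "\<bar>z\<bar>"] by (simp add: abs_mult)
  have Vlow: "a * ((w t)\<^sup>2 + (y t - 1)\<^sup>2) \<le> V y w t" and Vup: "V y w t \<le> B * ((w t)\<^sup>2 + (y t - 1)\<^sup>2)"
    if y: "ymin \<le> y t" "y t \<le> M" for y w t
  proof -
    define W where "W = (w t)\<^sup>2"
    define X where "X = (y t - 1)\<^sup>2"
    define P where "P = \<eta> * (w t * (y t - 1))"
    have V: "V y w t = W / 2 + G (y t) + P - G 1" by (simp add: V_def W_def P_def)
    have nonneg: "0 \<le> W" "0 \<le> X" by (auto simp: W_def X_def)
    have "\<bar>P\<bar> \<le> \<eta> * ((W + X) / 2)"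
      using cross[of "w t" "y t - 1"] \<eta> by (simp add: abs_mult mult_left_mono W_def X_def P_def)
    then have P: "\<bar>P\<bar> \<le> \<eta> * W / 2 + \<eta> * X / 2" by (simp add: algebra_simps)
    have "(a + \<eta> / 2) * W \<le> 1 / 2 * W" "(a + \<eta> / 2) * X \<le> k / 2 * X"
      using \<eta> nonneg by (intro mult_right_mono; simp add: a_def min_def)+
    then have "a * W + \<eta> * W / 2 \<le> W / 2" "a * X + \<eta> * X / 2 \<le> k * X / 2"
      by (simp_all add: algebra_simps)
    then have "a * (W + X) \<le> V y w t"
      using k2[OF y] P unfolding V X_def[symmetric] distrib_left by linarith
    then show "a * ((w t)\<^sup>2 + (y t - 1)\<^sup>2) \<le> V y w t" by (simp add: W_def X_def)
    have "(1 / 2 + \<eta> / 2) * W \<le> B * W" "(K / 2 + \<eta> / 2) * X \<le> B * X"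
      using \<eta> K0 nonneg by (intro mult_right_mono; simp add: B_def)+
    then have "W / 2 + \<eta> * W / 2 \<le> B * W" "K * X / 2 + \<eta> * X / 2 \<le> B * X"
      by (simp_all add: algebra_simps)
    then have "V y w t \<le> B * (W + X)"
      using K1[OF y] P unfolding V X_def[symmetric] distrib_left by linarith
    then show "V y w t \<le> B * ((w t)\<^sup>2 + (y t - 1)\<^sup>2)" by (simp add: W_def X_def)
  qed
  have dV: "\<exists>d. (V y w has_real_derivative d) (at t) \<and> d \<le> - (c / B) * V y w t + 2 * M * \<rho>"
    if ef: "ef_solution y w" and y: "ymin \<le> y t" "y t \<le> M" and w: "\<bar>w t\<bar> \<le> M"
      and \<rho>: "m\<^sup>2 * exp (2 * m * t) * M \<le> \<rho>" for y w t \<rho>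
  proof -
    define x where "x = y t - 1"
    define r where "r = m\<^sup>2 * exp (2 * m * t) * y t"
    define g where "g = y t powr p - y t"
    have y0: "0 < y t" using y ymin by simp
    have dy: "(y has_real_derivative w t) (at t)"
      and dw: "(w has_real_derivative - al * w t - g + r) (at t)"
      using ef_D[OF ef, of t] y0 by (auto simp: g_def r_def fpow_pos algebra_simps)
    have dG: "((\<lambda>t. G (y t)) has_real_derivative g * w t) (at t)"
      using DERIV_chain2[OF G_deriv dy] y0 by (simp add: g_def fpow_pos)
    have "(V y w has_real_derivative
        w t * (- al * w t - g + r) + g * w t + \<eta> * ((- al * w t - g + r) * x + w t * w t)) (at t)"
      unfolding V_def[abs_def] x_def
      by (auto intro!: derivative_eq_intros dy dw dG)
    moreover have "w t * (- al * w t - g + r) + g * w t + \<eta> * ((- al * w t - g + r) * x + w t * w t)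
      = - (al - \<eta>) * (w t)\<^sup>2 - \<eta> * (x * g) - \<eta> * (al * w t * x) + r * (w t + \<eta> * x)"
      by (simp add: power2_eq_square algebra_simps)
    moreover have "\<dots> \<le> - (c / B) * V y w t + 2 * M * \<rho>"
    proof -
      have 1: "\<eta> * (k * x\<^sup>2) \<le> \<eta> * (x * g)"
        using k1[OF y] \<eta> by (intro mult_left_mono) (auto simp: x_def g_def)
      \<comment> \<open>Young's inequality with weight k; its x^2 share uses up only half of the
        restoring term k x^2.\<close>
      have "- (al * w t * x) \<le> k * x\<^sup>2 / 2 + al\<^sup>2 / (2 * k) * (w t)\<^sup>2"
      proof -
        have "0 \<le> (k * x + al * w t)\<^sup>2 / (2 * k)" using k0 by simp
        also have "\<dots> = k * x\<^sup>2 / 2 + al * w t * x + al\<^sup>2 / (2 * k) * (w t)\<^sup>2"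
          using k0 by (simp add: power2_eq_square field_simps)
        finally show ?thesis by linarith
      qed
      then have "\<eta> * (- (al * w t * x)) \<le> \<eta> * (k * x\<^sup>2 / 2 + al\<^sup>2 / (2 * k) * (w t)\<^sup>2)"
        using \<eta> by (intro mult_left_mono) auto
      then have 2: "- \<eta> * (al * w t * x) \<le> \<eta> * (k * x\<^sup>2) / 2 + \<eta> * (al\<^sup>2 / (2 * k)) * (w t)\<^sup>2"
        by (simp add: algebra_simps)
      have 3: "r * (w t + \<eta> * x) \<le> 2 * M * \<rho>"
      proof -
        have r: "0 \<le> r" "r \<le> \<rho>"
        proof -
          show "0 \<le> r" using y0 by (simp add: r_def)
          have "r \<le> m\<^sup>2 * exp (2 * m * t) * M" unfolding r_def using y by (intro mult_left_mono) auto
          then show "r \<le> \<rho>" using \<rho> by simp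
        qed
        have "\<bar>x\<bar> \<le> M" using y0 y M(1) by (auto simp: x_def abs_le_iff)
        then have "\<eta> * \<bar>x\<bar> \<le> 1 * M" using \<eta> by (intro mult_mono) auto
        moreover have "\<eta> * x \<le> \<eta> * \<bar>x\<bar>" using \<eta> by (intro mult_left_mono) auto
        ultimately have "w t + \<eta> * x \<le> 2 * M" using w by linarith
        then have "r * (w t + \<eta> * x) \<le> r * (2 * M)" using r by (intro mult_left_mono) auto
        also have "\<dots> \<le> \<rho> * (2 * M)" using r M(1) by (intro mult_right_mono) auto
        finally show ?thesis by (simp add: mult_ac)
      qed
      have "(\<eta> * (1 + al\<^sup>2 / (2 * k))) * (w t)\<^sup>2 \<le> al / 2 * (w t)\<^sup>2" using \<eta>(4) by (intro mult_right_mono) auto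
      then have 4: "\<eta> * (w t)\<^sup>2 + \<eta> * (al\<^sup>2 / (2 * k)) * (w t)\<^sup>2 \<le> al / 2 * (w t)\<^sup>2"
        by (simp add: algebra_simps)
      have 5: "c * (w t)\<^sup>2 \<le> al / 2 * (w t)\<^sup>2" "c * x\<^sup>2 \<le> \<eta> * k / 2 * x\<^sup>2"
        by (intro mult_right_mono; simp add: c_def)+
      have "c / B * V y w t \<le> c / B * (B * ((w t)\<^sup>2 + x\<^sup>2))"
        using Vup[of y t, OF y] pos unfolding x_def by (intro mult_left_mono) auto
      then have 6: "c / B * V y w t \<le> c * (w t)\<^sup>2 + c * x\<^sup>2" using pos by (simp add: algebra_simps)
      have "- (al - \<eta>) * (w t)\<^sup>2 = - 2 * (al / 2 * (w t)\<^sup>2) + \<eta> * (w t)\<^sup>2" by (simp add: algebra_simps)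
      moreover have "\<eta> * k / 2 * x\<^sup>2 = \<eta> * (k * x\<^sup>2) / 2" by simp
      moreover have "- (c / B) * V y w t = - (c / B * V y w t)" by simp
      ultimately show ?thesis using 1 2 3 4 5 6 by linarith
    qed
    ultimately show ?thesis by metis
  qed
  have conv: "\<exists>T\<ge>0. \<exists>t1\<le>t0. \<forall>y w b t. bound_solution y w \<longrightarrow> J y w b \<le> - c0 \<longrightarrow>
        b + T \<le> t \<longrightarrow> t \<le> t1 \<longrightarrow> \<bar>y t - 1\<bar> \<le> \<delta> \<and> \<bar>w t\<bar> \<le> \<delta>" if \<delta>: "0 < \<delta>" for \<delta>
  proof -
    \<comment> \<open>Makes the error 2 M \<rho> equal to (c/B) R with R = a \<delta>^2/2. Then V -
      R decays exponentially, and V < a \<delta>^2 once the transient is below R.\<close>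
    define \<rho> where "\<rho> = a * \<delta>\<^sup>2 / 2 * (c / B) / (2 * M)"
    have \<rho>0: "0 < \<rho>" using pos \<delta> M(1) by (simp add: \<rho>_def)
    obtain t1 where t1: "t1 \<le> t0" "\<And>t. t \<le> t1 \<Longrightarrow> m\<^sup>2 * M * exp (2 * m * t) \<le> \<rho>"
      using small[OF \<rho>0, of t0 "m\<^sup>2 * M"] by blast
    have cB: "0 < c / B" using pos by simp
    have "((\<lambda>T. (2 * B * M\<^sup>2) * exp ((- (c / B)) * T)) \<longlongrightarrow> (2 * B * M\<^sup>2) * 0) at_top"
    proof (rule tendsto_mult_left)
      have "filterlim (\<lambda>T. c / B * T) at_top at_top"
        by (rule filterlim_tendsto_pos_mult_at_top[OF tendsto_const cB filterlim_ident])
      then have "filterlim (\<lambda>T. - (c / B) * T) at_bot at_top" by (simp add: filterlim_uminus_at_bot)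
      then show "((\<lambda>T. exp (- (c / B) * T)) \<longlongrightarrow> 0) at_top" by (rule filterlim_compose[OF Transcendental.exp_at_bot])
    qed
    then have "eventually (\<lambda>T. (2 * B * M\<^sup>2) * exp (- (c / B) * T) < a * \<delta>\<^sup>2 / 2) at_top"
      using pos \<delta> by (intro order_tendstoD(2)) auto
    then obtain T0 where T0: "\<And>T. T0 \<le> T \<Longrightarrow> (2 * B * M\<^sup>2) * exp (- (c / B) * T) < a * \<delta>\<^sup>2 / 2"
      by (auto simp: eventually_at_top_linorder)
    define T where "T = max T0 0"
    show ?thesis
    proof (rule exI[of _ T], intro conjI exI[of _ t1] allI impI)
      show "0 \<le> T" by (simp add: T_def)
      show "t1 \<le> t0" by (rule t1(1))
      fix y w :: "real \<Rightarrow> real" and b t :: real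
      assume bs: "bound_solution y w" and Jb: "J y w b \<le> - c0" and bt: "b + T \<le> t" "t \<le> t1"
      note ef = bound_solution_D(1)[OF bs]
      have bt': "b \<le> t" using bt by (simp add: T_def)
      have rng: "ymin \<le> y x" "y x \<le> M" "\<bar>w x\<bar> \<le> M" if "b \<le> x" "x \<le> t" for x
        using lower[OF bs Jb that(1)] M(2)[OF bs, of x] that bt t1(1) t0(1) by auto
      define R where "R = a * \<delta>\<^sup>2 / 2"
      have R: "2 * M * \<rho> = c / B * R" using M(1) by (simp add: \<rho>_def R_def mult_ac)
      have "V y w t - R \<le> (V y w b - R) * exp (- (c / B) * (t - b))"
      proof (rule gronwall_le[OF bt'])
        have D: "\<exists>d. (V y w has_real_derivative d) (at x) \<and> d \<le> - (c / B) * V y w x + 2 * M * \<rho>"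
          if "b \<le> x" "x \<le> t" for x
        proof -
          have "m\<^sup>2 * exp (2 * m * x) * M \<le> \<rho>" using t1(2)[of x] that bt by (simp add: mult_ac)
          then show ?thesis by (rule dV[OF ef rng[OF that]])
        qed
        show "continuous_on {b..t} (\<lambda>x. V y w x - R)"
        proof (intro continuous_intros continuous_at_imp_continuous_on ballI)
          fix x assume "x \<in> {b..t}"
          then obtain d where "(V y w has_real_derivative d) (at x)" using D[of x] by auto
          then show "isCont (V y w) x" by (rule DERIV_isCont)
        qed
        fix x assume "b < x" "x < t"
        then obtain d where d: "(V y w has_real_derivative d) (at x)" "d \<le> - (c / B) * V y w x + 2 * M * \<rho>"
          using D[of x] by auto
        have "((\<lambda>x. V y w x - R) has_real_derivative d) (at x)"
          by (rule DERIV_cong[OF DERIV_diff[OF d(1) DERIV_const]]) simp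
        moreover have "d \<le> - (c / B) * (V y w x - R)" using d(2) unfolding R by (simp add: algebra_simps)
        ultimately show "\<exists>d. ((\<lambda>x. V y w x - R) has_real_derivative d) (at x) \<and> d \<le> - (c / B) * (V y w x - R)"
          by blast
      qed
      also have "\<dots> \<le> (2 * B * M\<^sup>2) * exp (- (c / B) * (t - b))"
      proof (rule mult_right_mono)
        have "(w b)\<^sup>2 \<le> M\<^sup>2" using rng(3)[OF order_refl bt'] M(1) by (simp add: abs_le_square_iff[symmetric])
        moreover have "(y b - 1)\<^sup>2 \<le> M\<^sup>2"
          using rng(1,2)[OF order_refl bt'] ymin M(1) by (simp add: abs_le_square_iff[symmetric] abs_le_iff)
        ultimately have "B * ((w b)\<^sup>2 + (y b - 1)\<^sup>2) \<le> B * (M\<^sup>2 + M\<^sup>2)" using pos by (intro mult_left_mono) auto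
        then have "V y w b \<le> 2 * B * M\<^sup>2" using Vup[of y b, OF rng(1,2)[OF order_refl bt'], of w] by simp
        moreover have "0 \<le> R" using pos by (simp add: R_def)
        ultimately show "V y w b - R \<le> 2 * B * M\<^sup>2" by simp
      qed simp
      also have "\<dots> < R" unfolding R_def using bt by (intro T0) (simp add: T_def)
      finally have "V y w t < a * \<delta>\<^sup>2" by (simp add: R_def)
      then have "a * ((w t)\<^sup>2 + (y t - 1)\<^sup>2) < a * \<delta>\<^sup>2"
        using Vlow[of y t, OF rng(1,2)[OF bt' order_refl], of w] by linarith
      then have q: "(w t)\<^sup>2 + (y t - 1)\<^sup>2 < \<delta>\<^sup>2" using pos by simp
      then have "(w t)\<^sup>2 \<le> \<delta>\<^sup>2" "(y t - 1)\<^sup>2 \<le> \<delta>\<^sup>2"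
        using zero_le_power2[of "w t"] zero_le_power2[of "y t - 1"] by linarith+
      then show "\<bar>y t - 1\<bar> \<le> \<delta>" "\<bar>w t\<bar> \<le> \<delta>" using \<delta> by (auto simp: abs_le_square_iff[symmetric])
    qed
  qed
  show thesis
    by (rule that[of ymin t0]) (use ymin(1) lower conv in blast)+
qed

end

section \<open>The difference to the singular solution\<close>

context exponents
begin

text \<open>With D = y1 - y2 the parts are om D and D' + (al/2) D. In these coordinates the flow of
  D'' + al D' + (p - 1) D = 0 is multiplication by a complex number, and D = 0 means that the value
  is purely imaginary.\<close>

definition zc :: "(real \<Rightarrow> real) \<Rightarrow> (real \<Rightarrow> real) \<Rightarrow> (real \<Rightarrow> real) \<Rightarrow> (real \<Rightarrow> real) \<Rightarrow> real \<Rightarrow> complex" where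
  "zc y1 w1 y2 w2 t = Complex (om * (y1 t - y2 t)) (w1 t - w2 t + al / 2 * (y1 t - y2 t))"

text \<open>The derivative of \<open>zc\<close> with the equations of two positive solutions
  inserted.\<close>

definition zc' :: "(real \<Rightarrow> real) \<Rightarrow> (real \<Rightarrow> real) \<Rightarrow> (real \<Rightarrow> real) \<Rightarrow> (real \<Rightarrow> real) \<Rightarrow> real \<Rightarrow> complex" where
  "zc' y1 w1 y2 w2 t = Complex (om * (w1 t - w2 t))
     (- (al / 2) * (w1 t - w2 t) + (1 + m\<^sup>2 * exp (2 * m * t)) * (y1 t - y2 t) - (y1 t powr p - y2 t powr p))"

text \<open>Eigenvalue of the linearised flow: the real part is the decay, the negative imaginary
  part a clockwise rotation.\<close>

definition rate :: complex where
  "rate = Complex (- al / 2) (- om)"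

lemma zc_deriv:
  assumes "bound_solution y1 w1" "bound_solution y2 w2"
  shows "(zc y1 w1 y2 w2 has_vector_derivative zc' y1 w1 y2 w2 t) (at t)"
proof -
  note bs = bound_solution_D[OF assms(1)] bound_solution_D[OF assms(2)]
  note d = ef_D[OF bs(1), of t] ef_D[OF bs(4), of t]
  show ?thesis
    unfolding has_vector_derivative_complex_iff zc_def zc'_def complex.sel
  proof
    show "((\<lambda>t. om * (y1 t - y2 t)) has_real_derivative om * (w1 t - w2 t)) (at t)"
      by (rule DERIV_cmult[OF DERIV_diff[OF d(1,3)]])
    define h where "h = al / 2"
    have al: "al = 2 * h" by (simp add: h_def)
    show "((\<lambda>t. w1 t - w2 t + al / 2 * (y1 t - y2 t)) has_real_derivative
      - (al / 2) * (w1 t - w2 t) + (1 + m\<^sup>2 * exp (2 * m * t)) * (y1 t - y2 t) - (y1 t powr p - y2 t powr p)) (at t)"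
      by (rule DERIV_cong[OF DERIV_add[OF DERIV_diff[OF d(2,4)] DERIV_cmult[OF DERIV_diff[OF d(1,3)]]]])
        (use bs(2,5)[of t] in \<open>simp add: fpow_pos al algebra_simps\<close>)
  qed
qed

lemma zc_zero_iff: "zc y1 w1 y2 w2 t = 0 \<longleftrightarrow> y1 t = y2 t \<and> w1 t = w2 t"
  using om_pos by (auto simp: zc_def complex_eq_iff)

text \<open>Since al^2/4 + om^2 = p - 1, the deviation from the linear flow consists only of the
  exponential term and the remainder of the power. Because |D| <= |z|/om it is bounded relative to
  z, however small the difference of the orbits is.\<close>

lemma zc_rate:
  assumes g: "\<bar>y1 t powr p - y2 t powr p - p * (y1 t - y2 t)\<bar> + m\<^sup>2 * exp (2 * m * t) * \<bar>y1 t - y2 t\<bar>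
      \<le> g * \<bar>y1 t - y2 t\<bar>" and g0: "0 \<le> g"
  shows "norm (zc' y1 w1 y2 w2 t - rate * zc y1 w1 y2 w2 t) \<le> g / om * norm (zc y1 w1 y2 w2 t)"
proof -
  define D where "D = y1 t - y2 t"
  define h where "h = y1 t powr p - y2 t powr p - p * D"
  have om2: "al * al / 4 + om * om = p - 1" using om_sq by (simp add: power2_eq_square)
  have "zc' y1 w1 y2 w2 t - rate * zc y1 w1 y2 w2 t = Complex 0 (m\<^sup>2 * exp (2 * m * t) * D - h)"
  proof (rule complex_eqI)
    show "Re (zc' y1 w1 y2 w2 t - rate * zc y1 w1 y2 w2 t) = Re (Complex 0 (m\<^sup>2 * exp (2 * m * t) * D - h))"
      by (simp add: zc'_def zc_def rate_def algebra_simps diff_divide_distrib)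
    have "Im (zc' y1 w1 y2 w2 t - rate * zc y1 w1 y2 w2 t)
      = (1 + m\<^sup>2 * exp (2 * m * t)) * D - (y1 t powr p - y2 t powr p) + (al * al / 4 + om * om) * D"
    proof -
      define h where "h = al / 2"
      have al: "al = 2 * h" by (simp add: h_def)
      show ?thesis unfolding D_def by (simp add: zc'_def zc_def rate_def al algebra_simps)
    qed
    also have "\<dots> = m\<^sup>2 * exp (2 * m * t) * D - h"
      unfolding om2 h_def by (simp add: algebra_simps)
    finally show "Im (zc' y1 w1 y2 w2 t - rate * zc y1 w1 y2 w2 t) = Im (Complex 0 (m\<^sup>2 * exp (2 * m * t) * D - h))"
      by simp
  qed
  then have "norm (zc' y1 w1 y2 w2 t - rate * zc y1 w1 y2 w2 t) = \<bar>m\<^sup>2 * exp (2 * m * t) * D - h\<bar>"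
    by (simp add: complex_norm)
  also have "\<dots> \<le> m\<^sup>2 * exp (2 * m * t) * \<bar>D\<bar> + \<bar>h\<bar>"
    using abs_triangle_ineq4[of "m\<^sup>2 * exp (2 * m * t) * D" h] by (simp add: abs_mult)
  also have "\<dots> \<le> g * \<bar>D\<bar>" using g by (simp add: D_def h_def)
  also have "\<dots> = g / om * \<bar>om * D\<bar>" using om_pos by (simp add: abs_mult)
  also have "\<dots> \<le> g / om * norm (zc y1 w1 y2 w2 t)"
    using abs_Re_le_cmod[of "zc y1 w1 y2 w2 t"] g0 om_pos
    by (intro mult_left_mono) (auto simp: zc_def D_def)
  finally show ?thesis .
qed

text \<open>A crude version from the Lipschitz bound of the power, for time ranges of bounded length
  where the orbits need not be near the equilibrium.\<close>

lemma zc_rate_bounded: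
  obtains K where "0 < K" "\<And>y1 w1 y2 w2 t. \<lbrakk>bound_solution y1 w1; bound_solution y2 w2; t \<le> T\<rbrakk> \<Longrightarrow>
    norm (zc' y1 w1 y2 w2 t - rate * zc y1 w1 y2 w2 t) \<le> K * norm (zc y1 w1 y2 w2 t)"
proof -
  obtain M where M: "1 \<le> M" "\<And>y w t. bound_solution y w \<Longrightarrow> t \<le> T \<Longrightarrow> y t \<le> M \<and> \<bar>w t\<bar> \<le> M"
    using bound_solution_bounded[of T] by blast
  define g where "g = p * M powr (p - 1) + p + m\<^sup>2 * exp (2 * m * T)"
  have g: "0 < g" using p1 M(1) by (auto simp: g_def intro!: add_nonneg_pos add_pos_nonneg)
  show thesis
  proof (rule that[of "g / om"])
    show "0 < g / om" using g om_pos by simp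
    fix y1 w1 y2 w2 :: "real \<Rightarrow> real" and t
    assume bs: "bound_solution y1 w1" "bound_solution y2 w2" and t: "t \<le> T"
    have "\<bar>y1 t powr p - y2 t powr p\<bar> \<le> p * M powr (p - 1) * \<bar>y1 t - y2 t\<bar>"
      using bound_solution_D(2)[OF bs(1)] bound_solution_D(2)[OF bs(2)] M(2)[OF bs(1) t] M(2)[OF bs(2) t] p1
      by (intro powr_lipschitz) auto
    moreover have "\<bar>y1 t powr p - y2 t powr p - p * (y1 t - y2 t)\<bar>
        \<le> \<bar>y1 t powr p - y2 t powr p\<bar> + p * \<bar>y1 t - y2 t\<bar>"
      using abs_triangle_ineq4[of "y1 t powr p - y2 t powr p" "p * (y1 t - y2 t)"] p1 by (simp add: abs_mult)
    moreover have "m\<^sup>2 * exp (2 * m * t) * \<bar>y1 t - y2 t\<bar> \<le> m\<^sup>2 * exp (2 * m * T) * \<bar>y1 t - y2 t\<bar>"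
      using t m_pos by (intro mult_right_mono mult_left_mono) auto
    ultimately show "norm (zc' y1 w1 y2 w2 t - rate * zc y1 w1 y2 w2 t) \<le> g / om * norm (zc y1 w1 y2 w2 t)"
      using g by (intro zc_rate) (auto simp: g_def distrib_right)
  qed
qed

text \<open>Gronwall for |z|^2 in reversed time. The backward direction is the useful one, since the
  behaviour at -\<infinity> tells a regular orbit from the singular one.\<close>

lemma zc_zero_backwards:
  assumes bs: "bound_solution y1 w1" "bound_solution y2 w2" and z0: "zc y1 w1 y2 w2 b = 0" and a: "a \<le> b"
  shows "zc y1 w1 y2 w2 a = 0"
proof -
  define z where "z = zc y1 w1 y2 w2"
  define z' where "z' = zc' y1 w1 y2 w2"
  obtain K where K: "0 < K" "\<And>t. t \<le> b \<Longrightarrow> norm (z' t - rate * z t) \<le> K * norm (z t)"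
    using zc_rate_bounded[of b] bs unfolding z_def z'_def by metis
  define C where "C = norm rate + K"
  have C: "norm (z' t) \<le> C * norm (z t)" if "t \<le> b" for t
  proof -
    have "norm (z' t) \<le> norm (z' t - rate * z t) + norm (rate * z t)" by (metis diff_add_cancel norm_triangle_ineq)
    then show ?thesis using K(2)[OF that] by (simp add: norm_mult C_def distrib_right)
  qed
  define e where "e t = (Re (z (- t)))\<^sup>2 + (Im (z (- t)))\<^sup>2" for t
  have en: "e t = (norm (z (- t)))\<^sup>2" for t by (simp add: e_def cmod_power2)
  have De: "(e has_real_derivative
     - 2 * (Re (z (- t)) * Re (z' (- t)) + Im (z (- t)) * Im (z' (- t)))) (at t)" for t
  proof -
    have "(z has_vector_derivative z' (- t)) (at (- t))" unfolding z_def z'_def by (rule zc_deriv[OF bs])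
    then have d: "((\<lambda>x. Re (z x)) has_real_derivative Re (z' (- t))) (at (- t))"
      "((\<lambda>x. Im (z x)) has_real_derivative Im (z' (- t))) (at (- t))"
      by (auto simp: has_vector_derivative_complex_iff)
    have mt: "(uminus has_real_derivative - 1) (at t)" by (auto intro!: derivative_eq_intros)
    have "((\<lambda>x. Re (z (- x))) has_real_derivative - Re (z' (- t))) (at t)"
      "((\<lambda>x. Im (z (- x))) has_real_derivative - Im (z' (- t))) (at t)"
      using DERIV_chain2[OF d(1) mt] DERIV_chain2[OF d(2) mt] by simp_all
    from DERIV_add[OF DERIV_power[OF this(1), of 2] DERIV_power[OF this(2), of 2]]
    show ?thesis unfolding e_def by (rule DERIV_cong) (simp add: mult_ac)
  qed
  have "e (- a) \<le> e (- b) * exp (2 * C * (- a - - b))"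
  proof (rule gronwall_le)
    show "continuous_on {- b..- a} e"
      by (blast intro: continuous_at_imp_continuous_on DERIV_isCont[OF De])
    fix x assume x: "- b < x" "x < - a"
    define q where "q = - x"
    have "Re (z q) * Re (z' q) + Im (z q) * Im (z' q) = Re (cnj (z q) * z' q)" by simp
    then have "\<bar>Re (z q) * Re (z' q) + Im (z q) * Im (z' q)\<bar> \<le> norm (z q) * norm (z' q)"
      using abs_Re_le_cmod[of "cnj (z q) * z' q"] by (simp add: norm_mult)
    also have "\<dots> \<le> norm (z q) * (C * norm (z q))" using C[of q] x by (intro mult_left_mono) (auto simp: q_def)
    finally have "- 2 * (Re (z q) * Re (z' q) + Im (z q) * Im (z' q)) \<le> 2 * C * e x"
      unfolding en q_def by (simp add: power2_eq_square abs_le_iff mult_ac)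
    then show "\<exists>d. (e has_real_derivative d) (at x) \<and> d \<le> 2 * C * e x" using De[of x] unfolding q_def by blast
  qed (use a in simp)
  also have "e (- b) = 0" using z0 by (simp add: en z_def)
  finally show ?thesis by (simp add: en z_def)
qed

end

section \<open>The family of regular solutions compared with the singular one\<close>

locale singular_limit = exponents +
  fixes u v :: "real \<Rightarrow> real \<Rightarrow> real" and y w :: "real \<Rightarrow> real"
  assumes reg: "1 < \<gamma> \<Longrightarrow> regular \<gamma> (u \<gamma>) (v \<gamma>)"
    and ef: "ef_solution y w" and y_lim: "(y \<longlongrightarrow> 1) at_bot"
begin

definition z :: "real \<Rightarrow> real \<Rightarrow> complex" where
  "z \<gamma> = zc (ef_y (u \<gamma>)) (ef_w (u \<gamma>) (v \<gamma>)) y w"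

definition z' :: "real \<Rightarrow> real \<Rightarrow> complex" where
  "z' \<gamma> = zc' (ef_y (u \<gamma>)) (ef_w (u \<gamma>) (v \<gamma>)) y w"

lemma bs_sing: "bound_solution y w"
  by (rule singular_bound_solution[OF ef y_lim])

lemma bs_reg: "1 < \<gamma> \<Longrightarrow> bound_solution (ef_y (u \<gamma>)) (ef_w (u \<gamma>) (v \<gamma>))"
  by (rule regular_bound_solution[OF reg])

lemma z_deriv: "1 < \<gamma> \<Longrightarrow> (z \<gamma> has_vector_derivative z' \<gamma> t) (at t)"
  unfolding z_def z'_def by (rule zc_deriv[OF bs_reg bs_sing])

lemma z_continuous: "1 < \<gamma> \<Longrightarrow> continuous_on S (z \<gamma>)"
  using z_deriv has_vector_derivative_continuous by (blast intro: continuous_at_imp_continuous_on)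

text \<open>A zero would make the orbits agree at all earlier times, but at -\<infinity> one tends
  to 0 and the other to 1. This is what makes an angle of \<open>z\<close> available.\<close>

lemma z_nonzero:
  assumes g: "1 < \<gamma>"
  shows "z \<gamma> t \<noteq> 0"
proof
  assume z0: "z \<gamma> t = 0"
  have "z \<gamma> s = 0" if "s \<le> t" for s
    using zc_zero_backwards[OF bs_reg[OF g] bs_sing z0[unfolded z_def] that] by (simp add: z_def)
  then have eq: "y s = ef_y (u \<gamma>) s" if "s \<le> t" for s
    using that by (simp add: z_def zc_zero_iff)
  have e: "((\<lambda>t. exp (m * th * t)) \<longlongrightarrow> 0) at_bot"
    using m_pos th_pos by (intro exp_at_bot) auto
  have "((\<lambda>t. exp (m * th * t) / A * u \<gamma> (exp (m * t))) \<longlongrightarrow> 0 / A * \<gamma>) at_bot"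
    using A_pos by (intro tendsto_intros e regular_tendsto_at_bot[OF reg[OF g]]) auto
  then have "(ef_y (u \<gamma>) \<longlongrightarrow> 0) at_bot" by (simp add: ef_y_def[abs_def])
  moreover have "eventually (\<lambda>s. ef_y (u \<gamma>) s = y s) at_bot"
    unfolding eventually_at_bot_linorder using eq by (intro exI[of _ t]) auto
  ultimately have "(y \<longlongrightarrow> 0) at_bot" by (rule Lim_transform_eventually)
  then show False using tendsto_unique[OF _ y_lim] by force
qed

text \<open>The increment is split at f \<gamma>0 s: the first part is small uniformly in bounded s
  by \<open>regular_lipschitz\<close>, the second needs only the continuity of a single
  solution.\<close>

lemma uv_jointly_continuous:
  "continuous_on ({1<..} \<times> {0..}) (\<lambda>(\<gamma>, s). u \<gamma> s)" "continuous_on ({1<..} \<times> {0..}) (\<lambda>(\<gamma>, s). v \<gamma> s)"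
proof -
  have lim: "((\<lambda>x. f (fst x) (snd x)) \<longlongrightarrow> f \<gamma>0 s0) (at (\<gamma>0, s0) within {1<..} \<times> {0..})"
    if \<gamma>0: "1 < \<gamma>0" and s0: "0 \<le> s0" and cont: "continuous_on {0..} (f \<gamma>0)"
      and le: "\<And>\<gamma> s. 1 < \<gamma> \<Longrightarrow> 0 \<le> s \<Longrightarrow> (f \<gamma> s - f \<gamma>0 s)\<^sup>2 \<le> (u \<gamma> s - u \<gamma>0 s)\<^sup>2 + (v \<gamma> s - v \<gamma>0 s)\<^sup>2"
    for f :: "real \<Rightarrow> real \<Rightarrow> real" and \<gamma>0 s0
  proof -
    let ?F = "at (\<gamma>0, s0) within {1<..} \<times> {0::real..}"
    define C where "C = exp ((2 + p * (\<gamma>0 + 1) powr (p - 1)) * (s0 + 1))"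
    have C0: "0 \<le> C" by (simp add: C_def)
    have fst: "((\<lambda>x. fst x) \<longlongrightarrow> \<gamma>0) ?F" and snd: "((\<lambda>x. snd x) \<longlongrightarrow> s0) ?F"
      by (auto intro!: tendsto_eq_intros)
    have "eventually (\<lambda>x. x \<in> {1<..} \<times> {0::real..}) ?F" by (simp add: eventually_at_filter)
    moreover have "eventually (\<lambda>x. fst x < \<gamma>0 + 1) ?F" using fst by (rule order_tendstoD) simp
    moreover have "eventually (\<lambda>x. snd x < s0 + 1) ?F" using snd by (rule order_tendstoD) simp
    ultimately have ev: "eventually (\<lambda>x. 1 < fst x \<and> 0 \<le> snd x \<and> fst x < \<gamma>0 + 1 \<and> snd x < s0 + 1) ?F"
      by eventually_elim auto
    have sc: "((\<lambda>x. f \<gamma>0 (snd x)) \<longlongrightarrow> f \<gamma>0 s0) ?F"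
    proof (rule continuous_on_tendsto_compose[OF cont snd])
      show "s0 \<in> {0..}" using s0 by simp
      show "eventually (\<lambda>x. snd x \<in> {0..}) ?F" using ev by (rule eventually_mono) auto
    qed
    have "((\<lambda>x. f (fst x) (snd x) - f \<gamma>0 (snd x)) \<longlongrightarrow> 0) ?F"
    proof (rule Lim_null_comparison)
      show "((\<lambda>x. \<bar>fst x - \<gamma>0\<bar> * sqrt C) \<longlongrightarrow> 0) ?F"
        using tendsto_mult_right[OF tendsto_rabs[OF tendsto_diff[OF fst tendsto_const[of \<gamma>0]]], of "sqrt C"] by simp
      show "eventually (\<lambda>x. norm (f (fst x) (snd x) - f \<gamma>0 (snd x)) \<le> \<bar>fst x - \<gamma>0\<bar> * sqrt C) ?F"
        using ev
      proof eventually_elim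
        case (elim x)
        have "(f (fst x) (snd x) - f \<gamma>0 (snd x))\<^sup>2 \<le>
            (u (fst x) (snd x) - u \<gamma>0 (snd x))\<^sup>2 + (v (fst x) (snd x) - v \<gamma>0 (snd x))\<^sup>2"
          using elim by (intro le) auto
        also have "\<dots> \<le> (fst x - \<gamma>0)\<^sup>2 * exp ((2 + p * (\<gamma>0 + 1) powr (p - 1)) * snd x)"
          using elim \<gamma>0 by (intro regular_lipschitz reg) auto
        also have "\<dots> \<le> (fst x - \<gamma>0)\<^sup>2 * C"
          unfolding C_def using elim p1 by (intro mult_left_mono) (auto intro!: mult_left_mono add_nonneg_nonneg)
        also have "\<dots> = (\<bar>fst x - \<gamma>0\<bar> * sqrt C)\<^sup>2" using C0 by (simp add: power_mult_distrib)
        finally have "\<bar>f (fst x) (snd x) - f \<gamma>0 (snd x)\<bar> \<le> \<bar>\<bar>fst x - \<gamma>0\<bar> * sqrt C\<bar>"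
          by (simp only: abs_le_square_iff)
        then show ?case using C0 by (simp add: abs_mult)
      qed
    qed
    from tendsto_add[OF this sc] show ?thesis by simp
  qed
  show "continuous_on ({1<..} \<times> {0..}) (\<lambda>(\<gamma>, s). u \<gamma> s)"
    unfolding continuous_on_def case_prod_beta
    using lim[of _ _ u] regular_u_continuous[OF reg] by auto
  show "continuous_on ({1<..} \<times> {0..}) (\<lambda>(\<gamma>, s). v \<gamma> s)"
    unfolding continuous_on_def case_prod_beta
    using lim[of _ _ v] regular_v_continuous[OF reg] by auto
qed

lemma z_jointly_continuous:
  "continuous_on ({1<..} \<times> UNIV) (\<lambda>(\<gamma>, t). z \<gamma> t)"
proof -
  have s: "continuous_on ({1<..} \<times> UNIV) (\<lambda>x. (fst x, exp (m * snd x)))"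
    by (intro continuous_intros)
  have "continuous_on ({1<..} \<times> UNIV) (\<lambda>x. (\<lambda>(\<gamma>, s). u \<gamma> s) (fst x, exp (m * snd x)))"
    by (rule continuous_on_compose2[OF uv_jointly_continuous(1) s]) auto
  then have u: "continuous_on ({1<..} \<times> UNIV) (\<lambda>x. u (fst x) (exp (m * snd x)))" by simp
  have "continuous_on ({1<..} \<times> UNIV) (\<lambda>x. (\<lambda>(\<gamma>, s). v \<gamma> s) (fst x, exp (m * snd x)))"
    by (rule continuous_on_compose2[OF uv_jointly_continuous(2) s]) auto
  then have v: "continuous_on ({1<..} \<times> UNIV) (\<lambda>x. v (fst x) (exp (m * snd x)))" by simp
  have y: "continuous_on (({1<..} :: real set) \<times> UNIV) (\<lambda>x. y (snd x))"
    and w: "continuous_on (({1<..} :: real set) \<times> UNIV) (\<lambda>x. w (snd x))"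
    by (rule continuous_on_compose2[OF ef_continuous(1)[OF ef, of UNIV]]
        continuous_on_compose2[OF ef_continuous(2)[OF ef, of UNIV]]; auto intro: continuous_intros)+
  have Y: "continuous_on ({1<..} \<times> UNIV) (\<lambda>x. ef_y (u (fst x)) (snd x))"
    unfolding ef_y_def using A_pos by (intro continuous_intros u) auto
  have W: "continuous_on ({1<..} \<times> UNIV) (\<lambda>x. ef_w (u (fst x)) (v (fst x)) (snd x))"
    unfolding ef_w_def using A_pos by (intro continuous_intros u v) auto
  show ?thesis
    unfolding z_def zc_def case_prod_beta Complex_eq
    by (intro continuous_intros Y W y w)
qed

end

section \<open>Convergence and rotation\<close>

lemma polar_of_exp:
  fixes z g :: complex
  assumes "z = exp g"
  shows "z = of_real (norm z) * cis (Im g)"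
  unfolding assms by (metis exp_eq_polar norm_exp_eq_Re)

context singular_limit
begin

lemma J_sing_le: "J y w t \<le> G 1"
proof -
  have "(J y w \<longlongrightarrow> G 1) at_bot" by (rule J_tendsto[OF y_lim singular_w_tendsto[OF ef y_lim]])
  then show ?thesis
    by (rule tendsto_lowerbound)
      (auto simp: eventually_at_bot_linorder intro!: exI[of _ t] J_antimono[OF ef])
qed

text \<open>Constants independent of \<gamma> for three time ranges: up to entry + T and from t1 to
  tS the deviation from the linear flow is at most K |z|, in between at most \<kappa> |z|. The
  limits al/4 and om/2 on \<kappa> preserve half of the decay and half of the rotation. The last two
  conclusions serve to keep critical points out of the range before t1.\<close>

lemma matching_estimates:
  fixes tS :: real
  obtains \<tau> \<kappa> K T t1 M where "0 < \<kappa>" "0 < K" "0 \<le> T" "t1 \<le> tS" "0 < M"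
    "\<And>\<gamma>. 1 < \<gamma> \<Longrightarrow> ef_y (u \<gamma>) (\<tau> - ln \<gamma> / (m * th)) \<le> 1 / 2"
    "\<And>\<gamma> t. \<lbrakk>1 < \<gamma>; t \<le> tS\<rbrakk> \<Longrightarrow> norm (z \<gamma> t) \<le> M"
    "\<And>\<gamma> t. \<lbrakk>1 < \<gamma>; t \<le> tS\<rbrakk> \<Longrightarrow> norm (z' \<gamma> t - rate * z \<gamma> t) \<le> K * norm (z \<gamma> t)"
    "\<And>\<gamma> t. \<lbrakk>1 < \<gamma>; \<tau> - ln \<gamma> / (m * th) + T \<le> t; t \<le> t1\<rbrakk> \<Longrightarrow>
        norm (z' \<gamma> t - rate * z \<gamma> t) \<le> \<kappa> * norm (z \<gamma> t)"
    "\<kappa> \<le> al / 4" "\<kappa> \<le> om / 2"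
    "\<And>\<gamma> t. \<lbrakk>2 < \<gamma>; t \<le> t1\<rbrakk> \<Longrightarrow> 1 < u \<gamma> (exp (m * t))"
    "\<And>t. t \<le> t1 \<Longrightarrow> 1 / 2 < y t \<and> w t < m * th * y t \<and> exp (m * th * t) < A * y t"
proof -
  obtain \<tau> c where c: "0 < c"
    and e1: "\<And>\<gamma> u v. regular \<gamma> u v \<Longrightarrow> ef_y u (\<tau> - ln \<gamma> / (m * th)) \<le> 1 / 2"
    and e2: "\<And>\<gamma> u v. regular \<gamma> u v \<Longrightarrow> J (ef_y u) (ef_w u v) (\<tau> - ln \<gamma> / (m * th)) \<le> - c"
    and e3: "\<And>\<gamma> u v t. \<lbrakk>regular \<gamma> u v; t \<le> \<tau> - ln \<gamma> / (m * th)\<rbrakk> \<Longrightarrow> \<gamma> / 2 \<le> u (exp (m * t))"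
    using regular_entry by metis
  \<comment> \<open>One energy threshold for both kinds of orbit; the singular one meets it at every
    time, since its energy starts from G 1.\<close>
  define c0 where "c0 = min c (- G 1)"
  have c0: "0 < c0" using c G1_neg by (simp add: c0_def)
  obtain ymin t0 where ymin: "0 < ymin"
    and low: "\<And>y w b t. \<lbrakk>bound_solution y w; J y w b \<le> - c0; b \<le> t; t \<le> t0\<rbrakk> \<Longrightarrow> ymin \<le> y t"
    and app: "\<And>\<delta>. 0 < \<delta> \<Longrightarrow> \<exists>T\<ge>0. \<exists>t1\<le>t0. \<forall>y w b t. bound_solution y w \<longrightarrow> J y w b \<le> - c0 \<longrightarrow>
        b + T \<le> t \<longrightarrow> t \<le> t1 \<longrightarrow> \<bar>y t - 1\<bar> \<le> \<delta> \<and> \<bar>w t\<bar> \<le> \<delta>"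
    using approach_equilibrium[OF c0] by metis
  have J_reg: "J (ef_y (u \<gamma>)) (ef_w (u \<gamma>) (v \<gamma>)) (\<tau> - ln \<gamma> / (m * th)) \<le> - c0" if "1 < \<gamma>" for \<gamma>
    using e2[OF reg[OF that]] by (simp add: c0_def)
  have J_sing: "J y w b \<le> - c0" for b using J_sing_le[of b] by (simp add: c0_def)
  define \<kappa> where "\<kappa> = min (al / 4) (om / 2)"
  have \<kappa>: "0 < \<kappa>" "\<kappa> \<le> al / 4" "\<kappa> \<le> om / 2" using al_pos om_pos by (auto simp: \<kappa>_def)
  define g where "g = om * \<kappa>"
  have g: "0 < g" using \<kappa> om_pos by (simp add: g_def)
  obtain \<delta>1 where \<delta>1: "0 < \<delta>1" "\<delta>1 < 1" "\<And>a b. \<lbrakk>\<bar>a - 1\<bar> \<le> \<delta>1; \<bar>b - 1\<bar> \<le> \<delta>1\<rbrakk> \<Longrightarrow>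
      \<bar>a powr p - b powr p - p * (a - b)\<bar> \<le> g / 2 * \<bar>a - b\<bar>"
    using powr_linearization_at_1[of "g / 2" p] g by (metis half_gt_zero)
  define \<delta> where "\<delta> = min (\<delta>1 / 2) (m * th / 4)"
  have mth: "0 < m * th" using m_pos th_pos by simp
  have \<delta>: "0 < \<delta>" "\<delta> \<le> \<delta>1" "\<delta> < 1 / 2" "\<delta> \<le> m * th / 4"
    using \<delta>1 mth by (auto simp: \<delta>_def)
  obtain T t2 where T: "0 \<le> T" and t2: "t2 \<le> t0"
    and near: "\<And>y w b t. \<lbrakk>bound_solution y w; J y w b \<le> - c0; b + T \<le> t; t \<le> t2\<rbrakk> \<Longrightarrow>
        \<bar>y t - 1\<bar> \<le> \<delta> \<and> \<bar>w t\<bar> \<le> \<delta>"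
    using app[OF \<delta>(1)] by metis
  have m2: "0 < 2 * m" using m_pos by simp
  have "((\<lambda>t. m\<^sup>2 * exp (2 * m * t)) \<longlongrightarrow> m\<^sup>2 * 0) at_bot"
    by (intro tendsto_intros exp_at_bot m2)
  then have "eventually (\<lambda>t. m\<^sup>2 * exp (2 * m * t) < g / 2) at_bot"
    using g by (intro order_tendstoD(2)) auto
  \<comment> \<open>The minimum serves both solutions: y > 1/2 on the singular orbit and y >= ymin
    on regular orbits after entry then mean u > 1.\<close>
  moreover have "eventually (\<lambda>t. exp (m * th * t) < A * min (1/2) ymin) at_bot"
    using ymin A_pos by (intro order_tendstoD(2)[OF exp_at_bot[OF mth]]) auto
  ultimately obtain t3 where t3: "\<And>t. t \<le> t3 \<Longrightarrow> m\<^sup>2 * exp (2 * m * t) < g / 2 \<and> exp (m * th * t) < A * min (1/2) ymin"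
    by (metis (mono_tags, lifting) eventually_conj eventually_at_bot_linorder)
  define t1 where "t1 = min (min t2 t3) tS"
  have t1: "t1 \<le> t2" "t1 \<le> t3" "t1 \<le> tS" by (auto simp: t1_def)
  obtain M where M: "1 \<le> M" "\<And>y w t. bound_solution y w \<Longrightarrow> t \<le> tS \<Longrightarrow> y t \<le> M \<and> \<bar>w t\<bar> \<le> M"
    using bound_solution_bounded[of tS] by blast
  obtain K where K: "0 < K" "\<And>y1 w1 y2 w2 t. \<lbrakk>bound_solution y1 w1; bound_solution y2 w2; t \<le> tS\<rbrakk> \<Longrightarrow>
    norm (zc' y1 w1 y2 w2 t - rate * zc y1 w1 y2 w2 t) \<le> K * norm (zc y1 w1 y2 w2 t)"
    using zc_rate_bounded[of tS] by metis
  have near_sing: "\<bar>y t - 1\<bar> \<le> \<delta>" "\<bar>w t\<bar> \<le> \<delta>" if "t \<le> t2" for t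
    using near[OF bs_sing J_sing[of "t - T"], of t] that by auto
  show thesis
  proof (rule that[of \<kappa> K T t1 "om * M + 2 * M + al / 2 * M" \<tau>])
    show "0 < om * M + 2 * M + al / 2 * M"
      using om_pos al_pos M(1) by (intro add_pos_pos mult_pos_pos) auto
    show "ef_y (u \<gamma>) (\<tau> - ln \<gamma> / (m * th)) \<le> 1 / 2" if "1 < \<gamma>" for \<gamma> by (rule e1[OF reg[OF that]])
    show "norm (z \<gamma> t) \<le> om * M + 2 * M + al / 2 * M" if g1: "1 < \<gamma>" and t: "t \<le> tS" for \<gamma> t
    proof -
      have b: "0 < ef_y (u \<gamma>) t" "ef_y (u \<gamma>) t \<le> M" "\<bar>ef_w (u \<gamma>) (v \<gamma>) t\<bar> \<le> M" "0 < y t" "y t \<le> M" "\<bar>w t\<bar> \<le> M"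
        using bound_solution_D(2)[OF bs_reg[OF g1]] bound_solution_D(2)[OF bs_sing] M(2)[OF bs_reg[OF g1] t] M(2)[OF bs_sing t]
        by auto
      then have D: "\<bar>ef_y (u \<gamma>) t - y t\<bar> \<le> M" by linarith
      have 1: "\<bar>om * (ef_y (u \<gamma>) t - y t)\<bar> \<le> om * M" "\<bar>al / 2 * (ef_y (u \<gamma>) t - y t)\<bar> \<le> al / 2 * M"
        using D om_pos al_pos by (auto simp: abs_mult intro!: mult_left_mono)
      have 2: "\<bar>ef_w (u \<gamma>) (v \<gamma>) t - w t\<bar> \<le> 2 * M" using b by linarith
      have "norm (z \<gamma> t) \<le> \<bar>Re (z \<gamma> t)\<bar> + \<bar>Im (z \<gamma> t)\<bar>" by (rule cmod_le)
      also have "\<dots> \<le> om * M + (2 * M + al / 2 * M)"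
        using 1 2 unfolding z_def zc_def complex.sel by linarith
      finally show ?thesis by simp
    qed
    show "norm (z' \<gamma> t - rate * z \<gamma> t) \<le> K * norm (z \<gamma> t)" if "1 < \<gamma>" "t \<le> tS" for \<gamma> t
      unfolding z_def z'_def by (rule K(2)[OF bs_reg[OF that(1)] bs_sing that(2)])
    show "norm (z' \<gamma> t - rate * z \<gamma> t) \<le> \<kappa> * norm (z \<gamma> t)"
      if g1: "1 < \<gamma>" and t: "\<tau> - ln \<gamma> / (m * th) + T \<le> t" "t \<le> t1" for \<gamma> t
    proof -
      have nr: "\<bar>ef_y (u \<gamma>) t - 1\<bar> \<le> \<delta>1"
        using near[OF bs_reg[OF g1] J_reg[OF g1] t(1)] t t1 \<delta> by force
      have ns: "\<bar>y t - 1\<bar> \<le> \<delta>1" using near_sing(1)[of t] t t1 \<delta> by linarith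
      have "\<bar>ef_y (u \<gamma>) t powr p - y t powr p - p * (ef_y (u \<gamma>) t - y t)\<bar> \<le> g / 2 * \<bar>ef_y (u \<gamma>) t - y t\<bar>"
        by (rule \<delta>1(3)[OF nr ns])
      moreover have "m\<^sup>2 * exp (2 * m * t) * \<bar>ef_y (u \<gamma>) t - y t\<bar> \<le> g / 2 * \<bar>ef_y (u \<gamma>) t - y t\<bar>"
        using t3[of t] t t1 by (intro mult_right_mono) auto
      ultimately have "norm (z' \<gamma> t - rate * z \<gamma> t) \<le> g / om * norm (z \<gamma> t)"
        unfolding z_def z'_def using g by (intro zc_rate) auto
      then show ?thesis using om_pos by (simp add: g_def)
    qed
    show "1 < u \<gamma> (exp (m * t))" if g2: "2 < \<gamma>" and t: "t \<le> t1" for \<gamma> t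
    proof (cases "t \<le> \<tau> - ln \<gamma> / (m * th)")
      case True
      then have "\<gamma> / 2 \<le> u \<gamma> (exp (m * t))" using e3[OF reg] g2 by simp
      then show ?thesis using g2 by simp
    next
      case False
      have g1: "1 < \<gamma>" using g2 by simp
      have "ymin \<le> ef_y (u \<gamma>) t"
        using low[OF bs_reg[OF g1] J_reg[OF g1], of t] False t t1 t2 by simp
      then have "ymin \<le> exp (m * th * t) / A * u \<gamma> (exp (m * t))" by (simp add: ef_y_def)
      then have "A * ymin \<le> exp (m * th * t) * u \<gamma> (exp (m * t))" using A_pos by (simp add: field_simps)
      moreover have "exp (m * th * t) < A * ymin"
      proof -
        have "exp (m * th * t) < A * min (1/2) ymin" using t3[of t] t t1 by simp
        also have "\<dots> \<le> A * ymin" using A_pos by (intro mult_left_mono) auto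
        finally show ?thesis .
      qed
      ultimately have "exp (m * th * t) * 1 < exp (m * th * t) * u \<gamma> (exp (m * t))" by linarith
      then show ?thesis by (simp only: mult_less_cancel_left_pos[OF exp_gt_zero])
    qed
    show "1 / 2 < y t \<and> w t < m * th * y t \<and> exp (m * th * t) < A * y t" if t: "t \<le> t1" for t
    proof (intro conjI)
      have n: "\<bar>y t - 1\<bar> \<le> \<delta>" "\<bar>w t\<bar> \<le> \<delta>" using near_sing[of t] t t1 by auto
      show y: "1 / 2 < y t" using n \<delta> by linarith
      have "m * th * (1 / 2) < m * th * y t" using y mth by (rule mult_strict_left_mono)
      then show "w t < m * th * y t" using n \<delta> mth by linarith
      have "exp (m * th * t) < A * min (1/2) ymin" using t3[of t] t t1 by simp
      also have "\<dots> \<le> A * y t" using A_pos y by (intro mult_left_mono) auto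
      finally show "exp (m * th * t) < A * y t" .
    qed
  qed (use \<kappa> K(1) T t1 in auto)
qed

lemma entry_time_at_bot: "filterlim (\<lambda>\<gamma>. \<tau> - ln \<gamma> / (m * th)) at_bot at_top"
proof -
  have "0 < 1 / (m * th)" using m_pos th_pos by simp
  then have "filterlim (\<lambda>\<gamma>. 1 / (m * th) * ln \<gamma>) at_top at_top"
    by (rule filterlim_tendsto_pos_mult_at_top[OF tendsto_const _ ln_at_top])
  then have "filterlim (\<lambda>\<gamma>. - \<tau> + ln \<gamma> / (m * th)) at_top at_top"
    by (intro filterlim_tendsto_add_at_top[OF tendsto_const]) simp
  then show ?thesis unfolding filterlim_uminus_at_bot by simp
qed

text \<open>On the long range log |z| and the angle both drop at rate \<kappa> at least; elsewhere
  their increase is bounded. So a single bound R, tending to -\<infinity>, yields both the smallness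
  of z on [t1, tS] and, with the entry angle bounded above, the divergence of h.\<close>

lemma convergence_and_rotation:
  fixes tS :: real
  obtains t1 h \<gamma>0 where "t1 \<le> tS" "2 \<le> \<gamma>0"
    "\<And>e. 0 < e \<Longrightarrow> eventually (\<lambda>\<gamma>. \<forall>t\<in>{t1..tS}. norm (z \<gamma> t) \<le> e) at_top"
    "continuous_on {\<gamma>0..} h" "filterlim h at_bot at_top"
    "\<And>\<gamma>. \<gamma>0 \<le> \<gamma> \<Longrightarrow> z \<gamma> tS = of_real (norm (z \<gamma> tS)) * cis (h \<gamma>)"
    "\<And>\<gamma> t. \<lbrakk>2 < \<gamma>; t \<le> t1\<rbrakk> \<Longrightarrow> 1 < u \<gamma> (exp (m * t))"
    "\<And>t. t \<le> t1 \<Longrightarrow> 1 / 2 < y t \<and> w t < m * th * y t \<and> exp (m * th * t) < A * y t"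
proof (rule matching_estimates[of tS])
  fix \<tau> \<kappa> K T t1 M :: real
  assume \<kappa>: "0 < \<kappa>" and K: "0 < K" and T: "0 \<le> T" and t1: "t1 \<le> tS" and M: "0 < M"
    and half: "\<And>\<gamma>. 1 < \<gamma> \<Longrightarrow> ef_y (u \<gamma>) (\<tau> - ln \<gamma> / (m * th)) \<le> 1 / 2"
    and zM: "\<And>\<gamma> t. \<lbrakk>1 < \<gamma>; t \<le> tS\<rbrakk> \<Longrightarrow> norm (z \<gamma> t) \<le> M"
    and zK: "\<And>\<gamma> t. \<lbrakk>1 < \<gamma>; t \<le> tS\<rbrakk> \<Longrightarrow> norm (z' \<gamma> t - rate * z \<gamma> t) \<le> K * norm (z \<gamma> t)"
    and z\<kappa>: "\<And>\<gamma> t. \<lbrakk>1 < \<gamma>; \<tau> - ln \<gamma> / (m * th) + T \<le> t; t \<le> t1\<rbrakk> \<Longrightarrow>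
        norm (z' \<gamma> t - rate * z \<gamma> t) \<le> \<kappa> * norm (z \<gamma> t)"
    and \<kappa>_le: "\<kappa> \<le> al / 4" "\<kappa> \<le> om / 2"
    and u1: "\<And>\<gamma> t. \<lbrakk>2 < \<gamma>; t \<le> t1\<rbrakk> \<Longrightarrow> 1 < u \<gamma> (exp (m * t))"
    and y1: "\<And>t. t \<le> t1 \<Longrightarrow> 1 / 2 < y t \<and> w t < m * th * y t \<and> exp (m * th * t) < A * y t"
  define b where "b \<gamma> = \<tau> - ln \<gamma> / (m * th)" for \<gamma>
  have b_lim: "filterlim b at_bot at_top" unfolding b_def[abs_def] by (rule entry_time_at_bot)
  \<comment> \<open>Then entry + T lies before t1 and the three ranges follow one another.\<close>
  have "eventually (\<lambda>\<gamma>. b \<gamma> \<le> t1 - T - 1) at_top"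
    using b_lim unfolding filterlim_at_bot by blast
  then have "eventually (\<lambda>\<gamma>. b \<gamma> \<le> t1 - T - 1 \<and> 3 \<le> \<gamma>) at_top"
    using eventually_ge_at_top[of "3::real"] by (rule eventually_conj)
  then obtain \<gamma>0 where \<gamma>0': "\<And>\<gamma>. \<gamma>0 \<le> \<gamma> \<Longrightarrow> b \<gamma> \<le> t1 - T - 1 \<and> 3 \<le> \<gamma>"
    by (auto simp: eventually_at_top_linorder)
  then have \<gamma>0: "3 \<le> \<gamma>0" "\<And>\<gamma>. \<gamma>0 \<le> \<gamma> \<Longrightarrow> b \<gamma> \<le> t1 - T - 1" by auto
  have rate_sel: "Re rate = - al / 2" "Im rate = - om" by (auto simp: rate_def)
  have growth: "Re (g t) - Re (g (b \<gamma>)) \<le> K * T - \<kappa> * (t1 - (b \<gamma> + T)) + K * (tS - t1)"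
      "Im (g t) - Im (g (b \<gamma>)) \<le> K * T - \<kappa> * (t1 - (b \<gamma> + T)) + K * (tS - t1)"
    if \<gamma>: "\<gamma>0 \<le> \<gamma>" and t: "t1 \<le> t" "t \<le> tS" and g: "continuous_on {b \<gamma>..tS} g"
      and eg: "\<And>x. x \<in> {b \<gamma>..tS} \<Longrightarrow> exp (g x) = z \<gamma> x" for \<gamma> t and g :: "real \<Rightarrow> complex"
  proof -
    have g1: "1 < \<gamma>" using \<gamma> \<gamma>0 by simp
    have b1: "b \<gamma> \<le> b \<gamma> + T" "b \<gamma> + T \<le> t1" using T \<gamma>0(2)[OF \<gamma>] by auto
    have gc: "continuous_on {c..d} g" if "b \<gamma> \<le> c" "d \<le> tS" for c d
      using g by (rule continuous_on_subset) (use that in auto)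
    have I: "Re (g (b \<gamma> + T)) - Re (g (b \<gamma>)) \<le> (Re rate + K) * (b \<gamma> + T - b \<gamma>)"
        "Im (g (b \<gamma> + T)) - Im (g (b \<gamma>)) \<le> (Im rate + K) * (b \<gamma> + T - b \<gamma>)"
      by (rule log_growth[OF b1(1) gc eg z_deriv[OF g1] zK[OF g1]]; use b1 t1 in auto)+
    have II: "Re (g t1) - Re (g (b \<gamma> + T)) \<le> (Re rate + \<kappa>) * (t1 - (b \<gamma> + T))"
        "Im (g t1) - Im (g (b \<gamma> + T)) \<le> (Im rate + \<kappa>) * (t1 - (b \<gamma> + T))"
      by (rule log_growth[OF b1(2) gc eg z_deriv[OF g1] z\<kappa>[OF g1]]; use b1 t1 in \<open>auto simp: b_def\<close>)+
    have III: "Re (g t) - Re (g t1) \<le> (Re rate + K) * (t - t1)"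
        "Im (g t) - Im (g t1) \<le> (Im rate + K) * (t - t1)"
      by (rule log_growth[OF t(1) gc eg z_deriv[OF g1] zK[OF g1]]; use b1 t in auto)+
    have le1: "(r + K) * (b \<gamma> + T - b \<gamma>) \<le> K * T" "(r + K) * (t - t1) \<le> K * (tS - t1)" if "r \<le> 0" for r
    proof -
      show "(r + K) * (b \<gamma> + T - b \<gamma>) \<le> K * T" using that T mult_nonpos_nonneg[OF that T] by (simp add: distrib_right)
      have "(r + K) * (t - t1) \<le> K * (t - t1)" using that t by (intro mult_right_mono) auto
      also have "\<dots> \<le> K * (tS - t1)" using t K by (intro mult_left_mono) auto
      finally show "(r + K) * (t - t1) \<le> K * (tS - t1)" .
    qed
    have le2: "(r + \<kappa>) * (t1 - (b \<gamma> + T)) \<le> - \<kappa> * (t1 - (b \<gamma> + T))" if "r \<le> - (2 * \<kappa>)" for r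
      using that b1 by (intro mult_right_mono) auto
    have r: "Re rate \<le> 0" "Im rate \<le> 0" "Re rate \<le> - (2 * \<kappa>)" "Im rate \<le> - (2 * \<kappa>)"
      using al_pos om_pos \<kappa>_le by (auto simp: rate_sel)
    show "Re (g t) - Re (g (b \<gamma>)) \<le> K * T - \<kappa> * (t1 - (b \<gamma> + T)) + K * (tS - t1)"
      using I(1) II(1) III(1) le1[OF r(1)] le2[OF r(3)] by linarith
    show "Im (g t) - Im (g (b \<gamma>)) \<le> K * T - \<kappa> * (t1 - (b \<gamma> + T)) + K * (tS - t1)"
      using I(2) II(2) III(2) le1[OF r(2)] le2[OF r(4)] by linarith
  qed
  define R where "R \<gamma> = K * T - \<kappa> * (t1 - (b \<gamma> + T)) + K * (tS - t1)" for \<gamma>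
  have R_lim: "filterlim R at_bot at_top"
  proof -
    have "filterlim (\<lambda>\<gamma>. \<kappa> * b \<gamma>) at_bot at_top"
      by (rule filterlim_tendsto_pos_mult_at_bot[OF tendsto_const \<kappa> b_lim])
    then have ev: "eventually (\<lambda>\<gamma>. \<kappa> * b \<gamma> \<le> Z) at_top" for Z unfolding filterlim_at_bot by blast
    have R: "R \<gamma> = (K * T - \<kappa> * (t1 - T) + K * (tS - t1)) + \<kappa> * b \<gamma>" for \<gamma>
      by (simp add: R_def algebra_simps)
    show ?thesis
      unfolding filterlim_at_bot
    proof
      fix Z
      show "eventually (\<lambda>\<gamma>. R \<gamma> \<le> Z) at_top"
        using ev[of "Z - (K * T - \<kappa> * (t1 - T) + K * (tS - t1))"]
        by (rule eventually_mono) (simp add: R)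
    qed
  qed
  have conv: "eventually (\<lambda>\<gamma>. \<forall>t\<in>{t1..tS}. norm (z \<gamma> t) \<le> e) at_top" if e: "0 < e" for e
  proof -
    have "eventually (\<lambda>\<gamma>. R \<gamma> \<le> ln e - ln M) at_top" using R_lim unfolding filterlim_at_bot by blast
    then show ?thesis
      using eventually_ge_at_top[of \<gamma>0]
    proof eventually_elim
      case (elim \<gamma>)
      have g1: "1 < \<gamma>" using elim \<gamma>0 by simp
      have b1: "b \<gamma> \<le> t1" using \<gamma>0(2)[OF elim(2)] T by simp
      have "contractible {b \<gamma>..tS}" by (simp add: convex_imp_contractible)
      then obtain g where g: "continuous_on {b \<gamma>..tS} g" "\<And>x. x \<in> {b \<gamma>..tS} \<Longrightarrow> z \<gamma> x = exp (g x)"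
        using continuous_logarithm_on_contractible[OF z_continuous[OF g1]] z_nonzero[OF g1] by metis
      have nz: "norm (z \<gamma> x) = exp (Re (g x))" if "x \<in> {b \<gamma>..tS}" for x
        using g(2)[OF that] by (simp add: norm_exp_eq_Re)
      show ?case
      proof
        fix t assume t: "t \<in> {t1..tS}"
        have "exp (Re (g (b \<gamma>))) \<le> M" using nz[of "b \<gamma>"] zM[OF g1, of "b \<gamma>"] b1 t1 by simp
        then have "Re (g (b \<gamma>)) \<le> ln M" using M by (simp add: ln_ge_iff)
        moreover have "Re (g t) - Re (g (b \<gamma>)) \<le> R \<gamma>"
          unfolding R_def by (rule growth(1)[OF elim(2) _ _ g(1)]) (use t g(2) in auto)
        ultimately have "Re (g t) \<le> ln e" using elim(1) by linarith
        then have "exp (Re (g t)) \<le> exp (ln e)" by (simp only: exp_le_cancel_iff)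
        then show "norm (z \<gamma> t) \<le> e" using nz[of t] t b1 e by simp
      qed
    qed
  qed
  \<comment> \<open>The time from entry to tS is rescaled to [0, 1], so that the parameters range
    over a convex set. One logarithm on it makes both end angles continuous in \<gamma> and their
    difference the rotation along the orbit.\<close>
  define F where "F x = z (fst x) (b (fst x) + snd x * (tS - b (fst x)))" for x
  define S where "S = {\<gamma>0..} \<times> {0..1::real}"
  have b_cont: "continuous_on S (\<lambda>x. b (fst x))"
    unfolding b_def using \<gamma>0(1) m_pos th_pos by (intro continuous_intros) (auto simp: S_def)
  have F_cont: "continuous_on S F"
  proof -
    have "continuous_on S (\<lambda>x. (\<lambda>(\<gamma>, t). z \<gamma> t) (fst x, b (fst x) + snd x * (tS - b (fst x))))"
      by (rule continuous_on_compose2[OF z_jointly_continuous]; (intro continuous_intros b_cont)?)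
        (use \<gamma>0(1) in \<open>auto simp: S_def\<close>)
    then show ?thesis by (simp add: F_def[abs_def])
  qed
  have "convex S" unfolding S_def by (intro convex_Times) auto
  then have "contractible S" by (rule convex_imp_contractible)
  then obtain g where g: "continuous_on S g" "\<And>x. x \<in> S \<Longrightarrow> F x = exp (g x)"
    using continuous_logarithm_on_contractible[OF F_cont] z_nonzero \<gamma>0(1) unfolding F_def S_def
    by (smt (verit, best) atLeast_iff mem_Sigma_iff prod.collapse)
  define h0 where "h0 \<gamma> = Im (g (\<gamma>, 0))" for \<gamma>
  define h where "h \<gamma> = Im (g (\<gamma>, 1))" for \<gamma>
  have h0_cont: "continuous_on {\<gamma>0..} h0" and h_cont: "continuous_on {\<gamma>0..} h"
    unfolding h0_def h_def
    by (intro continuous_intros continuous_on_compose2[OF g(1)]; auto simp: S_def)+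
  have h_le: "h \<gamma> - h0 \<gamma> \<le> R \<gamma>" if \<gamma>: "\<gamma>0 \<le> \<gamma>" for \<gamma>
  proof -
    have b1: "b \<gamma> < tS" using \<gamma>0(2)[OF \<gamma>] T t1 by simp
    define q where "q t = g (\<gamma>, (t - b \<gamma>) / (tS - b \<gamma>))" for t
    have "continuous_on {b \<gamma>..tS} q"
      unfolding q_def using b1 \<gamma>
      by (intro continuous_on_compose2[OF g(1)] continuous_intros) (auto simp: S_def)
    moreover have "exp (q x) = z \<gamma> x" if "x \<in> {b \<gamma>..tS}" for x
    proof -
      have "(\<gamma>, (x - b \<gamma>) / (tS - b \<gamma>)) \<in> S" using that \<gamma> b1 by (auto simp: S_def)
      from g(2)[OF this] show ?thesis using b1 by (simp add: q_def F_def)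
    qed
    ultimately have "Im (q tS) - Im (q (b \<gamma>)) \<le> R \<gamma>"
      unfolding R_def using growth(2)[OF \<gamma> t1 order_refl] by blast
    then show ?thesis using b1 by (simp add: q_def h_def h0_def)
  qed
  \<comment> \<open>At entry y is at most 1/2 on the regular orbit and above 1/2 on the singular
    one, so z lies in the open left half-plane.\<close>
  have cos_neg: "cos (h0 \<gamma>) < 0" if \<gamma>: "\<gamma>0 \<le> \<gamma>" for \<gamma>
  proof -
    have g1: "1 < \<gamma>" using \<gamma> \<gamma>0 by simp
    have "z \<gamma> (b \<gamma>) = exp (g (\<gamma>, 0))" using g(2)[of "(\<gamma>, 0)"] \<gamma> by (simp add: S_def F_def)
    moreover have "Re (z \<gamma> (b \<gamma>)) < 0"
    proof -
      have "ef_y (u \<gamma>) (b \<gamma>) \<le> 1 / 2" using half[OF g1] by (simp add: b_def)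
      moreover have "1 / 2 < y (b \<gamma>)" using y1[of "b \<gamma>"] \<gamma>0(2)[OF \<gamma>] T by simp
      ultimately show ?thesis using om_pos by (simp add: z_def zc_def mult_pos_neg)
    qed
    ultimately have "exp (Re (g (\<gamma>, 0))) * cos (h0 \<gamma>) < 0" by (simp add: Re_exp h0_def)
    then show ?thesis by (simp add: mult_less_0_iff)
  qed
  have h0_le: "h0 \<gamma> \<le> h0 \<gamma>0 + 2 * pi" if \<gamma>: "\<gamma>0 \<le> \<gamma>" for \<gamma>
  proof (rule ccontr)
    assume neg: "\<not> ?thesis"
    \<comment> \<open>c is the least multiple of 2 \<pi> not below h0 \<gamma>0; the continuous h0
      cannot attain it, because its cosine stays negative.\<close>
    define k where "k = \<lceil>h0 \<gamma>0 / (2 * pi)\<rceil>"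
    define c where "c = 2 * pi * of_int k"
    have "h0 \<gamma>0 / (2 * pi) \<le> of_int k" "of_int k - 1 \<le> h0 \<gamma>0 / (2 * pi)"
      unfolding k_def by linarith+
    then have "h0 \<gamma>0 \<le> of_int k * (2 * pi)" "(of_int k - 1) * (2 * pi) \<le> h0 \<gamma>0"
      by (simp_all only: pos_divide_le_eq pos_le_divide_eq zero_less_mult_iff pi_gt_zero zero_less_numeral simp_thms)
    then have c: "h0 \<gamma>0 \<le> c" "c \<le> h0 \<gamma>0 + 2 * pi" by (auto simp: c_def algebra_simps)
    have "\<exists>x\<ge>\<gamma>0. x \<le> \<gamma> \<and> h0 x = c"
      by (rule IVT'[of h0 \<gamma>0 c \<gamma>]) (use c neg \<gamma> continuous_on_subset[OF h0_cont] in auto)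
    then obtain x where "\<gamma>0 \<le> x" "h0 x = c" by blast
    moreover have "cos c = 1" unfolding c_def by (metis cos_int_2pin mult.commute mult.left_commute)
    ultimately show False using cos_neg[of x] by simp
  qed
  have h_lim: "filterlim h at_bot at_top"
    unfolding filterlim_at_bot
  proof
    fix Z
    have "eventually (\<lambda>\<gamma>. R \<gamma> \<le> Z - h0 \<gamma>0 - 2 * pi) at_top" using R_lim unfolding filterlim_at_bot by blast
    then show "eventually (\<lambda>\<gamma>. h \<gamma> \<le> Z) at_top"
      using eventually_ge_at_top[of \<gamma>0]
    proof eventually_elim
      case (elim \<gamma>)
      then show ?case using h_le[of \<gamma>] h0_le[of \<gamma>] by linarith
    qed
  qed
  have polar: "z \<gamma> tS = of_real (norm (z \<gamma> tS)) * cis (h \<gamma>)" if \<gamma>: "\<gamma>0 \<le> \<gamma>" for \<gamma>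
  proof -
    have "z \<gamma> tS = exp (g (\<gamma>, 1))" using g(2)[of "(\<gamma>, 1)"] \<gamma> by (simp add: S_def F_def)
    then show ?thesis unfolding h_def by (rule polar_of_exp)
  qed
  show thesis
    by (rule that[of t1 \<gamma>0 h]) (use t1 \<gamma>0(1) conv h_cont h_lim polar u1 y1 in auto)
qed

end

section \<open>The phase plane around the constant solution\<close>

context exponents
begin

lemma G_min:
  assumes "0 < x"
  shows "G 1 \<le> G x"
proof -
  obtain k K where kK: "0 < k" "0 < K"
    "\<And>y. \<lbrakk>min 1 x \<le> y; y \<le> max 1 x\<rbrakk> \<Longrightarrow> k * (y - 1)\<^sup>2 \<le> (y - 1) * (y powr p - y)"
    "\<And>y. \<lbrakk>min 1 x \<le> y; y \<le> max 1 x\<rbrakk> \<Longrightarrow> k * (y - 1)\<^sup>2 / 2 \<le> G y - G 1"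
    "\<And>y. \<lbrakk>min 1 x \<le> y; y \<le> max 1 x\<rbrakk> \<Longrightarrow> G y - G 1 \<le> K * (y - 1)\<^sup>2 / 2"
    by (rule G_quadratic_bounds[of "min 1 x" "max 1 x"]) (use assms in auto)
  have "0 \<le> k * (x - 1)\<^sup>2 / 2" using kK(1) by simp
  also have "\<dots> \<le> G x - G 1" by (rule kK(4)) auto
  finally show ?thesis by simp
qed

text \<open>The distance of the energy to its minimum obeys a linear differential inequality, so an orbit
  cannot reach the equilibrium \<open>(1, 0)\<close> in finite time.\<close>

lemma radial_not_equilibrium:
  assumes sol: "radial_solution u v" and a: "0 < a" "a \<le> s"
    and pos: "\<And>x. \<lbrakk>a \<le> x; x \<le> s\<rbrakk> \<Longrightarrow> 0 < u x" and va: "v a \<noteq> 0"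
  shows "u s \<noteq> 1 \<or> v s \<noteq> 0"
proof (rule ccontr)
  assume eq: "\<not> ?thesis"
  define F where "F x = G 1 - ((v x)\<^sup>2 / 2 + G (u x))" for x
  have dF: "(F has_real_derivative (real N - 1) / x * (v x)\<^sup>2) (at x)" if "0 < x" for x
    unfolding F_def
    by (rule DERIV_cong[OF DERIV_diff[OF DERIV_const radial_energy_deriv[OF sol that]]])
      (simp only: diff_0 mult_minus_left minus_divide_left[symmetric] minus_minus)
  define C where "C = 2 * (real N - 1) / a"
  have "F s \<le> F a * exp (- C * (s - a))"
    using a(2)
  proof (rule gronwall_le)
    show "continuous_on {a..s} F"
      by (rule continuous_at_imp_continuous_on) (use a DERIV_isCont[OF dF] in auto)
    fix x assume x: "a < x" "x < s"
    have "(real N - 1) / x * (v x)\<^sup>2 \<le> (real N - 1) / a * (v x)\<^sup>2"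
      using x a N3 by (intro mult_right_mono divide_left_mono) auto
    also have "\<dots> = C * ((v x)\<^sup>2 / 2)" using a by (simp add: C_def field_simps)
    also have "\<dots> \<le> C * (- F x)"
      using G_min[OF pos[of x]] x a N3 by (intro mult_left_mono) (auto simp: F_def C_def)
    finally show "\<exists>d. (F has_real_derivative d) (at x) \<and> d \<le> - C * F x"
      using dF[of x] x a by auto
  qed
  moreover have "F s = 0" using eq by (simp add: F_def)
  moreover have "F a < 0"
  proof -
    have "0 < (v a)\<^sup>2 / 2" using va by simp
    then show ?thesis using G_min[OF pos[of a]] a unfolding F_def by linarith
  qed
  then have "F a * exp (- C * (s - a)) < 0" by (simp add: mult_neg_pos)
  ultimately show False by simp
qed

lemma u_sing_ef_y: "0 < s \<Longrightarrow> u_sing N p (ef_y u) s = u s"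
  using m_pos A_pos by (simp add: u_sing_ef ef_y_def)

lemma rad_v_eq:
  assumes s: "0 < s"
  shows "rad_v y w s = A * s powr (- th - 1) / m * (w (ln s / m) - m * th * y (ln s / m))"
  using m_pos by (simp add: rad_v_def field_simps)

lemma rad_v_ef:
  assumes s: "0 < s"
  shows "rad_v (ef_y u) (ef_w u v) s = v s"
proof -
  have e: "exp (m * (ln s / m)) = s" "exp (m * th * (ln s / m)) = s powr th"
    using m_pos s by (auto simp: powr_def)
  have "s powr (- th - 1) * s powr th * s = 1"
    using s by (simp add: powr_diff powr_minus)
  moreover have "rad_v (ef_y u) (ef_w u v) s = s powr (- th - 1) * s powr th * s * v s"
    unfolding rad_v_def ef_y_def ef_w_def e using m_pos A_pos by (simp add: field_simps)
  ultimately show ?thesis by simp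
qed

text \<open>(s^(N-1) v)' = - s^(N-1) f(u) is negative while u > 1. Hence a range on which u > 1 is
  known contains no critical point.\<close>

lemma regular_v_neg:
  assumes reg: "regular \<gamma> u v" and s: "0 < s" and u1: "\<And>x. \<lbrakk>0 < x; x \<le> s\<rbrakk> \<Longrightarrow> 1 < u x"
  shows "v s < 0"
proof -
  define k where "k = N - 1"
  have k: "N = Suc k" "2 \<le> k" using N3 by (auto simp: k_def)
  have "s ^ k * v s < 0 ^ k * v 0"
  proof (rule DERIV_neg_imp_decreasing_open[OF s, of "\<lambda>s. s ^ k * v s"])
    fix x assume x: "0 < x" "x < s"
    have "((\<lambda>s. s ^ k * v s) has_real_derivative
        real k * x ^ (k - Suc 0) * v x + (- (real N - 1) / x * v x - fnl p (u x)) * x ^ k) (at x)"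
      by (rule DERIV_mult[OF DERIV_pow regular_D(6)[OF reg x(1)]])
    moreover have "real k * x ^ (k - Suc 0) * v x + (- (real N - 1) / x * v x - fnl p (u x)) * x ^ k
      = - (x ^ k * fnl p (u x))"
    proof -
      have "x ^ k = x * x ^ (k - Suc 0)" using k by (cases k) auto
      then have "(real N - 1) / x * v x * x ^ k = real k * x ^ (k - Suc 0) * v x" using x k by simp
      moreover have "- (real N - 1) / x * v x = - ((real N - 1) / x * v x)"
        by (simp only: minus_divide_left[symmetric] mult_minus_left)
      ultimately show ?thesis by (simp only: left_diff_distrib mult_minus_left) (simp add: mult_ac)
    qed
    moreover have "0 < fnl p (u x)"
    proof -
      have "u x powr 1 < u x powr p" using u1[of x] x p1 by (intro powr_less_mono) auto
      then show ?thesis using u1[of x] x by (simp add: fnl_def fpow_pos)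
    qed
    then have "- (x ^ k * fnl p (u x)) < 0" using x by simp
    ultimately show "\<exists>y. ((\<lambda>s. s ^ k * v s) has_real_derivative y) (at x) \<and> y < 0" by auto
  next
    show "continuous_on {0..s} (\<lambda>s. s ^ k * v s)"
      by (intro continuous_intros continuous_on_subset[OF regular_v_continuous[OF reg]]) auto
  qed
  then show ?thesis using s regular_D(3)[OF reg] by (simp add: mult_less_0_iff zero_less_mult_iff)
qed

text \<open>The angle exists because (u - 1, v) cannot vanish from a on, and between successive
  zeros of v, which occur arbitrarily far out, it drops by at least \<pi>. So every level -n \<pi>
  is reached.\<close>

lemma singular_angle:
  assumes bs: "bound_solution y w" and a: "0 < a"
    and neg: "rad_v y w a < 0"
  obtains \<psi> where "continuous_on {a..} \<psi>" "- pi < \<psi> a" "\<psi> a < 0"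
    "\<And>s. a \<le> s \<Longrightarrow> Complex (u_sing N p y s - 1) (rad_v y w s) =
        of_real (norm (Complex (u_sing N p y s - 1) (rad_v y w s))) * cis (\<psi> s)"
    "\<And>s. a \<le> s \<Longrightarrow> Complex (u_sing N p y s - 1) (rad_v y w s) \<noteq> 0"
    "\<And>n. 1 \<le> n \<Longrightarrow> \<exists>s>a. \<psi> s = - real n * pi"
proof -
  define U where "U = u_sing N p y"
  define V where "V = rad_v y w"
  define Z where "Z s = Complex (U s - 1) (V s)" for s
  note ef = bound_solution_D(1)[OF bs]
  have sol: "radial_solution U V" unfolding U_def V_def by (rule radial_solution_of_ef[OF ef])
  have pos: "0 < U s" if "0 < s" for s
    using bound_solution_D(2)[OF bs] A_pos that by (simp add: U_def u_sing_ef)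
  have nz: "Z s \<noteq> 0" if "a \<le> s" for s
    using radial_not_equilibrium[OF sol a that pos] a neg by (auto simp: Z_def complex_eq_iff V_def)
  have dU: "(U has_real_derivative V s) (at s)"
    and dV: "(V has_real_derivative - (real N - 1) / s * V s - fnl p (U s)) (at s)" if "0 < s" for s
    using sol that by (auto simp: radial_solution_def)
  have contUV: "continuous_on {a..} U" "continuous_on {a..} V"
    by (rule continuous_at_imp_continuous_on; use a DERIV_isCont[OF dU] DERIV_isCont[OF dV] in auto)+
  then have contZ: "continuous_on {a..} Z" unfolding Z_def Complex_eq by (intro continuous_intros)
  obtain g where g: "continuous_on {a..} g" "\<And>s. s \<in> {a..} \<Longrightarrow> Z s = exp (g s)"
    using continuous_logarithm_on_contractible[OF contZ] nz by (metis atLeast_iff convex_imp_contractible convex_real_interval(1))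
  have gp: "Z s = of_real (norm (Z s)) * cis (Im (g s))" if "a \<le> s" for s
    by (rule polar_of_exp[OF g(2)]) (use that in simp)
  \<comment> \<open>The logarithm fixes the angle only up to a multiple of 2 \<pi>; starting from
    \<open>Arg\<close> puts \<psi> a into (-\<pi>, 0), as the imaginary part at a is
    negative.\<close>
  define \<psi> where "\<psi> s = Im (g s) - Im (g a) + Arg (Z a)" for s
  have "of_real (norm (Z a)) * cis (Im (g a)) = of_real (norm (Z a)) * cis (Arg (Z a))"
    using gp[of a] rcis_cmod_Arg[of "Z a"] by (simp add: rcis_def)
  then have "cis (Im (g a)) = cis (Arg (Z a))" using nz[of a] by (simp only: mult_cancel_left) auto
  then have "cis (\<psi> s) = cis (Im (g s))" for s
    unfolding \<psi>_def by (simp add: cis_mult[symmetric] cis_divide[symmetric])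
  then have polar: "Z s = of_real (norm (Z s)) * cis (\<psi> s)" if "a \<le> s" for s
    using gp[OF that] by simp
  have cont: "continuous_on {a..} \<psi>" unfolding \<psi>_def by (intro continuous_intros g(1))
  have "Im (Z a) < 0" using neg by (simp add: Z_def V_def)
  then have psia: "- pi < \<psi> a" "\<psi> a < 0"
    using mpi_less_Arg[of "Z a"] by (auto simp: \<psi>_def Arg_neg_iff)
  have reim: "0 < norm (Z s) \<and> U s - 1 = norm (Z s) * cos (\<psi> s) \<and> V s = norm (Z s) * sin (\<psi> s)" if "a \<le> s" for s
  proof -
    have "Re (Z s) = Re (of_real (norm (Z s)) * cis (\<psi> s))" "Im (Z s) = Im (of_real (norm (Z s)) * cis (\<psi> s))"
      using polar[OF that] by auto
    then show ?thesis using nz[OF that] by (simp add: Z_def)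
  qed
  have dc: "sin (\<psi> s) = 0 \<Longrightarrow> \<psi> t < \<psi> s" "sin (\<psi> t) = 0 \<Longrightarrow> \<psi> t < \<psi> s" if st: "a \<le> s" "s < t" for s t
  proof -
    have c: "continuous_on {a..t} \<psi>" by (rule continuous_on_subset[OF cont]) auto
    have l: "eventually (\<lambda>y. \<psi> x < \<psi> y) (at_left x)" if "a < x" "x \<le> t" "sin (\<psi> x) = 0" for x
      by (rule angle_crossing(1)[OF sol a _ c, where r = "\<lambda>s. norm (Z s)"])
        (use that a pos reim in auto)
    have r: "eventually (\<lambda>y. \<psi> y < \<psi> x) (at_right x)" if "a \<le> x" "x < t" "sin (\<psi> x) = 0" for x
      by (rule angle_crossing(2)[OF sol a _ c, where r = "\<lambda>s. norm (Z s)"])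
        (use that a pos reim in auto)
    show "sin (\<psi> s) = 0 \<Longrightarrow> \<psi> t < \<psi> s" "sin (\<psi> t) = 0 \<Longrightarrow> \<psi> t < \<psi> s"
      using down_crossing[OF c l r st order_refl] by blast+
  qed
  have mult: "\<psi> t \<le> \<psi> s - pi" if "sin (\<psi> s) = 0" "sin (\<psi> t) = 0" "\<psi> t < \<psi> s" for s t
  proof -
    obtain i j :: int where ij: "\<psi> s = of_int i * pi" "\<psi> t = of_int j * pi"
      using \<open>sin (\<psi> s) = 0\<close> \<open>sin (\<psi> t) = 0\<close> by (auto simp: sin_zero_iff_int2)
    then have "j < i" using that(3) by simp
    then have "of_int j * pi \<le> (of_int i - 1) * pi" by (intro mult_right_mono) auto
    then show ?thesis by (simp add: ij left_diff_distrib)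
  qed
  have zero: "\<exists>t>s. sin (\<psi> t) = 0" if s: "a \<le> s" for s
  proof -
    obtain t where t: "s < t" "V t = 0"
      using singular_crit_unbounded[OF bs, of s] s a by (auto simp: V_def)
    then show ?thesis using reim[of t] s by auto
  qed
  have reach0: "\<exists>s>a. sin (\<psi> s) = 0 \<and> \<psi> s \<le> - real n * pi" for n
  proof (induction n)
    case 0
    obtain s where s: "a < s" "sin (\<psi> s) = 0" using zero by blast
    then have "\<psi> s < \<psi> a" using dc(2)[of a s] by simp
    then show ?case using s psia by (intro exI[of _ s]) auto
  next
    case (Suc n)
    then obtain s where s: "a < s" "sin (\<psi> s) = 0" "\<psi> s \<le> - real n * pi" by blast
    obtain t where t: "s < t" "sin (\<psi> t) = 0" using zero[of s] s by auto
    have "\<psi> t < \<psi> s" using dc(1)[of s t] s t by simp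
    then have "\<psi> t \<le> \<psi> s - pi" by (rule mult[OF s(2) t(2)])
    then show ?case using s t by (intro exI[of _ t]) (auto simp: algebra_simps)
  qed
  have reach: "\<exists>s>a. \<psi> s = - real n * pi" if n: "1 \<le> n" for n
  proof -
    obtain t where t: "a < t" "\<psi> t \<le> - real n * pi" using reach0 by blast
    have "1 * pi \<le> real n * pi" using n by (intro mult_right_mono) auto
    then have na: "- real n * pi < \<psi> a" using psia by linarith
    have "\<exists>s\<ge>a. s \<le> t \<and> \<psi> s = - real n * pi"
      by (rule IVT2'[of \<psi> t "- real n * pi" a])
        (use t na continuous_on_subset[OF cont] in auto)
    then obtain s where "a \<le> s" "\<psi> s = - real n * pi" by blast
    moreover from this have "s \<noteq> a" using na by auto
    ultimately show ?thesis by (intro exI[of _ s]) auto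
  qed
  show thesis
    by (rule that[of \<psi>]) (use cont psia polar nz reach in \<open>auto simp: Z_def U_def V_def\<close>)
qed

end

section \<open>Oscillation of the bifurcation branches\<close>

lemma sgn_neg_one_power: "sgn ((-1) ^ n) = ((-1) ^ n :: real)"
  by (cases "even n") auto

text \<open>h attains every level \<pi>/2 - 2 \<pi> i and -\<pi>/2 - 2 \<pi> i with large i, beyond
  any given point. Gaps of more than 1 between successive choices make the sequence increasing and
  unbounded.\<close>

lemma alternating_hits:
  fixes h :: "real \<Rightarrow> real"
  assumes cont: "continuous_on {a..} h" and lim: "filterlim h at_bot at_top"
  obtains g :: "nat \<Rightarrow> real" where "strict_mono g" "filterlim g at_top sequentially"
    "\<And>j. b < g j" "\<And>j. a \<le> g j" "\<And>j. cos (h (g j)) = 0" "\<And>j. sin (h (g j)) = (-1) ^ j"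
proof -
  have hit: "\<exists>x>c. a \<le> x \<and> cos (h x) = 0 \<and> sin (h x) = s" if s: "s = 1 \<or> s = -1" for c s
  proof -
    define d where "d = max a (c + 1)"
    obtain i :: nat where i: "s * (pi / 2) - h d < real i * (2 * pi)"
      using ex_less_of_nat_mult[of "2 * pi" "s * (pi / 2) - h d"] pi_gt_zero by auto
    define t where "t = s * (pi / 2) - real i * (2 * pi)"
    have "eventually (\<lambda>x. h x \<le> t) at_top" using lim unfolding filterlim_at_bot by blast
    then obtain x0 where "\<And>x. x0 \<le> x \<Longrightarrow> h x \<le> t" by (auto simp: eventually_at_top_linorder)
    then have x0: "h (max x0 d) \<le> t" by simp
    have "\<exists>x\<ge>d. x \<le> max x0 d \<and> h x = t"
      by (rule IVT2'[of h "max x0 d" t d])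
        (use x0 i continuous_on_subset[OF cont] in \<open>auto simp: t_def d_def\<close>)
    then obtain x where x: "d \<le> x" "h x = t" by blast
    have "cis t = cis (s * (pi / 2)) / cis (real i * (2 * pi))" by (simp add: t_def cis_divide)
    also have "cis (real i * (2 * pi)) = 1" using cis_multiple_2pi[of "real i"] by (simp add: mult_ac)
    finally have "cos t = cos (s * (pi / 2))" "sin t = sin (s * (pi / 2))" by (auto simp: complex_eq_iff)
    then show ?thesis using x s by (intro exI[of _ x]) (auto simp: d_def)
  qed
  have s: "(-1) ^ j = (1::real) \<or> (-1) ^ j = (-1::real)" for j :: nat by (cases "even j") auto
  have "\<exists>g. \<forall>j. (b < g j \<and> a \<le> g j \<and> cos (h (g j)) = 0 \<and> sin (h (g j)) = (-1) ^ j) \<and> g j + 1 < g (Suc j)"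
  proof (rule dependent_nat_choice)
    show "\<exists>x. b < x \<and> a \<le> x \<and> cos (h x) = 0 \<and> sin (h x) = (-1) ^ 0" using hit[OF s[of 0], of b] by auto
    fix x and j :: nat
    assume "b < x \<and> a \<le> x \<and> cos (h x) = 0 \<and> sin (h x) = (-1) ^ j"
    moreover obtain y where "x + 1 < y" "a \<le> y" "cos (h y) = 0" "sin (h y) = (-1) ^ Suc j"
      using hit[OF s[of "Suc j"], of "x + 1"] by auto
    ultimately show "\<exists>y. (b < y \<and> a \<le> y \<and> cos (h y) = 0 \<and> sin (h y) = (-1) ^ Suc j) \<and> x + 1 < y"
      by (intro exI[of _ y]) auto
  qed
  then obtain g where g: "\<And>j. b < g j \<and> a \<le> g j \<and> cos (h (g j)) = 0 \<and> sin (h (g j)) = (-1) ^ j"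
    "\<And>j. g j + 1 < g (Suc j)" by blast
  have "strict_mono g"
  proof (rule strict_mono_Suc_iff[THEN iffD2], rule allI)
    show "g j < g (Suc j)" for j using g(2)[of j] by simp
  qed
  moreover have "filterlim g at_top sequentially"
  proof (rule filterlim_at_top_mono)
    have le: "g 0 + real j \<le> g j" for j
      by (induction j) (use g(2) in \<open>auto intro: less_imp_le order_trans simp: algebra_simps\<close>, smt (verit) g(2))
    show "eventually (\<lambda>j. g 0 + real j \<le> g j) sequentially" using le by simp
    show "filterlim (\<lambda>j. g 0 + real j) at_top sequentially"
      by (rule filterlim_tendsto_add_at_top[OF tendsto_const filterlim_real_sequentially])
  qed
  ultimately show thesis using that g(1) by blast
qed

context singular_limit
begin

abbreviation (input) "U \<equiv> u_sing N p y"
abbreviation (input) "V \<equiv> rad_v y w"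

text \<open>All outer factors are positive. So Re z = 0 means that the two solutions agree at s, and
  then the difference of their derivatives has the sign of Im z.\<close>

lemma radial_difference:
  assumes g: "1 < \<gamma>" and s: "0 < s"
  shows "u \<gamma> s - U s = A * s powr (- th) * (Re (z \<gamma> (ln s / m)) / om)"
    and "v \<gamma> s - V s = A * s powr (- th - 1) / m *
        (Im (z \<gamma> (ln s / m)) - (al / 2 + m * th) * (Re (z \<gamma> (ln s / m)) / om))"
proof -
  have D: "Re (z \<gamma> (ln s / m)) / om = ef_y (u \<gamma>) (ln s / m) - y (ln s / m)"
    using om_pos by (simp add: z_def zc_def)
  have "u \<gamma> s = A * s powr (- th) * ef_y (u \<gamma>) (ln s / m)"
    using u_sing_ef_y[OF s, of "u \<gamma>"] by (simp add: u_sing_def A_def th_def m_def)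
  then show "u \<gamma> s - U s = A * s powr (- th) * (Re (z \<gamma> (ln s / m)) / om)"
    unfolding D by (simp add: u_sing_def A_def th_def m_def right_diff_distrib)
  have v: "v \<gamma> s = rad_v (ef_y (u \<gamma>)) (ef_w (u \<gamma>) (v \<gamma>)) s" by (rule rad_v_ef[OF s, symmetric])
  show "v \<gamma> s - V s = A * s powr (- th - 1) / m *
        (Im (z \<gamma> (ln s / m)) - (al / 2 + m * th) * (Re (z \<gamma> (ln s / m)) / om))"
    unfolding D v rad_v_eq[OF s] right_diff_distrib[symmetric]
  proof -
    define k where "k = al / 2"
    have al: "al = 2 * k" by (simp add: k_def)
    show "A * s powr (- th - 1) / m * (ef_w (u \<gamma>) (v \<gamma>) (ln s / m) - m * th * ef_y (u \<gamma>) (ln s / m)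
        - (w (ln s / m) - m * th * y (ln s / m))) =
      A * s powr (- th - 1) / m * (Im (z \<gamma> (ln s / m)) - (al / 2 + m * th) *
        (ef_y (u \<gamma>) (ln s / m) - y (ln s / m)))"
      by (simp add: z_def zc_def al) (simp add: algebra_simps)
  qed
qed

lemma radial_convergence:
  assumes a: "0 < a" "a \<le> b"
    and conv: "\<And>e. 0 < e \<Longrightarrow> eventually (\<lambda>\<gamma>. \<forall>t\<in>{ln a / m..ln b / m}. norm (z \<gamma> t) \<le> e) at_top"
    and e: "0 < e"
  shows "eventually (\<lambda>\<gamma>. \<forall>s\<in>{a..b}. norm (Complex (u \<gamma> s - 1) (v \<gamma> s) - Complex (U s - 1) (V s)) \<le> e) at_top"
proof -
  \<comment> \<open>The negative powers of s are largest at a, so this constant is valid on all of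
    [a, b].\<close>
  define C where "C = A * a powr (- th) / om + A * a powr (- th - 1) / m * (1 + (al / 2 + m * th) / om)"
  have c1: "0 < A * a powr (- th) / om" "0 < A * a powr (- th - 1) / m" "0 < 1 + (al / 2 + m * th) / om"
    using A_pos om_pos m_pos al_pos th_pos a by (auto intro!: add_pos_pos divide_pos_pos mult_pos_pos)
  have C: "0 < C" unfolding C_def by (rule add_pos_pos[OF c1(1) mult_pos_pos[OF c1(2,3)]])
  have "eventually (\<lambda>\<gamma>. \<forall>t\<in>{ln a / m..ln b / m}. norm (z \<gamma> t) \<le> e / C) at_top"
    using e C by (intro conv) auto
  then show ?thesis
    using eventually_gt_at_top[of "1::real"]
  proof eventually_elim
    case (elim \<gamma>)
    show ?case
    proof
      fix s assume s: "s \<in> {a..b}"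
      then have s0: "0 < s" using a by simp
      define t where "t = ln s / m"
      have "t \<in> {ln a / m..ln b / m}" using s a m_pos s0 by (auto simp: t_def divide_right_mono)
      then have zt: "norm (z \<gamma> t) \<le> e / C" using elim by blast
      define n where "n = norm (z \<gamma> t)"
      have re: "\<bar>Re (z \<gamma> t) / om\<bar> \<le> n / om"
        using abs_Re_le_cmod[of "z \<gamma> t"] om_pos by (simp add: n_def divide_right_mono)
      have im: "\<bar>Im (z \<gamma> t)\<bar> \<le> n" using abs_Im_le_cmod by (simp add: n_def)
      have pa: "s powr (- th) \<le> a powr (- th)" "s powr (- th - 1) \<le> a powr (- th - 1)"
        using s a th_pos by (auto intro!: powr_mono2')
      have "\<bar>u \<gamma> s - U s\<bar> = A * s powr (- th) * \<bar>Re (z \<gamma> t) / om\<bar>"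
        using radial_difference(1)[OF elim(2) s0] A_pos by (simp add: t_def abs_mult)
      also have "\<dots> \<le> A * a powr (- th) * (n / om)"
        using re pa A_pos by (intro mult_mono) auto
      finally have du: "\<bar>u \<gamma> s - U s\<bar> \<le> A * a powr (- th) / om * n" by simp
      have "\<bar>v \<gamma> s - V s\<bar> = A * s powr (- th - 1) / m * \<bar>Im (z \<gamma> t) - (al / 2 + m * th) * (Re (z \<gamma> t) / om)\<bar>"
        unfolding radial_difference(2)[OF elim(2) s0] t_def[symmetric] using A_pos m_pos by (simp add: abs_mult)
      also have "\<dots> \<le> A * a powr (- th - 1) / m * (n + (al / 2 + m * th) * (n / om))"
      proof (rule mult_mono)
        show "A * s powr (- th - 1) / m \<le> A * a powr (- th - 1) / m"
          using pa A_pos m_pos by (intro divide_right_mono mult_left_mono) auto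
        have "0 \<le> al / 2 + m * th" using al_pos m_pos th_pos by simp
        then have "\<bar>(al / 2 + m * th) * (Re (z \<gamma> t) / om)\<bar> \<le> (al / 2 + m * th) * (n / om)"
          using re by (simp only: abs_mult abs_of_nonneg mult_left_mono)
        then show "\<bar>Im (z \<gamma> t) - (al / 2 + m * th) * (Re (z \<gamma> t) / om)\<bar> \<le> n + (al / 2 + m * th) * (n / om)"
          using im by linarith
      qed (use c1 in auto)
      also have "\<dots> = A * a powr (- th - 1) / m * (1 + (al / 2 + m * th) / om) * n"
        by (simp add: distrib_left distrib_right)
      finally have dv: "\<bar>v \<gamma> s - V s\<bar> \<le> A * a powr (- th - 1) / m * (1 + (al / 2 + m * th) / om) * n" .
      have "norm (Complex (u \<gamma> s - 1) (v \<gamma> s) - Complex (U s - 1) (V s)) \<le> \<bar>u \<gamma> s - U s\<bar> + \<bar>v \<gamma> s - V s\<bar>"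
        using cmod_le[of "Complex (u \<gamma> s - 1) (v \<gamma> s) - Complex (U s - 1) (V s)"] by simp
      also have "\<dots> \<le> C * n" using du dv by (simp add: C_def distrib_right)
      also have "\<dots> \<le> e" using zt C by (simp add: n_def field_simps)
      finally show "norm (Complex (u \<gamma> s - 1) (v \<gamma> s) - Complex (U s - 1) (V s)) \<le> e" .
    qed
  qed
qed

text \<open>The angle \<phi> of the regular solution is close to \<psi> and passes -n \<pi> on
  [a, b] at its own n-th critical point. The passage is downwards, so this point lies to the right
  of S exactly if \<phi>(S) > -n \<pi>, and v(S) has the sign of (-1)^n sin(\<phi>(S) + n
  \<pi>).\<close>

lemma crit_comparison:
  assumes n: "1 \<le> n"
  defines "S \<equiv> nth_crit U n"
  shows "0 < S" "V S = 0"
    "eventually (\<lambda>\<gamma>. 0 < nth_crit (u \<gamma>) n \<and>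
       (v \<gamma> S \<noteq> 0 \<longrightarrow> sgn (nth_crit (u \<gamma>) n - S) = (-1) ^ n * sgn (v \<gamma> S))) at_top"
proof -
  have "0 < S \<and> V S = 0 \<and> eventually (\<lambda>\<gamma>. 0 < nth_crit (u \<gamma>) n \<and>
       (v \<gamma> S \<noteq> 0 \<longrightarrow> sgn (nth_crit (u \<gamma>) n - S) = (-1) ^ n * sgn (v \<gamma> S))) at_top"
  \<comment> \<open>Nothing is known yet about S, so \<open>ln (S + 1) / m\<close> is just some
    time. Once S is identified as a point beyond a, it is the right end of the interval on which
    convergence is used.\<close>
  proof (rule convergence_and_rotation[of "ln (S + 1) / m"])
    fix t1 \<gamma>0 :: real and h :: "real \<Rightarrow> real"
    assume conv: "\<And>e. 0 < e \<Longrightarrow> eventually (\<lambda>\<gamma>. \<forall>t\<in>{t1..ln (S + 1) / m}. norm (z \<gamma> t) \<le> e) at_top"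
      and u1: "\<And>\<gamma> t. \<lbrakk>2 < \<gamma>; t \<le> t1\<rbrakk> \<Longrightarrow> 1 < u \<gamma> (exp (m * t))"
      and y1: "\<And>t. t \<le> t1 \<Longrightarrow> 1 / 2 < y t \<and> w t < m * th * y t \<and> exp (m * th * t) < A * y t"
    define a where "a = exp (m * t1)"
    have a: "0 < a" "ln a / m = t1" using m_pos by (auto simp: a_def)
    have lt: "ln s / m \<le> t1" "exp (m * (ln s / m)) = s" if "0 < s" "s \<le> a" for s
      using that a m_pos by (auto simp: a(2)[symmetric] divide_right_mono)
    have sol: "radial_solution U V" by (rule radial_solution_of_ef[OF ef])
    have pos: "0 < U s" if "0 < s" for s
      using bound_solution_D(2)[OF bs_sing] A_pos that by (simp add: u_sing_ef)
    have dU: "(U has_real_derivative V s) (at s)"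
      and dV: "(V has_real_derivative - (real N - 1) / s * V s - fnl p (U s)) (at s)" if "0 < s" for s
      using sol that by (auto simp: radial_solution_def)
    have Vneg: "V s < 0" if s: "0 < s" "s \<le> a" for s
      unfolding rad_v_eq[OF s(1)] using y1[OF lt(1)[OF s]] A_pos m_pos s
      by (intro mult_pos_neg divide_pos_pos mult_pos_pos) auto
    obtain \<psi> where \<psi>: "continuous_on {a..} \<psi>" "- pi < \<psi> a" "\<psi> a < 0"
      and polar: "\<And>s. a \<le> s \<Longrightarrow> Complex (U s - 1) (V s) = of_real (norm (Complex (U s - 1) (V s))) * cis (\<psi> s)"
      and nz: "\<And>s. a \<le> s \<Longrightarrow> Complex (U s - 1) (V s) \<noteq> 0"
      and reach: "\<And>n. 1 \<le> n \<Longrightarrow> \<exists>s>a. \<psi> s = - real n * pi"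
      using singular_angle[OF bs_sing a(1) Vneg[OF a(1) order_refl]] by metis
    define Z where "Z s = Complex (U s - 1) (V s)" for s
    have reim: "0 < norm (Z s) \<and> U s - 1 = norm (Z s) * cos (\<psi> s) \<and> V s = norm (Z s) * sin (\<psi> s)" if "a \<le> s" for s
    proof -
      have "Z s = of_real (norm (Z s)) * cis (\<psi> s)" using polar[OF that] by (simp only: Z_def)
      then have "Re (Z s) = Re (of_real (norm (Z s)) * cis (\<psi> s))" "Im (Z s) = Im (of_real (norm (Z s)) * cis (\<psi> s))"
        by metis+
      then show ?thesis using nz[OF that] by (simp add: Z_def)
    qed
    have l: "eventually (\<lambda>y. \<psi> x < \<psi> y) (at_left x)" if "a < x" "x \<le> b" "sin (\<psi> x) = 0" for b x
      by (rule angle_crossing(1)[OF sol a(1) _ continuous_on_subset[OF \<psi>(1)], where r = "\<lambda>s. norm (Z s)" and b = b])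
        (use that a pos reim in auto)
    have r: "eventually (\<lambda>y. \<psi> y < \<psi> x) (at_right x)" if "a \<le> x" "x < b" "sin (\<psi> x) = 0" for b x
      by (rule angle_crossing(2)[OF sol a(1) _ continuous_on_subset[OF \<psi>(1)], where r = "\<lambda>s. norm (Z s)" and b = b])
        (use that a pos reim in auto)
    obtain S' where S': "a < S'" "\<psi> S' = - real n * pi" using reach[OF n] by blast
    have "nth_crit U n = S'"
    proof (rule nth_crit_eq[of a S' \<psi>, OF _ l r a(1)])
      show "continuous_on {a..S'} \<psi>" by (rule continuous_on_subset[OF \<psi>(1)]) auto
      show "deriv U t \<noteq> 0" if "0 < t" "t \<le> a" for t
        using DERIV_imp_deriv[OF dU[OF that(1)]] Vneg[OF that] by simp
      show "deriv U t = 0 \<longleftrightarrow> sin (\<psi> t) = 0" if "a \<le> t" for t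
        using DERIV_imp_deriv[OF dU[of t]] reim[OF that] that a by auto
    qed (use \<psi> S' n in auto)
    then have S: "a < S" "\<psi> S = - real n * pi" using S' by (auto simp: S_def)
    have VS: "V S = 0" using reim[of S] S by simp
    define b where "b = S + 1"
    have ab: "a \<le> S" "S < b" "a \<le> b" using S by (auto simp: b_def)
    have "\<psi> b < \<psi> S"
      using down_crossing(1)[of a b \<psi> S b] continuous_on_subset[OF \<psi>(1), of "{a..b}"] l r ab S by auto
    then have psib: "\<psi> b < - real n * pi" using S by simp
    \<comment> \<open>An angle within e of \<psi> still starts in (-\<pi>, 0), is still below -n
      \<pi> at b, and differs from -n \<pi> by less than \<pi> at S.\<close>
    define e where "e = min (min (- \<psi> a) (\<psi> a + pi)) (min (- real n * pi - \<psi> b) 1)"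
    have e: "0 < e" "e \<le> - \<psi> a" "e \<le> \<psi> a + pi" "e \<le> - real n * pi - \<psi> b" "e < pi"
    proof -
      show "0 < e" using \<psi> psib by (simp add: e_def)
      show "e \<le> - \<psi> a" "e \<le> \<psi> a + pi" "e \<le> - real n * pi - \<psi> b" by (auto simp: e_def)
      have "e \<le> 1" by (simp add: e_def)
      then show "e < pi" using pi_gt3 by linarith
    qed
    have "isCont Ln 1" by (rule continuous_at_Ln) auto
    then have "eventually (\<lambda>x. dist (Ln x) (Ln 1) < e) (at 1)" using e(1) unfolding isCont_def tendsto_iff by blast
    then obtain d where d: "0 < d" "\<And>x. x \<noteq> 1 \<Longrightarrow> dist x 1 < d \<Longrightarrow> norm (Ln x) < e"
      by (auto simp: eventually_at)
    define \<delta> where "\<delta> = min d 1 / 2"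
    have \<delta>: "0 < \<delta>" using d by (simp add: \<delta>_def)
    have Ln_small: "\<bar>Im (Ln x)\<bar> < e" "x \<notin> \<real>\<^sub>\<le>\<^sub>0" if "norm (x - 1) \<le> \<delta>" for x
    proof -
      have "norm (x - 1) < d" "norm (x - 1) < 1" using that d by (auto simp: \<delta>_def)
      then have "norm (Ln x) < e" using d(2)[of x] e(1) by (cases "x = 1") (auto simp: dist_norm)
      then show "\<bar>Im (Ln x)\<bar> < e" using abs_Im_le_cmod[of "Ln x"] by linarith
      have "\<bar>Re x - 1\<bar> < 1" using abs_Re_le_cmod[of "x - 1"] \<open>norm (x - 1) < 1\<close> by simp
      then show "x \<notin> \<real>\<^sub>\<le>\<^sub>0" by (auto simp: complex_nonpos_Reals_iff)
    qed
    have contUV: "continuous_on {a..b} U" "continuous_on {a..b} V"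
      by (rule continuous_at_imp_continuous_on; use a DERIV_isCont[OF dU] DERIV_isCont[OF dV] in auto)+
    then have contZ: "continuous_on {a..b} Z" unfolding Z_def Complex_eq by (intro continuous_intros)
    have "{a..b} \<noteq> {}" using ab by simp
    then obtain x0 x1 where x0: "x0 \<in> {a..b}" "\<And>s. s \<in> {a..b} \<Longrightarrow> norm (Z x0) \<le> norm (Z s)"
      and x1: "x1 \<in> {a..b}" "\<And>s. s \<in> {a..b} \<Longrightarrow> U x1 \<le> U s"
      using continuous_attains_inf[OF compact_Icc _ continuous_on_norm[OF contZ]]
        continuous_attains_inf[OF compact_Icc _ contUV(1)] by metis
    \<comment> \<open>Relative to the least modulus of Z on [a, b], so that Zg / Z is within
      \<delta> of 1 and avoids the cut of \<open>Ln\<close>.\<close>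
    define \<mu> where "\<mu> = min (norm (Z x0) * \<delta>) (U x1 / 2)"
    have \<mu>: "0 < \<mu>" using x0(1) x1(1) reim[of x0] pos[of x1] a \<delta> by (simp add: \<mu>_def)
    have conv': "eventually (\<lambda>\<gamma>. \<forall>t\<in>{ln a / m..ln b / m}. norm (z \<gamma> t) \<le> e) at_top" if "0 < e" for e
      using conv[OF that] by (simp add: a(2) b_def)
    have "eventually (\<lambda>\<gamma>. \<forall>s\<in>{a..b}. norm (Complex (u \<gamma> s - 1) (v \<gamma> s) - Complex (U s - 1) (V s)) \<le> \<mu>) at_top"
      by (rule radial_convergence[OF a(1) ab(3) conv' \<mu>])
    then have "eventually (\<lambda>\<gamma>. 0 < nth_crit (u \<gamma>) n \<and>
       (v \<gamma> S \<noteq> 0 \<longrightarrow> sgn (nth_crit (u \<gamma>) n - S) = (-1) ^ n * sgn (v \<gamma> S))) at_top"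
      using eventually_gt_at_top[of "2::real"]
    proof eventually_elim
      case (elim \<gamma>)
      have g1: "1 < \<gamma>" using elim by simp
      note rg = reg[OF g1]
      note solg = regular_radial[OF rg]
      define Zg where "Zg s = Complex (u \<gamma> s - 1) (v \<gamma> s)" for s
      have close: "norm (Zg s - Z s) \<le> \<mu>" if "s \<in> {a..b}" for s
        using elim(1) that by (simp add: Zg_def Z_def)
      have contg: "continuous_on {a..b} Zg"
        unfolding Zg_def Complex_eq using a
        by (intro continuous_intros continuous_on_subset[OF regular_u_continuous[OF rg]]
            continuous_on_subset[OF regular_v_continuous[OF rg]]) auto
      have quot: "norm (Zg s / Z s - 1) \<le> \<delta>" if s: "s \<in> {a..b}" for s
      proof -
        have nzs: "0 < norm (Z s)" using reim[of s] s by simp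
        have "norm (Zg s - Z s) \<le> norm (Z x0) * \<delta>" using close[OF s] by (simp add: \<mu>_def)
        also have "\<dots> \<le> norm (Z s) * \<delta>" using x0(2)[OF s] \<delta> by (intro mult_right_mono) auto
        finally have "norm (Zg s - Z s) / norm (Z s) \<le> \<delta>" using nzs by (simp add: divide_le_eq mult.commute)
        moreover have "Zg s / Z s - 1 = (Zg s - Z s) / Z s" using nzs by (simp add: diff_divide_distrib)
        ultimately show ?thesis by (simp add: norm_divide)
      qed
      \<comment> \<open>The angle of Z corrected by the principal argument of the quotient; this is
        continuous, as the quotient stays near 1.\<close>
      define \<phi> where "\<phi> s = \<psi> s + Im (Ln (Zg s / Z s))" for s
      have \<phi>_close: "\<bar>\<phi> s - \<psi> s\<bar> < e" if "s \<in> {a..b}" for s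
        using Ln_small(1)[OF quot[OF that]] by (simp add: \<phi>_def)
      have cont\<phi>: "continuous_on {a..b} \<phi>"
        unfolding \<phi>_def using reim Ln_small(2)[OF quot]
        by (intro continuous_intros continuous_on_subset[OF \<psi>(1)] contg contZ) fastforce+
      have polarg: "0 < norm (Zg s) \<and> u \<gamma> s - 1 = norm (Zg s) * cos (\<phi> s) \<and> v \<gamma> s = norm (Zg s) * sin (\<phi> s)"
        if s: "s \<in> {a..b}" for s
      proof -
        have nzs: "Z s \<noteq> 0" using reim[of s] s by auto
        have q0: "Zg s / Z s \<noteq> 0" using Ln_small(2)[OF quot[OF s]] by auto
        have "Zg s / Z s = of_real (norm (Zg s / Z s)) * cis (Im (Ln (Zg s / Z s)))"
          by (rule polar_of_exp) (simp add: exp_Ln[OF q0])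
        moreover have "Z s = of_real (norm (Z s)) * cis (\<psi> s)" using polar[of s] s by (simp only: Z_def atLeastAtMost_iff)
        ultimately have "Zg s / Z s * Z s = (of_real (norm (Zg s / Z s)) * cis (Im (Ln (Zg s / Z s)))) * (of_real (norm (Z s)) * cis (\<psi> s))"
          by metis
        also have "\<dots> = of_real (norm (Zg s / Z s) * norm (Z s)) * cis (\<phi> s)"
          by (simp add: \<phi>_def mult_ac flip: cis_mult)
        finally have "Zg s = of_real (norm (Zg s)) * cis (\<phi> s)" using nzs by (simp add: norm_divide)
        then have "Re (Zg s) = Re (of_real (norm (Zg s)) * cis (\<phi> s))" "Im (Zg s) = Im (of_real (norm (Zg s)) * cis (\<phi> s))"
          by metis+
        moreover have "Zg s \<noteq> 0" using q0 by auto
        ultimately show ?thesis by (simp add: Zg_def)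
      qed
      have posg: "0 < u \<gamma> s" if "0 \<le> s" for s by (rule regular_pos[OF rg that])
      have lg: "eventually (\<lambda>y. \<phi> x < \<phi> y) (at_left x)" if "a < x" "x \<le> b" "sin (\<phi> x) = 0" for x
        by (rule angle_crossing(1)[OF solg a(1) _ cont\<phi>, where r = "\<lambda>s. norm (Zg s)"])
          (use that a posg polarg in auto)
      have rg': "eventually (\<lambda>y. \<phi> y < \<phi> x) (at_right x)" if "a \<le> x" "x < b" "sin (\<phi> x) = 0" for x
        by (rule angle_crossing(2)[OF solg a(1) _ cont\<phi>, where r = "\<lambda>s. norm (Zg s)"])
          (use that a posg polarg in auto)
      have phia: "- pi < \<phi> a" "\<phi> a < 0" using \<phi>_close[of a] e ab by (auto simp: abs_less_iff)
      have phib: "\<phi> b < - real n * pi" using \<phi>_close[of b] e ab by (auto simp: abs_less_iff)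
      have "1 * pi \<le> real n * pi" using n by (intro mult_right_mono) auto
      then have na: "- real n * pi < \<phi> a" using phia by linarith
      have "\<exists>s\<ge>a. s \<le> b \<and> \<phi> s = - real n * pi"
        by (rule IVT2'[of \<phi> b "- real n * pi" a]) (use phib na ab cont\<phi> in auto)
      then obtain s' where s': "a \<le> s'" "s' \<le> b" "\<phi> s' = - real n * pi" by blast
      have "nth_crit (u \<gamma>) n = s'"
      proof (rule nth_crit_eq[OF cont\<phi> lg rg' a(1)])
        fix t assume t: "0 < t" "t \<le> a"
        have "1 < u \<gamma> x" if "0 < x" "x \<le> t" for x
          using u1[OF elim(2), of "ln x / m"] lt[of x] that t by simp
        then have "v \<gamma> t < 0" by (rule regular_v_neg[OF rg t(1)])
        then show "deriv (u \<gamma>) t \<noteq> 0" using DERIV_imp_deriv[OF regular_D(5)[OF rg t(1)]] by simp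
      next
        fix t assume t: "a \<le> t" "t \<le> b"
        then show "deriv (u \<gamma>) t = 0 \<longleftrightarrow> sin (\<phi> t) = 0"
          using DERIV_imp_deriv[OF regular_D(5)[OF rg, of t]] polarg[of t] a by auto
      qed (use phia s' n in auto)
      moreover have "sgn (s' - S) = (-1) ^ n * sgn (v \<gamma> S)" if vS: "v \<gamma> S \<noteq> 0"
      proof -
        \<comment> \<open>Position relative to the level -n \<pi>; as |q| < \<pi>, sin q has the
          sign of q.\<close>
        define q where "q = \<phi> S + real n * pi"
        have Sab: "S \<in> {a..b}" using ab by simp
        have q: "\<bar>q\<bar> < pi" using \<phi>_close[OF Sab] S e unfolding q_def by simp
        have "sin (\<phi> S) = sin (q - real n * pi)" by (simp add: q_def)
        also have "\<dots> = (-1) ^ n * sin q" by (simp add: sin_diff)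
        finally have vq: "v \<gamma> S = norm (Zg S) * ((-1) ^ n * sin q)" using polarg[OF Sab] by simp
        then have "sgn (v \<gamma> S) = (-1) ^ n * sgn (sin q)"
          using polarg[OF Sab] by (simp add: sgn_mult sgn_neg_one_power)
        then have sv: "(-1) ^ n * sgn (v \<gamma> S) = sgn (sin q)"
          by (simp flip: mult.assoc power_mult_distrib)
        have dc: "\<phi> t < \<phi> s" if "a \<le> s" "s < t" "t \<le> b" "sin (\<phi> s) = 0 \<or> sin (\<phi> t) = 0" for s t
          using down_crossing[OF cont\<phi> lg rg' that(1,2,3)] that(4) by blast
        have s0: "sin (\<phi> s') = 0" using s' by simp
        consider "0 < q" | "q < 0" | "q = 0" by linarith
        then show ?thesis
        proof cases
          case 1
          then have "\<phi> s' < \<phi> S" using s' by (simp add: q_def)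
          then have "S < s'" using dc[of s' S] s0 s' ab by (cases s' S rule: linorder_cases) auto
          moreover have "0 < sin q" using 1 q by (intro sin_gt_zero) auto
          ultimately show ?thesis unfolding sv by simp
        next
          case 2
          then have "\<phi> S < \<phi> s'" using s' by (simp add: q_def)
          then have "s' < S" using dc[of S s'] s0 s' ab by (cases s' S rule: linorder_cases) auto
          moreover have "0 < sin (- q)" using 2 q by (intro sin_gt_zero) auto
          ultimately show ?thesis unfolding sv by simp
        next
          case 3
          then show ?thesis using vq vS by simp
        qed
      qed
      ultimately show ?case using s' a by auto
    qed
    then show ?thesis using VS S a by simp
  qed
  then show "0 < S" "V S = 0"
    "eventually (\<lambda>\<gamma>. 0 < nth_crit (u \<gamma>) n \<and>
       (v \<gamma> S \<noteq> 0 \<longrightarrow> sgn (nth_crit (u \<gamma>) n - S) = (-1) ^ n * sgn (v \<gamma> S))) at_top"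
    by blast+
qed

theorem branch_oscillation:
  assumes n: "1 \<le> n"
  shows "\<exists>g :: nat \<Rightarrow> real. strict_mono g \<and> filterlim g at_top sequentially \<and> (\<forall>j. 1 < g j) \<and>
    (\<forall>j. lam u n (g j) \<noteq> lam_star N p y n) \<and>
    (\<forall>j. sgn (lam u n (g (Suc j)) - lam_star N p y n) = - sgn (lam u n (g j) - lam_star N p y n))"
proof -
  define S where "S = nth_crit U n"
  have S: "0 < S" "V S = 0" using crit_comparison[OF n] by (auto simp: S_def)
  obtain \<gamma>1 where \<gamma>1: "\<And>\<gamma>. \<gamma>1 \<le> \<gamma> \<Longrightarrow> 0 < nth_crit (u \<gamma>) n \<and>
       (v \<gamma> S \<noteq> 0 \<longrightarrow> sgn (nth_crit (u \<gamma>) n - S) = (-1) ^ n * sgn (v \<gamma> S))"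
    using crit_comparison(3)[OF n] by (auto simp: S_def eventually_at_top_linorder)
  show ?thesis
  proof (rule convergence_and_rotation[of "ln S / m"])
    fix t1 \<gamma>0 :: real and h :: "real \<Rightarrow> real"
    assume \<gamma>0: "2 \<le> \<gamma>0" and h: "continuous_on {\<gamma>0..} h" "filterlim h at_bot at_top"
      and polar: "\<And>\<gamma>. \<gamma>0 \<le> \<gamma> \<Longrightarrow> z \<gamma> (ln S / m) = of_real (norm (z \<gamma> (ln S / m))) * cis (h \<gamma>)"
    obtain g :: "nat \<Rightarrow> real" where g: "strict_mono g" "filterlim g at_top sequentially"
      "\<And>j. \<gamma>1 < g j" "\<And>j. \<gamma>0 \<le> g j" "\<And>j. cos (h (g j)) = 0" "\<And>j. sin (h (g j)) = (-1) ^ j"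
      using alternating_hits[OF h] by metis
    have g1: "1 < g j" for j using g(4)[of j] \<gamma>0 by simp
    \<comment> \<open>cos h = 0 puts z on the imaginary axis, and \<open>V S = 0\<close>; so v at S
      is a positive multiple of Im z, whose sign alternates with j.\<close>
    have sv: "sgn (v (g j) S) = (-1) ^ j" for j
    proof -
      define r where "r = norm (z (g j) (ln S / m))"
      have r: "0 < r" using z_nonzero[OF g1] by (simp add: r_def)
      have "z (g j) (ln S / m) = of_real r * cis (h (g j))" unfolding r_def by (rule polar[OF g(4)])
      then have "Re (z (g j) (ln S / m)) = 0" "Im (z (g j) (ln S / m)) = r * (-1) ^ j"
        using g(5,6)[of j] by simp_all
      then have "v (g j) S = A * S powr (- th - 1) / m * (r * (-1) ^ j)"
        using radial_difference(2)[OF g1 S(1), of j] S(2) by simp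
      then show ?thesis using A_pos m_pos S r by (simp add: sgn_mult sgn_neg_one_power)
    qed
    have sl: "sgn (lam u n (g j) - lam_star N p y n) = (-1) ^ n * (-1) ^ j" for j
    proof -
      define s where "s = nth_crit (u (g j)) n"
      have "v (g j) S \<noteq> 0" using sv[of j] by auto
      then have s: "0 < s" "sgn (s - S) = (-1) ^ n * (-1) ^ j"
        using \<gamma>1[of "g j"] g(3)[of j] sv[of j] by (auto simp: s_def)
      have "lam u n (g j) - lam_star N p y n = (s - S) * (s + S)"
        by (simp add: lam_def lam_star_def s_def S_def power2_eq_square algebra_simps)
      then show ?thesis using s S by (simp add: sgn_mult)
    qed
    have "lam u n (g j) \<noteq> lam_star N p y n" for j using sl[of j] by auto
    then show ?thesis using g(1,2) g1 sl by (intro exI[of _ g]) auto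
  qed
qed

end

theorem theorem6p1:
  fixes N n :: nat and p :: real
    and u :: "real \<Rightarrow> real \<Rightarrow> real" and y :: "real \<Rightarrow> real"
  assumes "N \<ge> 3" and "p_S N < p" and "below_p_JL N p" and "n \<ge> 1"
    and "\<forall>gamma>1. radial_ivp N p gamma (u gamma)"
    and "sing_profile N p y"
  shows "\<exists>g :: nat \<Rightarrow> real. strict_mono g \<and> filterlim g at_top sequentially \<and>
           (\<forall>j. g j > 1) \<and>
           (\<forall>j. lam u n (g j) \<noteq> lam_star N p y n) \<and>
           (\<forall>j. sgn (lam u n (g (Suc j)) - lam_star N p y n)
                = - sgn (lam u n (g j) - lam_star N p y n))"
proof -
  interpret exponents N p by unfold_locales (use assms in auto)
  obtain w where w: "ef_solution y w" "(y \<longlongrightarrow> 1) at_bot"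
    using sing_profile_ef[OF assms(6)] .
  have "\<forall>gamma. \<exists>v. 1 < gamma \<longrightarrow> regular gamma (u gamma) v"
    using assms(5) unfolding radial_ivp_def regular_def by blast
  then obtain v where v: "\<And>gamma. 1 < gamma \<Longrightarrow> regular gamma (u gamma) (v gamma)" by metis
  interpret singular_limit N p u v y w by unfold_locales (use v w in auto)
  show ?thesis by (rule branch_oscillation[OF assms(4)])
qed

end
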